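(* Let $\sigma$ be a real non-singular matrix of order $d$, let $b(z)=Cz+K$ with $K\in\mathbb{R}^d$ and $C$ a real matrix of order $d$, and let $F(z,x)=F(0,x)$ depend only on $x\in\{x \in \mathbb{R}^d: 0<|x|<1\}$ and satisfy $$\int_{0<|x|<1}|F(0,x)|^2\nu(dx)<\infty,\qquad \sup_{0<|x|<1}|F(0,x)|<\infty.$$ Let $p>\frac d4$ and $\psi\in L^1(\mathbb{R}^d)$. Then for every $\omega\in\Omega\setminus\mathcal{N}$ and $t\ge0$, the distribution $Y_t(\psi)$ is given by the $L^1(\mathbb{R}^d)$ function $$e^{-t\,\mathrm{tr}(C)}\,\tau_{Z^0_t}\psi_t(\cdot),$$ where $\psi_t(z):=\psi(e^{-tC}z)$ for $t\ge0$, $z\in\mathbb{R}^d$, and $\mathrm{tr}(C)$ is the trace of the matrix $C$.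
   Context: $(\Omega,\mathcal{F},(\mathcal{F}_t)_t,\mathbb{P})$ is a complete filtered probability space satisfying the usual conditions; $B$ is a standard $d$-dimensional $(\mathcal{F}_t)_t$ Brownian motion; $N$ is a Poisson random measure (with respect to the same filtration) with Lévy measure $\nu$ on $\mathbb{R}^d\setminus\{0\}$ (intensity $dt\,\nu(dx)$), $\widetilde N$ its compensated version; $B$ and $N$ are independent. $\mathcal{S}(\mathbb{R}^d)$ is the space of real rapidly decreasing smooth functions. For $p\in\mathbb{R}$ the Hermite–Sobolev space $\mathcal{S}_p(\mathbb{R}^d)$ is the completion of $\mathcal{S}(\mathbb{R}^d)$ in the inner product $\langle f,g\rangle_p=\sum_{n\in\mathbb{Z}_+^d}(2|n|+d)^{2p}\langle f,h_n\rangle\langle g,h_n\rangle$, where $h_n$ are the $L^2$-normalized Hermite functions on $\mathbb{R}^d$, $|n|=n_1+\dots+n_d$, and $\langle\cdot,\cdot\rangle$ is the $L^2$ inner product; $\mathcal{S}_{-p}(\mathbb{R}^d)$ is the dual of $\mathcal{S}_p(\mathbb{R}^d)$. For $p>\frac d4$, $\sup_z\|\delta_z\|_{-p}<\infty$, where $\delta_z$ is the Dirac distribution at $z$. Translation: $(\tau_xg)(y)=g(y-x)$. $\mathcal{N}$ is a fixed $\mathbb{P}$-null set such that for all $\omega\in\Omega\setminus\mathcal{N}$ and $t\ge0$ $$Z^0_t=\int_0^t\sigma\,dB_s+\int_0^t(CZ^0_{s-}+K)\,ds+\int_0^t\int_{0<|x|<1}F(0,x)\,\widetilde N(ds,dx),$$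 and $Z^z_t:=Z^0_t+e^{tC}z$ for $z\in\mathbb{R}^d$. For $\omega\in\Omega\setminus\mathcal{N}$, $Y_t(\omega)(\psi):=\int_{\mathbb{R}^d}\psi(z)\,\delta_{Z^z_t(\omega)}\,dz$ (an $\mathcal{S}_{-p}(\mathbb{R}^d)$-valued integral), so that $\langle Y_t(\psi),\phi\rangle=\int_{\mathbb{R}^d}\psi(z)\phi(Z^z_t)\,dz$ for $\phi\in\mathcal{S}(\mathbb{R}^d)$. A distribution $T$ is given by an $L^1$ function $g$ if $\langle T,\phi\rangle=\int_{\mathbb{R}^d} g\phi\,dz$ for all $\phi\in\mathcal{S}(\mathbb{R}^d)$. *)

theory Defs
  imports "HOL-Probability.Probability"
begin

section \<open>Rapidly decreasing smooth functions\<close>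

definition partial_deriv :: "'d::finite \<Rightarrow> (real^'d \<Rightarrow> real) \<Rightarrow> real^'d \<Rightarrow> real" where
  "partial_deriv i f x = frechet_derivative f (at x) (axis i 1)"

primrec iter_partial :: "'d::finite list \<Rightarrow> (real^'d \<Rightarrow> real) \<Rightarrow> real^'d \<Rightarrow> real" where
  "iter_partial [] f = f"
| "iter_partial (i # is) f = partial_deriv i (iter_partial is f)"

text \<open>Differentiability of all iterated partial derivatives is the same as being C-infinity.\<close>

definition smooth :: "(real^'d::finite \<Rightarrow> real) \<Rightarrow> bool" where
  "smooth f \<longleftrightarrow> (\<forall>is x. iter_partial is f differentiable (at x))"

definition rapidly_decreasing :: "(real^'d::finite \<Rightarrow> real) \<Rightarrow> bool" where
  "rapidly_decreasing f \<longleftrightarrow>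
     (\<forall>is k. bounded (range (\<lambda>x. norm x ^ k * iter_partial is f x)))"

lemma partial_deriv_lin:
  fixes f g :: "real^'d::finite \<Rightarrow> real"
  assumes "f differentiable (at x)" "g differentiable (at x)"
  shows "partial_deriv i (\<lambda>x. a * f x + b * g x) x
         = a * partial_deriv i f x + b * partial_deriv i g x"
proof -
  have "(f has_derivative frechet_derivative f (at x)) (at x)"
    and "(g has_derivative frechet_derivative g (at x)) (at x)"
    using assms by (simp_all add: frechet_derivative_works)
  then have "((\<lambda>x. a * f x + b * g x) has_derivative
      (\<lambda>h. a * frechet_derivative f (at x) h + b * frechet_derivative g (at x) h)) (at x)"
    by (auto intro!: derivative_eq_intros)
  from frechet_derivative_at[OF this] show ?thesis
    unfolding partial_deriv_def by (metis (no_types))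
qed

lemma iter_partial_lin:
  assumes "smooth f" "smooth g"
  shows "iter_partial is (\<lambda>x. a * f x + b * g x)
         = (\<lambda>x. a * iter_partial is f x + b * iter_partial is g x)"
  using assms by (induction "is") (auto simp: smooth_def partial_deriv_lin intro!: ext)

lemma smooth_lin:
  assumes "smooth f" "smooth g"
  shows "smooth (\<lambda>x. a * f x + b * g x)"
  unfolding smooth_def iter_partial_lin[OF assms]
  using assms by (auto simp: smooth_def)

lemma rapidly_decreasing_lin:
  assumes "smooth f" "smooth g" "rapidly_decreasing f" "rapidly_decreasing g"
  shows "rapidly_decreasing (\<lambda>x. a * f x + b * g x)"
  unfolding rapidly_decreasing_def iter_partial_lin[OF assms(1,2)]
proof (intro allI)
  fix "is" k
  from assms(3) obtain A where A: "\<And>x. \<bar>norm x ^ k * iter_partial is f x\<bar> \<le> A"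
    unfolding rapidly_decreasing_def bounded_iff real_norm_def by blast
  from assms(4) obtain B where B: "\<And>x. \<bar>norm x ^ k * iter_partial is g x\<bar> \<le> B"
    unfolding rapidly_decreasing_def bounded_iff real_norm_def by blast
  have "\<bar>norm x ^ k * (a * iter_partial is f x + b * iter_partial is g x)\<bar>
        \<le> \<bar>a\<bar> * A + \<bar>b\<bar> * B" for x
  proof -
    have "norm x ^ k * (a * iter_partial is f x + b * iter_partial is g x)
       = a * (norm x ^ k * iter_partial is f x) + b * (norm x ^ k * iter_partial is g x)"
      by (simp add: algebra_simps)
    moreover have "\<bar>a * (norm x ^ k * iter_partial is f x)\<bar> \<le> \<bar>a\<bar> * A"
      unfolding abs_mult[of a] by (rule mult_left_mono[OF A]) simp
    moreover have "\<bar>b * (norm x ^ k * iter_partial is g x)\<bar> \<le> \<bar>b\<bar> * B"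
      unfolding abs_mult[of b] by (rule mult_left_mono[OF B]) simp
    ultimately show ?thesis by linarith
  qed
  then show "bounded (range (\<lambda>x. norm x ^ k * (a * iter_partial is f x + b * iter_partial is g x)))"
    unfolding bounded_iff by auto
qed

lemma schwartz_zero: "smooth (\<lambda>_::real^'d::finite. 0)" "rapidly_decreasing (\<lambda>_::real^'d. 0)"
proof -
  have "partial_deriv i (\<lambda>_. 0) = (\<lambda>_. 0)" for i :: 'd
    by (simp add: partial_deriv_def fun_eq_iff)
  then have "iter_partial is (\<lambda>_. 0) = (\<lambda>_. 0)" for "is" :: "'d list"
    by (induction "is") simp_all
  then show "smooth (\<lambda>_::real^'d. 0)" "rapidly_decreasing (\<lambda>_::real^'d. 0)"
    by (auto simp: smooth_def rapidly_decreasing_def)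
qed

lemma schwartz_lin:
  assumes "smooth f \<and> rapidly_decreasing f" "smooth g \<and> rapidly_decreasing g"
  shows "smooth (\<lambda>x. a * f x + b * g x) \<and> rapidly_decreasing (\<lambda>x. a * f x + b * g x)"
  using assms by (simp add: smooth_lin rapidly_decreasing_lin)

typedef (overloaded) 'd schwartz =
  "{f :: real^'d::finite \<Rightarrow> real. smooth f \<and> rapidly_decreasing f}"
  morphisms sfun Abs_schwartz
  using schwartz_zero by blast

setup_lifting type_definition_schwartz

instantiation schwartz :: (finite) real_vector
begin

lift_definition zero_schwartz :: "'a schwartz" is "\<lambda>_. 0"
  by (simp add: schwartz_zero)

lift_definition plus_schwartz :: "'a schwartz \<Rightarrow> 'a schwartz \<Rightarrow> 'a schwartz"
  is "\<lambda>f g x. f x + g x"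
  subgoal for f g using schwartz_lin[of f g 1 1] by simp
  done

lift_definition minus_schwartz :: "'a schwartz \<Rightarrow> 'a schwartz \<Rightarrow> 'a schwartz"
  is "\<lambda>f g x. f x - g x"
  subgoal for f g using schwartz_lin[of f g 1 "-1"] by simp
  done

lift_definition uminus_schwartz :: "'a schwartz \<Rightarrow> 'a schwartz" is "\<lambda>f x. - f x"
  subgoal for f using schwartz_lin[of f f "-1" 0] by simp
  done

lift_definition scaleR_schwartz :: "real \<Rightarrow> 'a schwartz \<Rightarrow> 'a schwartz" is "\<lambda>c f x. c * f x"
  subgoal for c f using schwartz_lin[of f f c 0] by simp
  done

instance
  by standard (transfer; simp add: algebra_simps fun_eq_iff)+

end

section \<open>Hermite--Sobolev spaces\<close>

text \<open>Physicists' Hermite polynomials.\<close>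

fun hermite_poly :: "nat \<Rightarrow> real \<Rightarrow> real" where
  "hermite_poly 0 x = 1"
| "hermite_poly (Suc 0) x = 2 * x"
| "hermite_poly (Suc (Suc n)) x =
     2 * x * hermite_poly (Suc n) x - 2 * real (Suc n) * hermite_poly n x"

definition hermite1 :: "nat \<Rightarrow> real \<Rightarrow> real" where
  "hermite1 n x = hermite_poly n x * exp (- x\<^sup>2 / 2) / sqrt (2 ^ n * fact n * sqrt pi)"

definition hermite_fun :: "('d::finite \<Rightarrow> nat) \<Rightarrow> real^'d \<Rightarrow> real" where
  "hermite_fun n x = (\<Prod>i\<in>UNIV. hermite1 (n i) (x $ i))"

definition hermite_coeff :: "'d::finite schwartz \<Rightarrow> ('d \<Rightarrow> nat) \<Rightarrow> real" where
  "hermite_coeff \<phi> n = (\<integral>x. sfun \<phi> x * hermite_fun n x \<partial>lborel)"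

definition hs_inner :: "real \<Rightarrow> 'd::finite schwartz \<Rightarrow> 'd schwartz \<Rightarrow> real" where
  "hs_inner p \<phi> \<theta> =
     infsum (\<lambda>n. real (2 * (\<Sum>i\<in>UNIV. n i) + CARD('d)) powr (2 * p)
        * hermite_coeff \<phi> n * hermite_coeff \<theta> n) UNIV"

definition hs_norm :: "real \<Rightarrow> 'd::finite schwartz \<Rightarrow> real" where
  "hs_norm p \<phi> = sqrt (hs_inner p \<phi> \<phi>)"

text \<open>
  The Hermite--Sobolev space of order p is the completion of the Schwartz space in
  \<^const>\<open>hs_norm\<close> p. Continuous functionals on a completion are the same, isometrically, as
  continuous functionals on the dense subspace, so its dual (the space of order -p) is
  represented by the linear functionals on the Schwartz space that are bounded for
  \<^const>\<open>hs_norm\<close> p. The carrier depends on the real number p and hence is a set, not a type.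
\<close>

type_synonym 'd dist = "'d schwartz \<Rightarrow> real"

definition hs_dual :: "real \<Rightarrow> 'd::finite dist set" where
  "hs_dual p = {T. linear T \<and> (\<exists>K. \<forall>\<phi>. \<bar>T \<phi>\<bar> \<le> K * hs_norm p \<phi>)}"

definition dual_norm :: "real \<Rightarrow> 'd::finite dist \<Rightarrow> real" where
  "dual_norm p T = (SUP \<phi>\<in>{\<phi>. hs_norm p \<phi> \<le> 1}. \<bar>T \<phi>\<bar>)"

definition dirac :: "real^'d::finite \<Rightarrow> 'd dist" where
  "dirac z = (\<lambda>\<phi>. sfun \<phi> z)"

text \<open>
  Bochner integral with values in \<^term>\<open>hs_dual p\<close>. This repeats the library's
  \<^const>\<open>has_bochner_integral\<close>, which needs the codomain to be a normed type.
\<close>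

definition hs_simple :: "real \<Rightarrow> 'a measure \<Rightarrow> ('a \<Rightarrow> 'd::finite dist) \<Rightarrow> bool" where
  "hs_simple p M s \<longleftrightarrow> simple_function M s \<and> (\<forall>z\<in>space M. s z \<in> hs_dual p) \<and>
     emeasure M {z \<in> space M. s z \<noteq> (\<lambda>_. 0)} \<noteq> \<infinity>"

definition hs_simple_integral :: "'a measure \<Rightarrow> ('a \<Rightarrow> 'd::finite dist) \<Rightarrow> 'd dist" where
  "hs_simple_integral M s = (\<lambda>\<phi>. \<Sum>T\<in>s ` space M. measure M {z \<in> space M. s z = T} * T \<phi>)"

definition has_hs_integral ::
  "real \<Rightarrow> 'a measure \<Rightarrow> ('a \<Rightarrow> 'd::finite dist) \<Rightarrow> 'd dist \<Rightarrow> bool" where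
  "has_hs_integral p M f I \<longleftrightarrow>
     I \<in> hs_dual p \<and> (\<forall>z\<in>space M. f z \<in> hs_dual p) \<and>
     (\<exists>s :: nat \<Rightarrow> 'a \<Rightarrow> 'd dist.
        (\<forall>i. hs_simple p M (s i)) \<and>
        (\<forall>i. (\<lambda>z. dual_norm p (\<lambda>\<phi>. f z \<phi> - s i z \<phi>)) \<in> borel_measurable M) \<and>
        (\<lambda>i. \<integral>\<^sup>+z. ennreal (dual_norm p (\<lambda>\<phi>. f z \<phi> - s i z \<phi>)) \<partial>M) \<longlonglongrightarrow> 0 \<and>
        (\<lambda>i. dual_norm p (\<lambda>\<phi>. I \<phi> - hs_simple_integral M (s i) \<phi>)) \<longlonglongrightarrow> 0)"

definition hs_integral :: "real \<Rightarrow> 'a measure \<Rightarrow> ('a \<Rightarrow> 'd::finite dist) \<Rightarrow> 'd dist" where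
  "hs_integral p M f = (THE I. has_hs_integral p M f I)"

definition given_by_L1 :: "'d::finite dist \<Rightarrow> (real^'d \<Rightarrow> real) \<Rightarrow> bool" where
  "given_by_L1 T g \<longleftrightarrow>
     integrable lebesgue g \<and> (\<forall>\<phi>. T \<phi> = (\<integral>z. g z * sfun \<phi> z \<partial>lebesgue))"

definition translate :: "real^'d::finite \<Rightarrow> (real^'d \<Rightarrow> real) \<Rightarrow> real^'d \<Rightarrow> real" where
  "translate x g = (\<lambda>y. g (y - x))"

section \<open>Matrix exponential\<close>

text \<open>The library's \<open>*\<close> and \<open>^\<close> on vectors of vectors are componentwise, so matrix powers
  are iterated from \<open>**\<close>.\<close>

definition mat_exp :: "real^'d::finite^'d \<Rightarrow> real^'d^'d" where
  "mat_exp A = (\<Sum>n. (1 / fact n) *\<^sub>R (((**) A) ^^ n) (mat 1))"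

section \<open>Stochastic basis, Brownian motion, Poisson random measure\<close>

text \<open>Processes and filtrations are indexed by the reals; only times \<open>t \<ge> 0\<close> matter.\<close>

locale usual_filtered_prob_space = prob_space M + complete_measure M for M :: "'w measure" +
  fixes F :: "real \<Rightarrow> 'w measure"
  assumes subalg: "\<And>t. 0 \<le> t \<Longrightarrow> subalgebra M (F t)"
    and mono: "\<And>s t. 0 \<le> s \<Longrightarrow> s \<le> t \<Longrightarrow> sets (F s) \<subseteq> sets (F t)"
    and right_cont: "\<And>t. 0 \<le> t \<Longrightarrow> sets (F t) = (\<Inter>s\<in>{t<..}. sets (F s))"
    and null_sets_F0: "null_sets M \<subseteq> sets (F 0)"

definition cadlag :: "(real \<Rightarrow> 'a::topological_space) \<Rightarrow> bool" where
  "cadlag x \<longleftrightarrow> (\<forall>t\<ge>0. (x \<longlongrightarrow> x t) (at_right t)) \<and> (\<forall>t>0. \<exists>l. (x \<longlongrightarrow> l) (at_left t))"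

definition left_lim :: "(real \<Rightarrow> 'a::t2_space) \<Rightarrow> real \<Rightarrow> 'a" where
  "left_lim x t = Lim (at_left t) x"

definition adapted :: "(real \<Rightarrow> 'w measure) \<Rightarrow> (real \<Rightarrow> 'w \<Rightarrow> 'a::topological_space) \<Rightarrow> bool" where
  "adapted F X \<longleftrightarrow> (\<forall>t\<ge>0. X t \<in> borel_measurable (F t))"

definition brownian_motion ::
  "'w measure \<Rightarrow> (real \<Rightarrow> 'w measure) \<Rightarrow> (real \<Rightarrow> 'w \<Rightarrow> real^'d::finite) \<Rightarrow> bool" where
  "brownian_motion M F B \<longleftrightarrow>
     adapted F B \<and> (AE \<omega> in M. B 0 \<omega> = 0) \<and> (AE \<omega> in M. continuous_on {0..} (\<lambda>t. B t \<omega>)) \<and>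
     (\<forall>s t. 0 \<le> s \<and> s < t \<longrightarrow>
        distributed M lborel (\<lambda>\<omega>. B t \<omega> - B s \<omega>)
          (\<lambda>x. ennreal (\<Prod>i\<in>UNIV. normal_density 0 (sqrt (t - s)) (x $ i))) \<and>
        prob_space.indep_set M (sets (F s))
          {(\<lambda>\<omega>. B t \<omega> - B s \<omega>) -` A \<inter> space M | A. A \<in> sets borel})"

text \<open>Measures on the punctured space are Borel measures on the whole space that do not
  charge the origin.\<close>

definition levy_measure :: "(real^'d::finite) measure \<Rightarrow> bool" where
  "levy_measure \<nu> \<longleftrightarrow> sets \<nu> = sets borel \<and> emeasure \<nu> {0} = 0 \<and>
     (\<integral>\<^sup>+x. ennreal (min 1 ((norm x)\<^sup>2)) \<partial>\<nu>) < \<infinity>"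

definition intensity :: "(real^'d::finite) measure \<Rightarrow> (real \<times> (real^'d)) measure" where
  "intensity \<nu> = density lborel (indicator {0..}) \<Otimes>\<^sub>M \<nu>"

definition poisson_random_measure ::
  "'w measure \<Rightarrow> (real \<Rightarrow> 'w measure) \<Rightarrow> (real^'d::finite) measure \<Rightarrow>
   ('w \<Rightarrow> (real \<times> (real^'d)) measure) \<Rightarrow> bool" where
  "poisson_random_measure M F \<nu> N \<longleftrightarrow>
     (\<forall>\<omega>\<in>space M. sets (N \<omega>) = sets borel \<and> emeasure (N \<omega>) (- ({0..} \<times> (- {0}))) = 0 \<and>
        (\<forall>A\<in>sets borel. emeasure (N \<omega>) A \<in> insert \<infinity> (range of_nat))) \<and>
     (\<forall>A\<in>sets borel. (\<lambda>\<omega>. emeasure (N \<omega>) A) \<in> borel_measurable M) \<and>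
     (\<forall>A\<in>sets borel. emeasure (intensity \<nu>) A < \<infinity> \<longrightarrow>
        (\<forall>k. measure M {\<omega> \<in> space M. emeasure (N \<omega>) A = of_nat k} =
           measure (intensity \<nu>) A ^ k / fact k * exp (- measure (intensity \<nu>) A))) \<and>
     (\<forall>A :: nat \<Rightarrow> _ set. disjoint_family A \<and> range A \<subseteq> sets borel \<longrightarrow>
        prob_space.indep_vars M (\<lambda>_. borel) (\<lambda>i \<omega>. emeasure (N \<omega>) (A i)) UNIV) \<and>
     (\<forall>t\<ge>0. \<forall>A\<in>sets borel. A \<subseteq> {0..t} \<times> UNIV \<longrightarrow>
        (\<lambda>\<omega>. emeasure (N \<omega>) A) \<in> borel_measurable (F t)) \<and>
     (\<forall>t\<ge>0. prob_space.indep_set M (sets (F t))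
        (sigma_sets (space M) {(\<lambda>\<omega>. emeasure (N \<omega>) A) -` U \<inter> space M | A U.
           A \<in> sets borel \<and> A \<subseteq> {t<..} \<times> UNIV \<and> U \<in> sets borel}))"

definition independent_BN ::
  "'w measure \<Rightarrow> (real \<Rightarrow> 'w \<Rightarrow> real^'d::finite) \<Rightarrow> ('w \<Rightarrow> (real \<times> (real^'d)) measure) \<Rightarrow> bool"
  where
  "independent_BN M B N \<longleftrightarrow> prob_space.indep_set M
     (sigma_sets (space M) {B t -` U \<inter> space M | t U. 0 \<le> t \<and> U \<in> sets borel})
     (sigma_sets (space M) {(\<lambda>\<omega>. emeasure (N \<omega>) A) -` U \<inter> space M | A U.
        A \<in> sets borel \<and> U \<in> sets borel})"

section \<open>Stochastic integrals\<close>

text \<open>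
  Both integrals are the usual extensions by L2-isometry from simple predictable integrands.
  A simple integrand is a list of tuples \<open>(a, b, \<xi>)\<close>, resp. \<open>(a, b, A, \<xi>)\<close>, standing for the sum
  of the functions \<open>\<xi> 1_(a,b](s)\<close>, resp. \<open>\<xi> 1_(a,b](s) 1_A(x)\<close>. The integral process is
  determined up to indistinguishability; the predicates say that X is one of its versions.
\<close>

type_synonym ('w, 'd) simpleB = "(real \<times> real \<times> ('w \<Rightarrow> real^'d^'d)) list"
type_synonym ('w, 'd) simpleN = "(real \<times> real \<times> (real^'d) set \<times> ('w \<Rightarrow> real^'d)) list"

definition simpleB_ok ::
  "'w measure \<Rightarrow> (real \<Rightarrow> 'w measure) \<Rightarrow> ('w, 'd::finite) simpleB \<Rightarrow> bool" where
  "simpleB_ok M F S \<longleftrightarrow> (\<forall>(a, b, \<xi>)\<in>set S. 0 \<le> a \<and> a \<le> b \<and>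
     \<xi> \<in> borel_measurable (F a) \<and> bounded (\<xi> ` space M))"

definition simpleB_fun :: "('w, 'd::finite) simpleB \<Rightarrow> real \<Rightarrow> 'w \<Rightarrow> real^'d^'d" where
  "simpleB_fun S s \<omega> = (\<Sum>(a, b, \<xi>)\<leftarrow>S. indicator {a<..b} s *\<^sub>R \<xi> \<omega>)"

definition simpleB_int ::
  "(real \<Rightarrow> 'w \<Rightarrow> real^'d) \<Rightarrow> ('w, 'd::finite) simpleB \<Rightarrow> real \<Rightarrow> 'w \<Rightarrow> real^'d" where
  "simpleB_int B S t \<omega> = (\<Sum>(a, b, \<xi>)\<leftarrow>S. \<xi> \<omega> *v (B (min t b) \<omega> - B (min t a) \<omega>))"

definition is_ito_integral ::
  "'w measure \<Rightarrow> (real \<Rightarrow> 'w measure) \<Rightarrow> (real \<Rightarrow> 'w \<Rightarrow> real^'d::finite) \<Rightarrow>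
   (real \<Rightarrow> 'w \<Rightarrow> real^'d^'d) \<Rightarrow> (real \<Rightarrow> 'w \<Rightarrow> real^'d) \<Rightarrow> bool" where
  "is_ito_integral M F B H X \<longleftrightarrow>
     (\<lambda>(s, \<omega>). H s \<omega>) \<in> borel_measurable (restrict_space lborel {0..} \<Otimes>\<^sub>M M) \<and>
     adapted F X \<and> (AE \<omega> in M. continuous_on {0..} (\<lambda>t. X t \<omega>)) \<and>
     (\<exists>S :: nat \<Rightarrow> ('w, 'd) simpleB. (\<forall>n. simpleB_ok M F (S n)) \<and>
        (\<forall>T\<ge>0.
          (\<lambda>n. \<integral>\<^sup>+\<omega>. (\<integral>\<^sup>+s\<in>{0..T}. ennreal ((norm (H s \<omega> - simpleB_fun (S n) s \<omega>))\<^sup>2) \<partial>lborel) \<partial>M)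
            \<longlonglongrightarrow> 0 \<and>
          (\<lambda>n. \<integral>\<^sup>+\<omega>. ennreal ((norm (X T \<omega> - simpleB_int B (S n) T \<omega>))\<^sup>2) \<partial>M) \<longlonglongrightarrow> 0))"

definition simpleN_ok ::
  "'w measure \<Rightarrow> (real \<Rightarrow> 'w measure) \<Rightarrow> (real^'d) measure \<Rightarrow> (real^'d) set \<Rightarrow>
   ('w, 'd::finite) simpleN \<Rightarrow> bool" where
  "simpleN_ok M F \<nu> E S \<longleftrightarrow> (\<forall>(a, b, A, \<xi>)\<in>set S. 0 \<le> a \<and> a \<le> b \<and>
     A \<in> sets borel \<and> A \<subseteq> E \<and> emeasure \<nu> A < \<infinity> \<and>
     \<xi> \<in> borel_measurable (F a) \<and> bounded (\<xi> ` space M))"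

definition simpleN_fun ::
  "('w, 'd::finite) simpleN \<Rightarrow> real \<Rightarrow> real^'d \<Rightarrow> 'w \<Rightarrow> real^'d" where
  "simpleN_fun S s x \<omega> =
     (\<Sum>(a, b, A, \<xi>)\<leftarrow>S. (indicator {a<..b} s * indicator A x) *\<^sub>R \<xi> \<omega>)"

definition simpleN_int ::
  "(real^'d) measure \<Rightarrow> ('w \<Rightarrow> (real \<times> (real^'d)) measure) \<Rightarrow> ('w, 'd::finite) simpleN \<Rightarrow>
   real \<Rightarrow> 'w \<Rightarrow> real^'d" where
  "simpleN_int \<nu> N S t \<omega> = (\<Sum>(a, b, A, \<xi>)\<leftarrow>S.
     (measure (N \<omega>) ({min t a<..min t b} \<times> A)
       - measure (intensity \<nu>) ({min t a<..min t b} \<times> A)) *\<^sub>R \<xi> \<omega>)"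

definition is_compensated_poisson_integral ::
  "'w measure \<Rightarrow> (real \<Rightarrow> 'w measure) \<Rightarrow> (real^'d::finite) measure \<Rightarrow>
   ('w \<Rightarrow> (real \<times> (real^'d)) measure) \<Rightarrow> (real^'d) set \<Rightarrow>
   (real \<Rightarrow> real^'d \<Rightarrow> 'w \<Rightarrow> real^'d) \<Rightarrow> (real \<Rightarrow> 'w \<Rightarrow> real^'d) \<Rightarrow> bool" where
  "is_compensated_poisson_integral M F \<nu> N E H X \<longleftrightarrow>
     (\<lambda>((s, x), \<omega>). H s x \<omega>) \<in> borel_measurable
        ((restrict_space lborel {0..} \<Otimes>\<^sub>M restrict_space \<nu> E) \<Otimes>\<^sub>M M) \<and>
     adapted F X \<and> (AE \<omega> in M. cadlag (\<lambda>t. X t \<omega>)) \<and>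
     (\<exists>S :: nat \<Rightarrow> ('w, 'd) simpleN. (\<forall>n. simpleN_ok M F \<nu> E (S n)) \<and>
        (\<forall>T\<ge>0.
          (\<lambda>n. \<integral>\<^sup>+\<omega>. (\<integral>\<^sup>+s\<in>{0..T}. (\<integral>\<^sup>+x\<in>E.
               ennreal ((norm (H s x \<omega> - simpleN_fun (S n) s x \<omega>))\<^sup>2) \<partial>\<nu>) \<partial>lborel) \<partial>M)
            \<longlonglongrightarrow> 0 \<and>
          (\<lambda>n. \<integral>\<^sup>+\<omega>. ennreal ((norm (X T \<omega> - simpleN_int \<nu> N (S n) T \<omega>))\<^sup>2) \<partial>M) \<longlonglongrightarrow> 0))"

section \<open>The flow and the distribution-valued process\<close>

definition affine_flow ::
  "real^'d::finite^'d \<Rightarrow> (real \<Rightarrow> 'w \<Rightarrow> real^'d) \<Rightarrow> real^'d \<Rightarrow> real \<Rightarrow> 'w \<Rightarrow> real^'d" where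
  "affine_flow C Z0 z t \<omega> = Z0 t \<omega> + mat_exp (t *\<^sub>R C) *v z"

definition Y_dist ::
  "real \<Rightarrow> real^'d::finite^'d \<Rightarrow> (real \<Rightarrow> 'w \<Rightarrow> real^'d) \<Rightarrow> (real^'d \<Rightarrow> real) \<Rightarrow>
   real \<Rightarrow> 'w \<Rightarrow> 'd dist" where
  "Y_dist p C Z0 \<psi> t \<omega> =
     hs_integral p lebesgue (\<lambda>z \<phi>. \<psi> z * dirac (affine_flow C Z0 z t \<omega>) \<phi>)"

definition psi_t :: "real^'d::finite^'d \<Rightarrow> (real^'d \<Rightarrow> real) \<Rightarrow> real \<Rightarrow> real^'d \<Rightarrow> real" where
  "psi_t C \<psi> t z = \<psi> (mat_exp ((- t) *\<^sub>R C) *v z)"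

end

theory Submission
  imports Defs
begin

text \<open>
  Tested against a rapidly decreasing \<open>\<phi>\<close>, the distribution \<open>Y\<^sub>t(\<psi>)\<close> should be the
  integral of \<open>\<psi>(z) \<phi>(Z\<^sup>0\<^sub>t + e\<^sup>t\<^sup>C z)\<close> over \<open>z\<close>. The substitution \<open>y = Z\<^sup>0\<^sub>t + e\<^sup>t\<^sup>C z\<close>, whose Jacobian
  is \<open>exp (t tr C)\<close>, moves the flow from \<open>\<phi>\<close> onto \<open>\<psi>\<close> and gives the claim. Here
  \<open>\<omega>\<close> and \<open>t\<close> are fixed, so \<open>Z\<^sup>0\<^sub>t\<close> is a fixed vector. Two points need an argument.

  The first is that the integral of \<open>\<psi>(z) \<delta>\<^sub>w\<^sub>(\<^sub>z\<^sub>)\<close> with \<open>w(z) = Z\<^sup>0\<^sub>t + e\<^sup>t\<^sup>C z\<close> exists as a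
  Bochner integral for the norm of order \<open>-p\<close> and may be tested under the integral sign (\<open>hs_integral_dirac_eq\<close>). For this, \<open>z \<mapsto> \<delta>\<^sub>z\<close> has to
  be bounded and continuous in that norm (\<open>dirac_bound\<close>, \<open>dirac_continuous\<close>). A rapidly decreasing
  function is the sum of its Hermite series (\<open>schwartz_hermite_expansion\<close>, from the completeness
  result \<open>hermite_complete\<close>), so by Cauchy-Schwarz \<open>\<bar>\<phi>(z)\<bar>\<^sup>2\<close> is at most \<open>\<parallel>\<phi>\<parallel>\<^sub>p\<^sup>2\<close> times the sum of
  \<open>(2\<bar>n\<bar> + d)\<^sup>-\<^sup>2\<^sup>p h\<^sub>n(z)\<^sup>2\<close>. That this sum is bounded in \<open>z\<close> as soon as \<open>p > d/4\<close> rests on the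
  one-dimensional estimate \<open>h\<^sub>0(x)\<^sup>2 + \<dots> + h\<^sub>N(x)\<^sup>2 \<le> sqrt (2 (N + 1))\<close> (\<open>sum_hermite1_sq_le\<close>): on average
  \<open>h\<^sub>k(x)\<^sup>2\<close> is of size \<open>1 / sqrt k\<close>, so \<open>k\<^sup>-\<^sup>a h\<^sub>k(x)\<^sup>2\<close> is summable for every \<open>a > 1/2\<close>, and a product over
  the \<open>d\<close> coordinates with \<open>a = 2p/d\<close> gives the threshold.

  The second point is the Jacobian. The image of Lebesgue measure under an invertible linear map is a
  multiple of Lebesgue measure (\<open>nn_integral_linear_substitution\<close>, by uniqueness of translation
  invariant measures). For the maps \<open>e\<^sup>t\<^sup>C\<close> the factor is multiplicative in \<open>t\<close>, and evaluated on a Gaussian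
  it has derivative \<open>- tr C\<close> at \<open>t = 0\<close> (\<open>gaussian_mass_deriv_0\<close>), hence it is \<open>exp (- t tr C)\<close>.
\<close>

section \<open>Integration on Euclidean space\<close>

lemma lborel_integral_shift:
  fixes f :: "'a::euclidean_space \<Rightarrow> real"
  assumes [measurable]: "f \<in> borel_measurable borel"
  shows "(\<integral>x. f (x + a) \<partial>lborel) = (\<integral>x. f x \<partial>lborel)"
  by (subst lborel_distr_plus[of a, symmetric], subst integral_distr)
     (simp_all add: add.commute)

lemma lborel_integrable_shift:
  fixes f :: "'a::euclidean_space \<Rightarrow> real"
  assumes [measurable]: "f \<in> borel_measurable borel"
  shows "integrable lborel (\<lambda>x. f (x + a)) \<longleftrightarrow> integrable lborel f"
  by (subst (2) lborel_distr_plus[of a, symmetric], subst integrable_distr_eq)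
     (simp_all add: add.commute)

lemma lborel_nn_integral_shift:
  fixes f :: "'a::euclidean_space \<Rightarrow> ennreal"
  assumes [measurable]: "f \<in> borel_measurable borel"
  shows "(\<integral>\<^sup>+x. f (x + a) \<partial>lborel) = (\<integral>\<^sup>+x. f x \<partial>lborel)"
  by (subst lborel_distr_plus[of a, symmetric], subst nn_integral_distr)
     (simp_all add: add.commute)

text \<open>
  The integral of the increment \<open>F (x + v) - F x\<close> vanishes by translation invariance, and by
  Fubini it equals the integral of \<open>G\<close>. This is the only form of integration by parts needed: taking
  a product for \<open>F\<close> moves a derivative from one factor to the other.
\<close>

lemma integral_directional_derivative_eq_0:
  fixes F G :: "'a::euclidean_space \<Rightarrow> real"
  assumes F: "integrable lborel F" and G: "integrable lborel G"
    and cont: "continuous_on UNIV G"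
    and deriv: "\<And>x s. ((\<lambda>s. F (x + s *\<^sub>R v)) has_real_derivative G (x + s *\<^sub>R v)) (at s)"
  shows "(\<integral>x. G x \<partial>lborel) = 0"
proof -
  have [measurable]: "F \<in> borel_measurable borel" "G \<in> borel_measurable borel"
    using F G by auto
  \<comment> \<open>\<open>F (x + v) - F x\<close> is the integral of \<open>H s x\<close> over \<open>s\<close>.\<close>
  define H where "H = (\<lambda>s x. G (x + s *\<^sub>R v) * indicator {0..1::real} s)"
  have H_meas: "case_prod H \<in> borel_measurable (lborel \<Otimes>\<^sub>M lborel)"
    unfolding H_def split_def by measurable
  have "integrable (lborel \<Otimes>\<^sub>M lborel) (case_prod H)"
  proof (rule lborel_pair.Fubini_integrable[OF H_meas])
    have "(\<integral>y. norm (case (x, y) of (s, x) \<Rightarrow> H s x) \<partial>lborel)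
        = (\<integral>x. \<bar>G x\<bar> \<partial>lborel) * indicator {0..1} x" for x
      using lborel_integral_shift[of "\<lambda>x. \<bar>G x\<bar>"] by (simp add: H_def abs_mult)
    then show "integrable lborel (\<lambda>x. \<integral>y. norm (case (x, y) of (s, x) \<Rightarrow> H s x) \<partial>lborel)"
      by (simp add: mult.commute)
    show "AE x in lborel. integrable lborel (\<lambda>y. case (x, y) of (s, x) \<Rightarrow> H s x)"
      using G by (simp add: H_def lborel_integrable_shift)
  qed
  from lborel_pair.Fubini_integral[OF this]
  have "(\<integral>x. (\<integral>s. H s x \<partial>lborel) \<partial>lborel) = (\<integral>s. (\<integral>x. H s x \<partial>lborel) \<partial>lborel)" .
  also have "\<dots> = (\<integral>s. (\<integral>x. G x \<partial>lborel) * indicator {0..1::real} s \<partial>lborel)"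
    by (simp add: H_def lborel_integral_shift)
  also have "\<dots> = (\<integral>x. G x \<partial>lborel)" by simp
  finally have "(\<integral>x. (\<integral>s. H s x \<partial>lborel) \<partial>lborel) = (\<integral>x. G x \<partial>lborel)" .
  moreover have "(\<integral>s. H s x \<partial>lborel) = F (x + v) - F x" for x
  proof -
    have "isCont (\<lambda>s. G (x + s *\<^sub>R v)) s" for s
    proof (rule isCont_o2[where f = "\<lambda>s. x + s *\<^sub>R v" and g = G])
      show "isCont (\<lambda>s. x + s *\<^sub>R v) s" by (intro continuous_intros)
      show "isCont G (x + s *\<^sub>R v)" using cont by (simp add: continuous_on_eq_continuous_at)
    qed
    from integral_FTC_Icc_real[where a = 0 and b = 1, OF _ deriv this] show ?thesis
      by (simp add: H_def)
  qed
  moreover have "(\<integral>x. F (x + v) - F x \<partial>lborel) = 0"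
    using F by (subst Bochner_Integration.integral_diff) (auto simp: lborel_integrable_shift lborel_integral_shift)
  ultimately show ?thesis by simp
qed

lemma
  fixes f :: "'d::finite \<Rightarrow> real \<Rightarrow> real"
  assumes f: "\<And>i. integrable lborel (f i)"
  shows integrable_prod_vec: "integrable lborel (\<lambda>x :: real^'d. \<Prod>i\<in>UNIV. f i (x $ i))"
    and integral_prod_vec: "(\<integral>x. (\<Prod>i\<in>UNIV. f i ((x::real^'d) $ i)) \<partial>lborel) = (\<Prod>i\<in>UNIV. \<integral>u. f i u \<partial>lborel)"
proof -
  interpret product_sigma_finite "\<lambda>_::real^'d. lborel :: real measure"
    by standard
  have [measurable]: "f i \<in> borel_measurable borel" for i using f[of i] by simp
  have inj: "inj_on (\<lambda>i::'d. axis i (1::real)) UNIV" by (auto simp: inj_on_def axis_eq_axis)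
  have basis: "(Basis :: (real^'d) set) = range (\<lambda>i. axis i 1)" by (auto simp: Basis_vec_def)
  define g where "g b = f (inv (\<lambda>i::'d. axis i (1::real)) b)" for b
  have g: "g (axis i 1) = f i" for i by (simp add: g_def inv_f_f[OF inj])
  have prod: "(\<Prod>i\<in>UNIV. f i (h (axis i 1))) = (\<Prod>b\<in>Basis. g b (h b))" for h :: "real^'d \<Rightarrow> real"
    by (simp add: basis prod.reindex[OF inj] g)
  have g_int: "integrable lborel (g b)" for b unfolding g_def by (rule f)
  have coord: "(\<Sum>b\<in>Basis. h b *\<^sub>R b) $ i = h (axis i 1)" for h :: "real^'d \<Rightarrow> real" and i
    unfolding basis sum.reindex[OF inj] by (simp add: axis_def if_distrib cong: if_cong)
  note lb = lborel_eq[where 'a="real^'d"]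
  show "integrable lborel (\<lambda>x :: real^'d. \<Prod>i\<in>UNIV. f i (x $ i))"
    unfolding lb
    by (subst integrable_distr_eq)
       (measurable, unfold coord prod, intro product_integrable_prod g_int finite_Basis)
  show "(\<integral>x. (\<Prod>i\<in>UNIV. f i ((x::real^'d) $ i)) \<partial>lborel) = (\<Prod>i\<in>UNIV. \<integral>u. f i u \<partial>lborel)"
  proof -
    have "(\<integral>x. (\<Prod>i\<in>UNIV. f i ((x::real^'d) $ i)) \<partial>lborel)
        = (\<integral>h. (\<Prod>b\<in>Basis. g b (h b)) \<partial>(\<Pi>\<^sub>M b\<in>Basis. lborel))"
      unfolding lb by (subst integral_distr) (measurable, simp only: coord prod)
    also have "\<dots> = (\<Prod>b\<in>Basis. \<integral>u. g b u \<partial>lborel)"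
      by (rule product_integral_prod[OF _ g_int]) simp
    also have "\<dots> = (\<Prod>i\<in>UNIV. \<integral>u. f i u \<partial>lborel)"
      unfolding basis prod.reindex[OF inj] by (simp add: g)
    finally show ?thesis .
  qed
qed

lemma
  assumes "0 < \<beta>"
  shows integrable_gaussian: "integrable lborel (\<lambda>x::real. exp (- \<beta> * x\<^sup>2))"
    and integral_gaussian: "(\<integral>x. exp (- \<beta> * (x::real)\<^sup>2) \<partial>lborel) = sqrt (pi / \<beta>)"
proof -
  define \<sigma> where "\<sigma> = 1 / sqrt (2 * \<beta>)"
  have "exp (- \<beta> * x\<^sup>2) = sqrt (pi / \<beta>) * normal_density 0 \<sigma> x" for x
    using assms by (simp add: normal_density_def \<sigma>_def field_simps real_sqrt_divide)
  then have eq: "(\<lambda>x. exp (- \<beta> * x\<^sup>2)) = (\<lambda>x. sqrt (pi / \<beta>) * normal_density 0 \<sigma> x)"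
    by auto
  have "0 < \<sigma>" using assms by (simp add: \<sigma>_def)
  then show "integrable lborel (\<lambda>x::real. exp (- \<beta> * x\<^sup>2))"
    "(\<integral>x. exp (- \<beta> * (x::real)\<^sup>2) \<partial>lborel) = sqrt (pi / \<beta>)"
    unfolding eq by auto
qed

lemma norm_vec_sq: "(norm (x :: real^'d::finite))\<^sup>2 = (\<Sum>i\<in>UNIV. (x $ i)\<^sup>2)"
  by (simp add: norm_vec_def L2_set_def sum_nonneg)

lemma exp_norm_sq_vec: "exp (- \<beta> * (norm (x :: real^'d::finite))\<^sup>2) = (\<Prod>i\<in>UNIV. exp (- \<beta> * (x $ i)\<^sup>2))"
  by (simp add: norm_vec_sq sum_distrib_left exp_sum)

lemma
  assumes "0 < \<beta>"
  shows integrable_gaussian_vec: "integrable lborel (\<lambda>x::real^'d::finite. exp (- \<beta> * (norm x)\<^sup>2))"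
    and integral_gaussian_vec:
      "(\<integral>x. exp (- \<beta> * (norm (x::real^'d::finite))\<^sup>2) \<partial>lborel) = sqrt (pi / \<beta>) ^ CARD('d)"
proof -
  note ints = integrable_gaussian[OF assms]
  show "integrable lborel (\<lambda>x::real^'d::finite. exp (- \<beta> * (norm x)\<^sup>2))"
    unfolding exp_norm_sq_vec by (rule integrable_prod_vec[OF ints])
  show "(\<integral>x. exp (- \<beta> * (norm (x::real^'d::finite))\<^sup>2) \<partial>lborel) = sqrt (pi / \<beta>) ^ CARD('d)"
    unfolding exp_norm_sq_vec by (subst integral_prod_vec[OF ints]) (simp only: integral_gaussian[OF assms] prod_constant)
qed

section \<open>Hermite functions on the line\<close>

lemma hermite_poly_rec:
  "2 * x * hermite_poly n x = hermite_poly (Suc n) x + 2 * real n * hermite_poly (n - 1) x"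
  by (cases n) simp_all

lemma hermite_poly_deriv:
  "(hermite_poly n has_real_derivative 2 * real n * hermite_poly (n - 1) x) (at x)"
proof (induction n rule: induct_nat_012)
  case (ge2 n)
  have "((\<lambda>x. 2 * x * hermite_poly (Suc n) x - 2 * real (Suc n) * hermite_poly n x)
     has_real_derivative
       2 * hermite_poly (Suc n) x + 2 * x * (2 * real (Suc n) * hermite_poly n x)
       - 2 * real (Suc n) * (2 * real n * hermite_poly (n - 1) x)) (at x)"
    using ge2 by (auto intro!: derivative_eq_intros)
  also have "2 * hermite_poly (Suc n) x + 2 * x * (2 * real (Suc n) * hermite_poly n x)
       - 2 * real (Suc n) * (2 * real n * hermite_poly (n - 1) x)
     = 2 * hermite_poly (Suc n) x + 2 * real (Suc n) * (2 * x * hermite_poly n x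
         - 2 * real n * hermite_poly (n - 1) x)"
    by (simp add: algebra_simps)
  also have "\<dots> = 2 * real (Suc (Suc n)) * hermite_poly (Suc n) x"
    unfolding hermite_poly_rec by (simp add: algebra_simps)
  finally show ?case by simp
qed (auto intro!: derivative_eq_intros)

definition hermite_const :: "nat \<Rightarrow> real" where
  "hermite_const n = sqrt (2 ^ n * fact n * sqrt pi)"

lemma hermite_const_pos: "0 < hermite_const n" by (simp add: hermite_const_def)

lemma hermite1_eq: "hermite1 n x = hermite_poly n x * exp (- x\<^sup>2 / 2) / hermite_const n"
  by (simp add: hermite1_def hermite_const_def)

lemma sqrt_double: "sqrt (2 * a) = 2 * sqrt (a / 2)"
  using real_sqrt_mult[of 4 "a / 2"] by simp

lemma hermite_const_Suc: "hermite_const (Suc n) = 2 * sqrt (real (Suc n) / 2) * hermite_const n"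
  unfolding sqrt_double[symmetric] hermite_const_def real_sqrt_mult[symmetric] by (simp add: mult_ac)

lemma hermite1_lower_coeff:
  "2 * sqrt (real n / 2) * hermite1 (n - 1) x
     = 2 * real n * hermite_poly (n - 1) x * exp (- x\<^sup>2 / 2) / hermite_const n"
proof (cases n)
  case (Suc m)
  define q where "q = sqrt (real (Suc m) / 2)"
  have "real (Suc m) = 2 * (q * q)" "0 < q" by (simp_all add: q_def)
  then show ?thesis using hermite_const_pos[of m]
    unfolding Suc hermite_const_Suc hermite1_eq q_def[symmetric] by (simp add: field_simps)
qed simp

lemma hermite1_mult_arg:
  "x * hermite1 n x = sqrt (real (Suc n) / 2) * hermite1 (Suc n) x + sqrt (real n / 2) * hermite1 (n - 1) x"
proof -
  have "0 < sqrt (real (Suc n) / 2)" by simp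
  then have 1: "sqrt (real (Suc n) / 2) * hermite1 (Suc n) x
      = hermite_poly (Suc n) x * exp (- x\<^sup>2 / 2) / (2 * hermite_const n)"
    using hermite_const_pos[of n] unfolding hermite1_eq hermite_const_Suc
    by (simp add: field_simps del: of_nat_Suc)
  have "x * hermite1 n x = (2 * x * hermite_poly n x) * exp (- x\<^sup>2 / 2) / (2 * hermite_const n)"
    by (simp add: hermite1_eq)
  also have "\<dots> = hermite_poly (Suc n) x * exp (- x\<^sup>2 / 2) / (2 * hermite_const n)
      + (2 * real n * hermite_poly (n - 1) x * exp (- x\<^sup>2 / 2) / hermite_const n) / 2"
    unfolding hermite_poly_rec using hermite_const_pos[of n] by (simp add: field_simps)
  finally show ?thesis
    unfolding 1[symmetric] hermite1_lower_coeff[symmetric] by simp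
qed

lemma hermite1_deriv_lower:
  "(hermite1 n has_real_derivative 2 * sqrt (real n / 2) * hermite1 (n - 1) x - x * hermite1 n x) (at x)"
proof -
  have "((\<lambda>x. hermite_poly n x * exp (- x\<^sup>2 / 2) / hermite_const n) has_real_derivative
      (2 * real n * hermite_poly (n - 1) x * exp (- x\<^sup>2 / 2)
        + hermite_poly n x * (exp (- x\<^sup>2 / 2) * (- x))) / hermite_const n) (at x)"
    using hermite_const_pos[of n]
    by (auto intro!: derivative_eq_intros hermite_poly_deriv)
  also have "(2 * real n * hermite_poly (n - 1) x * exp (- x\<^sup>2 / 2)
        + hermite_poly n x * (exp (- x\<^sup>2 / 2) * (- x))) / hermite_const n
      = 2 * sqrt (real n / 2) * hermite1 (n - 1) x - x * hermite1 n x"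
    unfolding hermite1_lower_coeff by (simp add: hermite1_eq add_divide_distrib diff_divide_distrib)
  finally show ?thesis unfolding hermite1_eq[abs_def] .
qed

lemma hermite1_deriv_raise:
  "(hermite1 n has_real_derivative x * hermite1 n x - 2 * sqrt (real (Suc n) / 2) * hermite1 (Suc n) x) (at x)"
  using hermite1_deriv_lower[of n x] unfolding hermite1_mult_arg
  by (simp add: algebra_simps del: of_nat_Suc)

lemma hermite1_deriv:
  "(hermite1 n has_real_derivative
     sqrt (real n / 2) * hermite1 (n - 1) x - sqrt (real (Suc n) / 2) * hermite1 (Suc n) x) (at x)"
  using hermite1_deriv_lower[of n x] unfolding hermite1_mult_arg
  by (simp add: algebra_simps del: of_nat_Suc)

lemma hermite1_continuous [continuous_intros]: "continuous_on A (hermite1 n)"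
  using hermite1_deriv[THEN DERIV_isCont] continuous_at_imp_continuous_on by blast

lemma hermite1_measurable [measurable]: "hermite1 n \<in> borel_measurable borel"
  by (intro borel_measurable_continuous_onI hermite1_continuous)

text \<open>
  Lowering after raising: the function differentiated here is the derivative of \<open>hermite1 n\<close> by
  \<open>hermite1_deriv_raise\<close>, so this is the eigenvalue equation \<open>x\<^sup>2 h\<^sub>n - h\<^sub>n'' = (2 n + 1) h\<^sub>n\<close>.
\<close>

lemma hermite1_deriv2:
  "((\<lambda>x. x * hermite1 n x - 2 * sqrt (real (Suc n) / 2) * hermite1 (Suc n) x) has_real_derivative
     (x\<^sup>2 - (2 * real n + 1)) * hermite1 n x) (at x)"
proof -
  define q where "q = sqrt (real (Suc n) / 2)"
  have q: "4 * (q * q) = 2 * real n + 2" by (simp add: q_def)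
  have "((\<lambda>x. x * hermite1 n x - 2 * q * hermite1 (Suc n) x) has_real_derivative
     (hermite1 n x + x * (x * hermite1 n x - 2 * q * hermite1 (Suc n) x))
     - 2 * q * (2 * q * hermite1 n x - x * hermite1 (Suc n) x)) (at x)"
    using hermite1_deriv_lower[of "Suc n" x] hermite1_deriv_raise[of n x] unfolding q_def
    by (auto intro!: derivative_eq_intros simp del: of_nat_Suc)
  also have "(hermite1 n x + x * (x * hermite1 n x - 2 * q * hermite1 (Suc n) x))
     - 2 * q * (2 * q * hermite1 n x - x * hermite1 (Suc n) x)
     = (x\<^sup>2 + 1 - 4 * (q * q)) * hermite1 n x"
    by (simp add: algebra_simps power2_eq_square)
  also have "\<dots> = (x\<^sup>2 - (2 * real n + 1)) * hermite1 n x"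
    unfolding q by (simp add: algebra_simps)
  finally show ?thesis unfolding q_def .
qed

lemma hermite_poly_bound: "\<exists>C\<ge>0. \<forall>x. \<bar>hermite_poly n x\<bar> \<le> C * exp (real n * \<bar>x\<bar>)"
proof (induction n rule: induct_nat_012)
  case 0
  show ?case by (intro exI[of _ 1]) simp
next
  case 1
  have "\<bar>x\<bar> \<le> exp \<bar>x\<bar>" for x :: real using exp_ge_add_one_self[of "\<bar>x\<bar>"] by linarith
  then show ?case by (intro exI[of _ 2]) (simp add: abs_mult)
next
  case (ge2 n)
  then obtain A B where A: "\<And>x. \<bar>hermite_poly (Suc n) x\<bar> \<le> A * exp (real (Suc n) * \<bar>x\<bar>)"
    and B: "\<And>x. \<bar>hermite_poly n x\<bar> \<le> B * exp (real n * \<bar>x\<bar>)" and A0: "0 \<le> A" and B0: "0 \<le> B" by blast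
  have "\<bar>hermite_poly (Suc (Suc n)) x\<bar>
    \<le> (2 * A + 2 * real (Suc n) * B) * exp (real (Suc (Suc n)) * \<bar>x\<bar>)" for x
  proof -
    have "\<bar>hermite_poly (Suc (Suc n)) x\<bar>
      \<le> \<bar>2 * x * hermite_poly (Suc n) x\<bar> + \<bar>2 * real (Suc n) * hermite_poly n x\<bar>"
      unfolding hermite_poly.simps by (rule abs_triangle_ineq4)
    also have "\<dots> = 2 * (\<bar>x\<bar> * \<bar>hermite_poly (Suc n) x\<bar>) + 2 * real (Suc n) * \<bar>hermite_poly n x\<bar>"
      by (simp add: abs_mult)
    also have "\<dots> \<le> 2 * (exp \<bar>x\<bar> * (A * exp (real (Suc n) * \<bar>x\<bar>))) + 2 * real (Suc n) * (B * exp (real (Suc (Suc n)) * \<bar>x\<bar>))"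
    proof (intro add_mono mult_mono order_refl)
      show "\<bar>x\<bar> \<le> exp \<bar>x\<bar>" using exp_ge_add_one_self[of "\<bar>x\<bar>"] by linarith
      show "\<bar>hermite_poly (Suc n) x\<bar> \<le> A * exp (real (Suc n) * \<bar>x\<bar>)" by (rule A)
      have "real n * \<bar>x\<bar> \<le> real (Suc (Suc n)) * \<bar>x\<bar>" by (intro mult_right_mono) auto
      then show "\<bar>hermite_poly n x\<bar> \<le> B * exp (real (Suc (Suc n)) * \<bar>x\<bar>)"
        using B0 by (intro order_trans[OF B] mult_left_mono) auto
    qed (use A0 in auto)
    also have "exp \<bar>x\<bar> * (A * exp (real (Suc n) * \<bar>x\<bar>)) = A * exp (real (Suc (Suc n)) * \<bar>x\<bar>)"
      by (simp add: algebra_simps flip: exp_add)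
    finally show ?thesis by (simp only: distrib_right mult.assoc)
  qed
  moreover have "0 \<le> 2 * A + 2 * real (Suc n) * B" using A0 B0 by simp
  ultimately show ?case by blast
qed

lemma hermite1_bound: "\<exists>C>0. \<forall>x. \<bar>hermite1 n x\<bar> \<le> C * exp (- (1/4) * x\<^sup>2)"
proof -
  obtain C where C0: "0 \<le> C" and C: "\<And>x. \<bar>hermite_poly n x\<bar> \<le> C * exp (real n * \<bar>x\<bar>)"
    using hermite_poly_bound by blast
  define K where "K = (C * exp ((real n)\<^sup>2)) / hermite_const n"
  have "\<bar>hermite1 n x\<bar> \<le> (K + 1) * exp (- (1/4) * x\<^sup>2)" for x
  proof -
    \<comment> \<open>Half of the Gaussian exponent is spent on the exponential growth of the polynomial.\<close>
    have q: "real n * \<bar>x\<bar> - x\<^sup>2 / 2 \<le> (real n)\<^sup>2 - (1/4) * x\<^sup>2"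
      using zero_le_power2[of "real n - \<bar>x\<bar> / 2"] by (simp add: power2_diff power_divide algebra_simps)
    have "\<bar>hermite1 n x\<bar> = \<bar>hermite_poly n x\<bar> * exp (- x\<^sup>2 / 2) / hermite_const n"
      using hermite_const_pos[of n] by (simp add: hermite1_eq abs_mult)
    also have "\<dots> \<le> C * exp (real n * \<bar>x\<bar>) * exp (- x\<^sup>2 / 2) / hermite_const n"
      using hermite_const_pos[of n] by (intro divide_right_mono mult_right_mono C) auto
    also have "\<dots> = C * exp (real n * \<bar>x\<bar> - x\<^sup>2 / 2) / hermite_const n"
      by (simp add: mult.assoc flip: exp_add)
    also have "\<dots> \<le> C * exp ((real n)\<^sup>2 - (1/4) * x\<^sup>2) / hermite_const n"
      using q C0 hermite_const_pos[of n] by (intro divide_right_mono mult_left_mono) auto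
    also have "\<dots> = K * exp (- (1/4) * x\<^sup>2)"
      by (simp add: K_def mult.assoc flip: exp_add)
    also have "\<dots> \<le> (K + 1) * exp (- (1/4) * x\<^sup>2)" by (intro mult_right_mono) auto
    finally show ?thesis .
  qed
  moreover have "K + 1 > 0" using C0 hermite_const_pos[of n] by (simp add: K_def add_nonneg_pos)
  ultimately show ?thesis by blast
qed

lemma hermite1_prod_integrable: "integrable lborel (\<lambda>x. hermite1 n x * hermite1 m x)"
proof -
  obtain C where C: "0 < C" "\<And>x. \<bar>hermite1 n x\<bar> \<le> C * exp (- (1/4) * x\<^sup>2)" using hermite1_bound by blast
  obtain D where D: "0 < D" "\<And>x. \<bar>hermite1 m x\<bar> \<le> D * exp (- (1/4) * x\<^sup>2)" using hermite1_bound by blast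
  have "integrable lborel (\<lambda>x. C * D * exp (- (1/2) * x\<^sup>2))"
    by (intro integrable_mult_right integrable_gaussian) simp
  then show ?thesis
  proof (rule Bochner_Integration.integrable_bound)
    have "norm (hermite1 n x * hermite1 m x) \<le> norm (C * D * exp (- (1/2) * x\<^sup>2))" for x
    proof -
      have "norm (hermite1 n x * hermite1 m x)
          \<le> (C * exp (- (1/4) * x\<^sup>2)) * (D * exp (- (1/4) * x\<^sup>2))"
        unfolding real_norm_def abs_mult using C D by (intro mult_mono) auto
      also have "\<dots> = C * D * (exp (- (1/4) * x\<^sup>2) * exp (- (1/4) * x\<^sup>2))" by simp
      also have "\<dots> = norm (C * D * exp (- (1/2) * x\<^sup>2))"
        using C D unfolding exp_add[symmetric] by (simp add: abs_mult)
      finally show ?thesis .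
    qed
    then show "AE x in lborel. norm (hermite1 n x * hermite1 m x) \<le> norm (C * D * exp (- (1/2) * x\<^sup>2))" by simp
  qed measurable
qed

text \<open>
  The raising operator \<open>x - d/dx\<close> is adjoint to the lowering operator \<open>x + d/dx\<close>, because the
  derivative of \<open>h\<^sub>n h\<^sub>m\<close> has integral zero.
\<close>

lemma hermite1_inner_shift:
  "sqrt (real (Suc n) / 2) * (\<integral>x. hermite1 (Suc n) x * hermite1 m x \<partial>lborel)
     = sqrt (real m / 2) * (\<integral>x. hermite1 n x * hermite1 (m - 1) x \<partial>lborel)"
proof -
  note ints = hermite1_prod_integrable
  define q r where "q = sqrt (real (Suc n) / 2)" and "r = sqrt (real m / 2)"
  define G where "G x = 2 * r * (hermite1 n x * hermite1 (m - 1) x) - 2 * q * (hermite1 (Suc n) x * hermite1 m x)" for x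
  have der: "((\<lambda>x. hermite1 n x * hermite1 m x) has_real_derivative G x) (at x)" for x
  proof -
    have "((\<lambda>x. hermite1 n x * hermite1 m x) has_real_derivative
       (x * hermite1 n x - 2 * q * hermite1 (Suc n) x) * hermite1 m x
       + (2 * r * hermite1 (m - 1) x - x * hermite1 m x) * hermite1 n x) (at x)"
      unfolding q_def r_def by (intro DERIV_mult hermite1_deriv_raise hermite1_deriv_lower)
    then show ?thesis by (simp add: G_def algebra_simps)
  qed
  have "(\<integral>x. G x \<partial>lborel) = 0"
  proof (rule integral_directional_derivative_eq_0[where v = 1])
    show "integrable lborel (\<lambda>x. hermite1 n x * hermite1 m x)" by (rule ints)
    show "integrable lborel G" unfolding G_def by (intro Bochner_Integration.integrable_diff integrable_mult_right ints)
    show "continuous_on UNIV G" unfolding G_def by (intro continuous_intros)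
    fix x s :: real
    show "((\<lambda>s. hermite1 n (x + s *\<^sub>R 1) * hermite1 m (x + s *\<^sub>R 1)) has_real_derivative G (x + s *\<^sub>R 1)) (at s)"
      using DERIV_shift[of "\<lambda>x. hermite1 n x * hermite1 m x" "G (x + s)" s x] der[of "x + s"]
      by (simp add: add.commute)
  qed
  then show ?thesis
    unfolding G_def q_def[symmetric] r_def[symmetric] by (simp add: ints)
qed

lemma hermite1_orthonormal: "(\<integral>x. hermite1 n x * hermite1 m x \<partial>lborel) = (if n = m then 1 else 0)"
proof (induction n arbitrary: m)
  case 0
  show ?case
  proof (cases m)
    case 0
    have "hermite1 0 x * hermite1 0 x = exp (- 1 * x\<^sup>2) / sqrt pi" for x
      by (simp add: hermite1_def flip: exp_add)
    then show ?thesis using integral_gaussian[of 1] 0 by simp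
  next
    case (Suc k)
    have "sqrt (real (Suc k) / 2) * (\<integral>x. hermite1 (Suc k) x * hermite1 0 x \<partial>lborel) = 0"
      unfolding hermite1_inner_shift by simp
    then show ?thesis using Suc by (simp add: mult.commute)
  qed
next
  case (Suc n)
  have "sqrt (real (Suc n) / 2) * (\<integral>x. hermite1 (Suc n) x * hermite1 m x \<partial>lborel)
     = sqrt (real m / 2) * (if n = m - 1 then 1 else 0)"
    unfolding hermite1_inner_shift Suc.IH ..
  also have "\<dots> = sqrt (real (Suc n) / 2) * (if Suc n = m then 1 else 0)"
    by (cases m) auto
  finally show ?case by (subst (asm) mult_cancel_left) simp
qed

lemma hermite1_tendsto_0: "(hermite1 n \<longlongrightarrow> 0) at_top"
proof -
  obtain C where C: "0 < C" "\<And>x. \<bar>hermite1 n x\<bar> \<le> C * exp (- (1/4) * x\<^sup>2)" using hermite1_bound by blast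
  have "((\<lambda>x::real. exp (- (1/4) * x\<^sup>2)) \<longlongrightarrow> 0) at_top"
  proof (rule filterlim_compose[OF exp_at_bot])
    show "filterlim (\<lambda>x::real. - (1/4) * x\<^sup>2) at_bot at_top"
      by (rule filterlim_tendsto_neg_mult_at_bot[OF tendsto_const])
         (auto intro!: filterlim_pow_at_top filterlim_ident)
  qed
  from tendsto_mult_right_zero[OF this, of C] show ?thesis
    by (rule Lim_null_comparison[rotated]) (use C in auto)
qed

text \<open>
  The derivative of \<open>h\<^sub>k\<^sup>2\<close> is a difference of two consecutive terms, so that of the sum
  telescopes.
\<close>

lemma sum_hermite1_sq_deriv:
  "((\<lambda>x. \<Sum>k\<le>N. (hermite1 k x)\<^sup>2) has_real_derivative
     - (2 * sqrt (real (Suc N) / 2) * (hermite1 N x * hermite1 (Suc N) x))) (at x)"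
proof (induction N)
  case 0
  show ?case by (auto intro!: derivative_eq_intros hermite1_deriv simp: power2_eq_square)
next
  case (Suc N)
  have "((\<lambda>x. (hermite1 (Suc N) x)\<^sup>2) has_real_derivative
      2 * hermite1 (Suc N) x * (sqrt (real (Suc N) / 2) * hermite1 N x
        - sqrt (real (Suc (Suc N)) / 2) * hermite1 (Suc (Suc N)) x)) (at x)"
    using DERIV_power[OF hermite1_deriv[of "Suc N" x], of 2] by (simp add: mult_ac del: of_nat_Suc)
  from DERIV_add[OF Suc.IH this] show ?case
    by (simp add: algebra_simps del: of_nat_Suc)
qed

text \<open>
  The sum tends to zero at infinity and its derivative is \<open>- sqrt (2 (N + 1)) h\<^sub>N h\<^sub>N\<^sub>+\<^sub>1\<close>, whose
  \<open>L\<^sup>1\<close> norm is at most \<open>sqrt (2 (N + 1))\<close> since \<open>h\<^sub>N\<close> and \<open>h\<^sub>N\<^sub>+\<^sub>1\<close> are unit vectors of \<open>L\<^sup>2\<close>. Bounding the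
  functions one at a time would lose a power of \<open>N\<close>; this estimate is sharp in \<open>N\<close> and is what
  makes \<open>d/4\<close> the threshold.
\<close>

lemma sum_hermite1_sq_le: "(\<Sum>k\<le>N. (hermite1 k x)\<^sup>2) \<le> sqrt (2 * real (Suc N))"
proof -
  define D where "D x = (\<Sum>k\<le>N. (hermite1 k x)\<^sup>2)" for x
  define q where "q = 2 * sqrt (real (Suc N) / 2)"
  define u where "u x = hermite1 N x * hermite1 (Suc N) x" for x
  have q0: "0 \<le> q" by (simp add: q_def)
  have abs_int: "integrable lborel (\<lambda>x. \<bar>u x\<bar>)"
    unfolding u_def by (intro integrable_abs hermite1_prod_integrable)
  have "(\<integral>x. \<bar>u x\<bar> \<partial>lborel) \<le> (\<integral>x. (hermite1 N x * hermite1 N x + hermite1 (Suc N) x * hermite1 (Suc N) x) / 2 \<partial>lborel)"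
  proof (rule integral_mono[OF abs_int])
    fix x
    show "\<bar>u x\<bar> \<le> (hermite1 N x * hermite1 N x + hermite1 (Suc N) x * hermite1 (Suc N) x) / 2"
      using zero_le_power2[of "\<bar>hermite1 N x\<bar> - \<bar>hermite1 (Suc N) x\<bar>"]
      by (simp add: u_def abs_mult power2_diff) (simp add: power2_eq_square)
  qed (auto intro!: hermite1_prod_integrable)
  also have "\<dots> = 1"
    by (simp add: hermite1_prod_integrable hermite1_orthonormal)
  finally have int1: "(\<integral>x. \<bar>u x\<bar> \<partial>lborel) \<le> 1" .
  have "D x \<le> D b + q" if "x \<le> b" for b
  proof -
    have "D b - D x = (\<integral>t. - (q * u t) * indicator {x..b} t \<partial>lborel)"
    proof (rule integral_FTC_Icc_real[OF that, symmetric])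
      show "(D has_real_derivative - (q * u t)) (at t)" for t
        unfolding D_def q_def u_def by (rule sum_hermite1_sq_deriv)
      show "isCont (\<lambda>t. - (q * u t)) t" for t
        using hermite1_continuous[of UNIV] unfolding u_def
        by (intro continuous_intros) (simp_all add: continuous_on_eq_continuous_at)
    qed
    moreover have "\<bar>\<integral>t. - (q * u t) * indicator {x..b} t \<partial>lborel\<bar> \<le> (\<integral>t. q * \<bar>u t\<bar> \<partial>lborel)"
    proof (rule order_trans[OF integral_abs_bound integral_mono])
      show "integrable lborel (\<lambda>t. \<bar>- (q * u t) * indicator {x..b} t\<bar>)"
        by (intro integrable_abs integrable_real_mult_indicator)
           (auto simp: u_def intro!: hermite1_prod_integrable)
      show "integrable lborel (\<lambda>t. q * \<bar>u t\<bar>)" using abs_int by simp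
      show "\<bar>- (q * u t) * indicator {x..b} t\<bar> \<le> q * \<bar>u t\<bar>" for t
        using q0 by (auto simp: abs_mult split: split_indicator)
    qed
    moreover have "(\<integral>t. q * \<bar>u t\<bar> \<partial>lborel) \<le> q"
      using mult_left_mono[OF int1 q0] by simp
    ultimately show ?thesis by linarith
  qed
  then have "eventually (\<lambda>b. D x \<le> D b + q) at_top"
    using eventually_ge_at_top[of x] by (rule eventually_mono[rotated])
  moreover have "((\<lambda>b. D b + q) \<longlongrightarrow> 0 + q) at_top"
    unfolding D_def
    by (intro tendsto_intros tendsto_null_sum) (use tendsto_power[OF hermite1_tendsto_0, of _ 2] in simp)
  ultimately have "D x \<le> q"
    by (intro tendsto_lowerbound[of "\<lambda>b. D b + q" q at_top]) auto
  then show ?thesis unfolding D_def q_def sqrt_double .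
qed

text \<open>
  Abel summation: decreasing nonnegative weights preserve an inequality between all partial
  sums.
\<close>

lemma sum_decreasing_weights_mono:
  fixes c u b :: "nat \<Rightarrow> real"
  assumes le: "\<And>N. (\<Sum>k\<le>N. u k) \<le> (\<Sum>k\<le>N. b k)"
    and dec: "\<And>k. c (Suc k) \<le> c k" and pos: "\<And>k. 0 \<le> c k"
  shows "(\<Sum>k\<le>N. c k * u k) \<le> (\<Sum>k\<le>N. c k * b k)"
proof -
  have "c N * (\<Sum>k\<le>N. b k - u k) \<le> (\<Sum>k\<le>N. c k * (b k - u k))"
  proof (induction N)
    case (Suc N)
    have "c (Suc N) * (\<Sum>k\<le>N. b k - u k) \<le> c N * (\<Sum>k\<le>N. b k - u k)"
      using le[of N] dec by (intro mult_right_mono) (auto simp: sum_subtractf)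
    with Suc show ?case by (simp add: distrib_left)
  qed simp
  moreover have "0 \<le> c N * (\<Sum>k\<le>N. b k - u k)"
    using le[of N] pos[of N] by (simp add: sum_subtractf)
  ultimately show ?thesis by (simp add: right_diff_distrib sum_subtractf)
qed

lemma summable_odd_powr:
  assumes "1 < s"
  shows "summable (\<lambda>k. real (2 * k + 1) powr - s)"
proof (rule summable_comparison_test)
  have "summable (\<lambda>n. real n powr - s)"
    using assms by (simp add: summable_real_powr_iff)
  then show "summable (\<lambda>k. real (Suc k) powr - s)" by (subst summable_Suc_iff)
  show "\<exists>N. \<forall>n\<ge>N. norm (real (2 * n + 1) powr - s) \<le> real (Suc n) powr - s"
    using assms by (auto intro!: powr_mono2' exI[of _ 0])
qed

text \<open>
  A majorant for the bound of \<open>sum_hermite1_sq_le\<close> that is itself a partial sum, as the comparison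
  \<open>sum_decreasing_weights_mono\<close> requires.
\<close>

lemma sum_inverse_sqrt_odd_ge: "sqrt (2 * real (Suc N)) \<le> (\<Sum>k\<le>N. 2 * real (2 * k + 1) powr - (1/2))"
proof (induction N)
  case 0
  show ?case using real_sqrt_le_mono[of 2 4] by simp
next
  case (Suc N)
  define a b c where "a = sqrt (2 * real (Suc N))" and "b = sqrt (2 * real (Suc (Suc N)))"
    and "c = sqrt (real (2 * Suc N + 1))"
  have sq: "a * a = 2 * real (Suc N)" "b * b = a * a + 2" by (simp_all add: a_def b_def)
  have pos: "0 < a" "0 < c" "c \<le> b" by (simp_all add: a_def b_def c_def)
  have "(b - a) * c \<le> (b - a) * (b + a)"
    using pos by (intro mult_left_mono) (linarith, simp add: a_def b_def)
  also have "\<dots> = 2" using sq by (simp add: algebra_simps)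
  finally have "b \<le> a + 2 / c" using pos by (simp add: field_simps)
  also have "2 / c = 2 * real (2 * Suc N + 1) powr - (1/2)"
    unfolding c_def powr_minus_divide by (subst powr_half_sqrt) (simp_all only: of_nat_0_le_iff times_divide_eq_right mult_1_right)
  finally show ?case using Suc.IH unfolding a_def b_def sum.atMost_Suc by linarith
qed

lemma weighted_sum_hermite1_sq_bounded:
  assumes "1/2 < a"
  shows "\<exists>K>0. \<forall>N x. (\<Sum>k\<le>N. real (2 * k + 1) powr - a * (hermite1 k x)\<^sup>2) \<le> K"
proof -
  define e where "e k = real (2 * k + 1) powr - (a + 1/2)" for k
  have e: "summable e" unfolding e_def using assms by (intro summable_odd_powr) simp
  have "(\<Sum>k\<le>N. real (2 * k + 1) powr - a * (hermite1 k x)\<^sup>2) \<le> 2 * suminf e + 1" for N x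
  proof -
    have "(\<Sum>k\<le>N. real (2 * k + 1) powr - a * (hermite1 k x)\<^sup>2)
       \<le> (\<Sum>k\<le>N. real (2 * k + 1) powr - a * (2 * real (2 * k + 1) powr - (1/2)))"
      using assms
      by (intro sum_decreasing_weights_mono order_trans[OF sum_hermite1_sq_le sum_inverse_sqrt_odd_ge])
         (auto intro!: powr_mono2')
    also have "\<dots> = 2 * (\<Sum>k\<le>N. e k)"
      by (simp add: e_def sum_distrib_left powr_add[symmetric] mult.left_commute)
    also have "\<dots> \<le> 2 * suminf e + 1"
      using sum_le_suminf[OF e, of "{..N}"] by (simp add: e_def)
    finally show ?thesis .
  qed
  moreover have "0 < 2 * suminf e + 1" using suminf_nonneg[OF e] by (simp add: e_def add_nonneg_pos)
  ultimately show ?thesis by blast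
qed

section \<open>Hermite functions in several variables\<close>

lemma hermite_fun_continuous [continuous_intros]:
  "continuous_on A (hermite_fun n :: real^'d::finite \<Rightarrow> real)"
  unfolding hermite_fun_def
  by (intro continuous_on_prod continuous_on_compose2[OF hermite1_continuous[of UNIV]] continuous_intros) auto

lemma hermite_fun_measurable [measurable]: "(hermite_fun n :: real^'d::finite \<Rightarrow> real) \<in> borel_measurable borel"
  by (intro borel_measurable_continuous_onI hermite_fun_continuous)

lemma hermite_fun_gaussian_bound:
  "\<exists>C>0. \<forall>x::real^'d::finite. \<bar>hermite_fun n x\<bar> \<le> C * exp (- (1/4) * (norm x)\<^sup>2)"
proof -
  have "\<forall>i. \<exists>C>0. \<forall>x. \<bar>hermite1 (n i) x\<bar> \<le> C * exp (- (1/4) * x\<^sup>2)" using hermite1_bound by blast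
  then obtain C where C: "\<And>i. 0 < C i" "\<And>i x. \<bar>hermite1 (n i) x\<bar> \<le> C i * exp (- (1/4) * x\<^sup>2)" by metis
  have "\<bar>hermite_fun n x\<bar> \<le> (\<Prod>i\<in>UNIV. C i) * exp (- (1/4) * (norm x)\<^sup>2)" for x :: "real^'d"
    unfolding hermite_fun_def abs_prod exp_norm_sq_vec prod.distrib[symmetric]
    by (intro prod_mono conjI C abs_ge_zero)
  moreover have "0 < (\<Prod>i\<in>UNIV. C i)" by (intro prod_pos) (use C in auto)
  ultimately show ?thesis by blast
qed

lemma hermite_fun_integrable: "integrable lborel (hermite_fun n :: real^'d::finite \<Rightarrow> real)"
proof -
  obtain C where C: "0 < C" "\<And>x::real^'d. \<bar>hermite_fun n x\<bar> \<le> C * exp (- (1/4) * (norm x)\<^sup>2)"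
    using hermite_fun_gaussian_bound by blast
  have "integrable lborel (\<lambda>x::real^'d. C * exp (- (1/4) * (norm x)\<^sup>2))"
    by (intro integrable_mult_right integrable_gaussian_vec) simp
  then show ?thesis
    by (rule Bochner_Integration.integrable_bound) (use C in \<open>auto simp: abs_mult\<close>)
qed

lemma hermite_fun_orthonormal:
  "(\<integral>x. hermite_fun n x * hermite_fun m (x :: real^'d::finite) \<partial>lborel) = (if n = m then 1 else 0)"
proof -
  have "(\<integral>x. hermite_fun n x * hermite_fun m (x :: real^'d) \<partial>lborel)
      = (\<Prod>i\<in>UNIV. \<integral>u. hermite1 (n i) u * hermite1 (m i) u \<partial>lborel)"
    unfolding hermite_fun_def prod.distrib[symmetric]
    by (rule integral_prod_vec[OF hermite1_prod_integrable])
  also have "\<dots> = (\<Prod>i\<in>UNIV. if n i = m i then 1 else 0)"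
    unfolding hermite1_orthonormal ..
  also have "\<dots> = (if n = m then 1 else 0)"
    by (auto simp: fun_eq_iff)
  finally show ?thesis .
qed

lemma hermite_fun_split:
  "hermite_fun n x = hermite1 (n i) (x $ i) * (\<Prod>j\<in>UNIV - {i}. hermite1 (n j) (x $ j))"
  unfolding hermite_fun_def by (subst prod.remove[of _ i]) auto

lemma hermite_fun_upd:
  "hermite_fun (n(i := k)) x = hermite1 k (x $ i) * (\<Prod>j\<in>UNIV - {i}. hermite1 (n j) (x $ j))"
  unfolding hermite_fun_split[of _ x i] by simp

lemma hermite_fun_mult_coord:
  "x $ i * hermite_fun n x = sqrt (real (Suc (n i)) / 2) * hermite_fun (n(i := Suc (n i))) x
     + sqrt (real (n i) / 2) * hermite_fun (n(i := n i - 1)) x"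
  unfolding hermite_fun_upd unfolding hermite_fun_split[of n x i] mult.assoc[symmetric] hermite1_mult_arg
  by (simp add: algebra_simps del: of_nat_Suc)

text \<open>
  The derivative of \<open>hermite_fun n\<close> in direction \<open>i\<close>, written through the raising operator; see
  \<open>hermite_fun_deriv\<close>.
\<close>

definition hermite_fun_d :: "'d::finite \<Rightarrow> ('d \<Rightarrow> nat) \<Rightarrow> real^'d \<Rightarrow> real" where
  "hermite_fun_d i n x =
     x $ i * hermite_fun n x - 2 * sqrt (real (Suc (n i)) / 2) * hermite_fun (n(i := Suc (n i))) x"

lemma has_real_derivative_along_axis:
  fixes x :: "real^'d::finite"
  assumes "(g has_real_derivative D) (at ((x + s *\<^sub>R axis i 1) $ i))"
  shows "((\<lambda>s. g ((x + s *\<^sub>R axis i 1) $ i)) has_real_derivative D) (at s)"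
proof -
  have eq: "(x + s *\<^sub>R axis i 1) $ i = x $ i + s" for s by simp
  show ?thesis using assms DERIV_shift[of g D s "x $ i"] unfolding eq by (simp add: add.commute)
qed

lemma hermite_fun_deriv:
  "((\<lambda>s. hermite_fun n (x + s *\<^sub>R axis i 1)) has_real_derivative hermite_fun_d i n (x + s *\<^sub>R axis i 1)) (at s)"
proof -
  define P where "P = (\<Prod>j\<in>UNIV - {i}. hermite1 (n j) (x $ j))"
  have eq: "hermite_fun (n(i := k)) (x + s *\<^sub>R axis i 1) = hermite1 k ((x + s *\<^sub>R axis i 1) $ i) * P" for s k
    unfolding hermite_fun_upd P_def
    by (intro arg_cong2[of _ _ _ _ times] refl prod.cong) (auto simp: axis_def)
  have eqn: "hermite_fun n (x + s *\<^sub>R axis i 1) = hermite1 (n i) ((x + s *\<^sub>R axis i 1) $ i) * P" for s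
    using eq[of "n i"] by simp
  show ?thesis
    unfolding hermite_fun_d_def eq eqn
    using DERIV_cmult_right[OF has_real_derivative_along_axis[OF hermite1_deriv_raise[where n = "n i"]], where c = P]
    by (simp only: left_diff_distrib mult.assoc)
qed

lemma hermite_fun_d_deriv:
  "((\<lambda>s. hermite_fun_d i n (x + s *\<^sub>R axis i 1)) has_real_derivative
     (((x + s *\<^sub>R axis i 1) $ i)\<^sup>2 - (2 * real (n i) + 1)) * hermite_fun n (x + s *\<^sub>R axis i 1)) (at s)"
proof -
  define P where "P = (\<Prod>j\<in>UNIV - {i}. hermite1 (n j) (x $ j))"
  have eq: "hermite_fun (n(i := k)) (x + s *\<^sub>R axis i 1) = hermite1 k ((x + s *\<^sub>R axis i 1) $ i) * P" for s k
    unfolding hermite_fun_upd P_def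
    by (intro arg_cong2[of _ _ _ _ times] refl prod.cong) (auto simp: axis_def)
  have eqn: "hermite_fun n (x + s *\<^sub>R axis i 1) = hermite1 (n i) ((x + s *\<^sub>R axis i 1) $ i) * P" for s
    using eq[of "n i"] by simp
  show ?thesis
    unfolding hermite_fun_d_def eq eqn
    using DERIV_cmult_right[OF has_real_derivative_along_axis[OF hermite1_deriv2[where n = "n i"]], where c = P]
    by (simp only: left_diff_distrib mult.assoc)
qed

lemma hermite_fun_d_continuous [continuous_intros]:
  "continuous_on A (hermite_fun_d i n :: real^'d::finite \<Rightarrow> real)"
  unfolding hermite_fun_d_def[abs_def] by (intro continuous_intros)

lemma hermite_fun_d_bounded: "\<exists>C. \<forall>x::real^'d::finite. \<bar>hermite_fun_d i n x\<bar> \<le> C"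
proof -
  have bdd: "\<exists>C. \<forall>x::real^'d. \<bar>hermite_fun m x\<bar> \<le> C" for m
  proof -
    obtain C where C: "0 < C" "\<And>x::real^'d. \<bar>hermite_fun m x\<bar> \<le> C * exp (- (1/4) * (norm x)\<^sup>2)"
      using hermite_fun_gaussian_bound by blast
    have "\<bar>hermite_fun m x\<bar> \<le> C" for x :: "real^'d"
      by (rule order_trans[OF C(2)]) (use C(1) in simp)
    then show ?thesis by blast
  qed
  define p q where "p = sqrt (real (Suc (n i)) / 2)" and "q = sqrt (real (n i) / 2)"
  obtain A B where A: "\<And>x::real^'d. \<bar>hermite_fun (n(i := Suc (n i))) x\<bar> \<le> A"
    and B: "\<And>x::real^'d. \<bar>hermite_fun (n(i := n i - 1)) x\<bar> \<le> B" using bdd by metis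
  have "\<bar>hermite_fun_d i n x\<bar> \<le> q * B + p * A" for x :: "real^'d"
  proof -
    have "hermite_fun_d i n x = q * hermite_fun (n(i := n i - 1)) x - p * hermite_fun (n(i := Suc (n i))) x"
      unfolding hermite_fun_d_def hermite_fun_mult_coord p_def q_def by (simp add: algebra_simps del: of_nat_Suc)
    then have "\<bar>hermite_fun_d i n x\<bar> \<le> q * \<bar>hermite_fun (n(i := n i - 1)) x\<bar> + p * \<bar>hermite_fun (n(i := Suc (n i))) x\<bar>"
      using abs_triangle_ineq4[of "q * hermite_fun (n(i := n i - 1)) x" "p * hermite_fun (n(i := Suc (n i))) x"]
      by (simp add: abs_mult p_def q_def)
    also have "\<dots> \<le> q * B + p * A"
      using A B by (intro add_mono mult_left_mono) (auto simp: p_def q_def)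
    finally show ?thesis .
  qed
  then show ?thesis by blast
qed

text \<open>
  A crude pointwise bound. It serves only where it is multiplied by rapidly decreasing
  coefficients.
\<close>

lemma hermite1_le: "\<bar>hermite1 k x\<bar> \<le> 2 * (2 * real k + 1)"
proof -
  have "(hermite1 k x)\<^sup>2 \<le> (\<Sum>j\<le>k. (hermite1 j x)\<^sup>2)"
    by (rule member_le_sum) auto
  also have "\<dots> \<le> sqrt (2 * real (Suc k))" by (rule sum_hermite1_sq_le)
  also have "\<dots> \<le> sqrt ((2 * real (Suc k))\<^sup>2)"
    by (intro real_sqrt_le_mono self_le_power) auto
  also have "\<dots> = 2 * real (Suc k)" by simp
  also have "\<dots> \<le> (2 * (2 * real k + 1))\<^sup>2" by (simp add: power2_eq_square algebra_simps)
  finally show ?thesis by (simp add: abs_le_square_iff[symmetric])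
qed

text \<open>
  A substitute for the eigenvalue \<open>2\<bar>n\<bar> + d\<close>, to which it is comparable up to powers, that
  factorizes over the coordinates and so turns sums over multi-indices into products of sums.
\<close>

definition odd_prod :: "('d::finite \<Rightarrow> nat) \<Rightarrow> real" where
  "odd_prod n = (\<Prod>i\<in>UNIV. 2 * real (n i) + 1)"

lemma odd_prod_ge_1: "1 \<le> odd_prod n"
  unfolding odd_prod_def by (rule prod_ge_1) simp

lemma hermite_fun_le: "\<bar>hermite_fun n (x::real^'d::finite)\<bar> \<le> 2 ^ CARD('d) * odd_prod n"
proof -
  have "\<bar>hermite_fun n x\<bar> \<le> (\<Prod>i\<in>UNIV. 2 * (2 * real (n i) + 1))"
    unfolding hermite_fun_def abs_prod by (intro prod_mono conjI hermite1_le abs_ge_zero)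
  also have "\<dots> = 2 ^ CARD('d) * odd_prod n"
    unfolding odd_prod_def prod.distrib prod_constant ..
  finally show ?thesis .
qed

abbreviation hermite_eigenvalue :: "('d::finite \<Rightarrow> nat) \<Rightarrow> real" where
  "hermite_eigenvalue n \<equiv> real (2 * (\<Sum>i\<in>UNIV. n i) + CARD('d))"

lemma hermite_eigenvalue_eq: "hermite_eigenvalue (n :: 'd::finite \<Rightarrow> nat) = (\<Sum>i\<in>UNIV. 2 * real (n i) + 1)"
  by (simp add: sum.distrib sum_distrib_left)

lemma hermite_eigenvalue_coord_le: "2 * real (n i) + 1 \<le> hermite_eigenvalue (n :: 'd::finite \<Rightarrow> nat)"
  unfolding hermite_eigenvalue_eq by (rule member_le_sum) auto

lemma hermite_eigenvalue_ge_1: "1 \<le> hermite_eigenvalue (n :: 'd::finite \<Rightarrow> nat)"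
  by (rule order_trans[OF _ hermite_eigenvalue_coord_le]) simp

lemma odd_prod_le_eigenvalue: "odd_prod (n :: 'd::finite \<Rightarrow> nat) \<le> hermite_eigenvalue n ^ CARD('d)"
  unfolding odd_prod_def prod_constant[symmetric]
  by (intro prod_mono conjI hermite_eigenvalue_coord_le) simp

lemma hermite_eigenvalue_le_odd_prod: "hermite_eigenvalue (n :: 'd::finite \<Rightarrow> nat) \<le> real CARD('d) * odd_prod n"
proof -
  have "2 * real (n i) + 1 \<le> odd_prod n" for i
  proof -
    have "(2 * real (n i) + 1) * 1 \<le> (2 * real (n i) + 1) * (\<Prod>j\<in>UNIV - {i}. 2 * real (n j) + 1)"
      by (intro mult_left_mono prod_ge_1) auto
    then show ?thesis unfolding odd_prod_def by (subst prod.remove[of _ i]) auto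
  qed
  then show ?thesis unfolding hermite_eigenvalue_eq by (rule sum_bounded_above)
qed

lemma finite_multiindex_sublevel: "finite {n :: 'd::finite \<Rightarrow> nat. hermite_eigenvalue n \<le> L}"
proof (rule finite_subset)
  show "{n :: 'd \<Rightarrow> nat. hermite_eigenvalue n \<le> L} \<subseteq> PiE UNIV (\<lambda>_. {..nat \<lceil>L\<rceil>})"
  proof
    fix n :: "'d \<Rightarrow> nat" assume "n \<in> {n. hermite_eigenvalue n \<le> L}"
    then have "2 * real (n i) + 1 \<le> L" for i using hermite_eigenvalue_coord_le[of n i] by simp
    then have "n i \<le> nat \<lceil>L\<rceil>" for i using real_nat_ceiling_ge[of L] by (smt (verit) of_nat_le_iff of_nat_0_le_iff)
    then show "n \<in> PiE UNIV (\<lambda>_. {..nat \<lceil>L\<rceil>})" by auto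
  qed
qed (intro finite_PiE, auto)

lemma sum_multiindex_prod_le:
  fixes f :: "'d::finite \<Rightarrow> nat \<Rightarrow> real"
  assumes nonneg: "\<And>i k. 0 \<le> f i k" and le: "\<And>i N. (\<Sum>k\<le>N. f i k) \<le> K"
    and A: "finite A"
  shows "(\<Sum>n\<in>A. \<Prod>i\<in>UNIV. f i (n i)) \<le> K ^ CARD('d)"
proof -
  define N where "N = Max (insert 0 ((\<lambda>(n, i). n i) ` (A \<times> UNIV)))"
  have "n i \<le> N" if "n \<in> A" for n i
    unfolding N_def using A that by (intro Max_ge) (auto intro!: image_eqI[of _ _ "(n, i)"])
  then have sub: "A \<subseteq> PiE UNIV (\<lambda>_. {..N})" by auto
  have "(\<Sum>n\<in>A. \<Prod>i\<in>UNIV. f i (n i)) \<le> (\<Sum>n\<in>PiE UNIV (\<lambda>_. {..N}). \<Prod>i\<in>UNIV. f i (n i))"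
    using sub by (intro sum_mono2 finite_PiE) (auto intro!: prod_nonneg nonneg)
  also have "\<dots> = (\<Prod>i\<in>UNIV. \<Sum>k\<le>N. f i k)"
    by (subst prod_sum_PiE) auto
  also have "\<dots> \<le> (\<Prod>i\<in>(UNIV :: 'd set). K)"
    by (intro prod_mono conjI le sum_nonneg nonneg)
  finally show ?thesis by simp
qed

text \<open>
  Since \<open>odd_prod n \<le> (2\<bar>n\<bar> + d)\<^sup>d\<close>, the weight \<open>(2\<bar>n\<bar> + d)\<^sup>-\<^sup>2\<^sup>p\<close> is at most a product of
  one-dimensional weights of exponent \<open>2p/d\<close>, which exceeds \<open>1/2\<close> exactly when \<open>p > d/4\<close>.
\<close>

lemma sum_weighted_hermite_fun_sq_bounded:
  assumes "real CARD('d::finite) / 4 < p"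
  shows "\<exists>K>0. \<forall>A (z::real^'d). finite A \<longrightarrow>
    (\<Sum>n\<in>A. hermite_eigenvalue n powr (- 2 * p) * (hermite_fun n z)\<^sup>2) \<le> K"
proof -
  \<comment> \<open>The exponent left for each coordinate.\<close>
  define a where "a = 2 * p / real CARD('d)"
  have "1/2 < a" using assms by (simp add: a_def field_simps)
  then obtain K where K: "0 < K" "\<And>N x. (\<Sum>k\<le>N. real (2 * k + 1) powr - a * (hermite1 k x)\<^sup>2) \<le> K"
    using weighted_sum_hermite1_sq_bounded by blast
  have "(\<Sum>n\<in>A. hermite_eigenvalue n powr (- 2 * p) * (hermite_fun n z)\<^sup>2) \<le> K ^ CARD('d)"
    if A: "finite A" for A and z :: "real^'d"
  proof -
    have "(\<Sum>n\<in>A. hermite_eigenvalue n powr (- 2 * p) * (hermite_fun n z)\<^sup>2)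
        \<le> (\<Sum>n\<in>A. \<Prod>i\<in>UNIV. real (2 * n i + 1) powr - a * (hermite1 (n i) (z $ i))\<^sup>2)"
    proof (rule sum_mono)
      fix n :: "'d \<Rightarrow> nat"
      have l: "1 \<le> hermite_eigenvalue n" by (rule hermite_eigenvalue_ge_1)
      have "hermite_eigenvalue n powr (- 2 * p) = hermite_eigenvalue n powr (real CARD('d) * - a)"
        by (simp add: a_def)
      also have "\<dots> = (hermite_eigenvalue n ^ CARD('d)) powr - a"
        using l by (subst powr_powr[symmetric]) (simp only: powr_realpow)
      also have "\<dots> \<le> odd_prod n powr - a"
        using odd_prod_le_eigenvalue[of n] odd_prod_ge_1[of n] \<open>1/2 < a\<close>
        by (intro powr_mono2') auto
      also have "\<dots> = (\<Prod>i\<in>UNIV. real (2 * n i + 1) powr - a)"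
        unfolding odd_prod_def by (subst prod_powr_distrib) (auto simp: add.commute)
      finally show "hermite_eigenvalue n powr (- 2 * p) * (hermite_fun n z)\<^sup>2
          \<le> (\<Prod>i\<in>UNIV. real (2 * n i + 1) powr - a * (hermite1 (n i) (z $ i))\<^sup>2)"
        unfolding prod.distrib hermite_fun_def prod_power_distrib by (intro mult_right_mono prod_nonneg) auto
    qed
    also have "\<dots> \<le> K ^ CARD('d)"
      by (rule sum_multiindex_prod_le[OF _ K(2) A]) simp
    finally show ?thesis .
  qed
  then show ?thesis using K(1) by (intro exI[of _ "K ^ CARD('d)"]) auto
qed

lemma summable_on_odd_prod:
  "(\<lambda>n :: 'd::finite \<Rightarrow> nat. odd_prod n powr - 2) summable_on UNIV"
proof (rule nonneg_bdd_above_summable_on)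
  have s: "summable (\<lambda>k. real (2 * k + 1) powr - 2)" by (rule summable_odd_powr) simp
  have "(\<Sum>n\<in>A. odd_prod n powr - 2) \<le> (\<Sum>k. real (2 * k + 1) powr - 2) ^ CARD('d)"
    if "finite A" for A :: "('d \<Rightarrow> nat) set"
  proof -
    have "odd_prod n powr - 2 = (\<Prod>i\<in>UNIV. real (2 * n i + 1) powr - 2)" for n :: "'d \<Rightarrow> nat"
      unfolding odd_prod_def by (subst prod_powr_distrib) (auto simp: add.commute)
    then show ?thesis
      using sum_multiindex_prod_le[of "\<lambda>_ k. real (2 * k + 1) powr - 2", OF _ sum_le_suminf[OF s] that]
      by simp
  qed
  then show "bdd_above (sum (\<lambda>n :: 'd \<Rightarrow> nat. odd_prod n powr - 2) ` {F. F \<subseteq> UNIV \<and> finite F})"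
    by (auto intro!: bdd_aboveI2)
qed simp

section \<open>Hermite coefficients of rapidly decreasing functions\<close>

abbreviation schwartz_fun :: "(real^'d::finite \<Rightarrow> real) \<Rightarrow> bool" where
  "schwartz_fun f \<equiv> smooth f \<and> rapidly_decreasing f"

lemma smooth_differentiable: "smooth f \<Longrightarrow> f differentiable (at x)"
  unfolding smooth_def by (drule spec[of _ "[]"]) simp

lemma smooth_continuous: "smooth f \<Longrightarrow> continuous_on A f"
  by (meson continuous_at_imp_continuous_on differentiable_imp_continuous_within smooth_differentiable)

lemma smooth_measurable: "smooth f \<Longrightarrow> f \<in> borel_measurable borel"
  by (intro borel_measurable_continuous_onI smooth_continuous)

lemma iter_partial_partial_deriv: "iter_partial is (partial_deriv i f) = iter_partial (is @ [i]) f"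
  by (induction "is") simp_all

lemma schwartz_partial_deriv: "schwartz_fun f \<Longrightarrow> schwartz_fun (partial_deriv i f)"
  by (simp add: smooth_def rapidly_decreasing_def iter_partial_partial_deriv)

lemma partial_deriv_eqI: "(f has_derivative f') (at x) \<Longrightarrow> partial_deriv i f x = f' (axis i 1)"
  unfolding partial_deriv_def using frechet_derivative_at by metis

lemma smooth_deriv_along_axis:
  fixes f :: "real^'d::finite \<Rightarrow> real"
  assumes "smooth f"
  shows "((\<lambda>s. f (x + s *\<^sub>R axis i 1)) has_real_derivative partial_deriv i f (x + s *\<^sub>R axis i 1)) (at s)"
proof -
  define f' where "f' = frechet_derivative f (at (x + s *\<^sub>R axis i 1))"
  have d: "(f has_derivative f') (at (x + s *\<^sub>R axis i 1))"
    unfolding f'_def using smooth_differentiable[OF assms] by (simp add: frechet_derivative_works)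
  have "((\<lambda>s. f (x + s *\<^sub>R axis i 1)) has_derivative (\<lambda>h. f' (h *\<^sub>R axis i 1))) (at s)"
    by (rule has_derivative_compose[of "\<lambda>s. x + s *\<^sub>R axis i 1" "\<lambda>h. h *\<^sub>R axis i 1" s UNIV f f', OF _ d])
      (auto intro!: derivative_eq_intros)
  moreover have "f' (h *\<^sub>R axis i 1) = partial_deriv i f (x + s *\<^sub>R axis i 1) * h" for h
    using has_derivative_linear[OF d] by (simp add: linear_cmul partial_deriv_def f'_def)
  ultimately show ?thesis by (simp add: has_field_derivative_def)
qed

text \<open>
  Leibniz rule. Only the shape of the lower-order terms matters for smoothness and decay, not which
  derivatives occur in them.
\<close>

lemma iter_partial_mult_coord:
  fixes f :: "real^'d::finite \<Rightarrow> real"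
  assumes f: "smooth f"
  shows "\<exists>L. \<forall>x. iter_partial is (\<lambda>x. x $ i * f x) x = x $ i * iter_partial is f x + (\<Sum>l\<leftarrow>L. iter_partial l f x)"
proof (induction "is")
  case Nil
  show ?case by (intro exI[of _ "[]"]) simp
next
  case (Cons j js)
  then obtain L where L: "iter_partial js (\<lambda>x. x $ i * f x)
      = (\<lambda>x. x $ i * iter_partial js f x + (\<Sum>l\<leftarrow>L. iter_partial l f x))"
    by blast
  let ?D = "\<lambda>l x. frechet_derivative (iter_partial l f) (at x)"
  have d: "(iter_partial l f has_derivative ?D l x) (at x)" for l x
    using f by (simp add: smooth_def flip: frechet_derivative_works)
  have "((\<lambda>x. x $ i * iter_partial js f x + (\<Sum>l\<leftarrow>L. iter_partial l f x)) has_derivative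
      (\<lambda>h. (x $ i * ?D js x h + h $ i * iter_partial js f x) + (\<Sum>l\<leftarrow>L. ?D l x h))) (at x)" for x
  proof (intro has_derivative_add has_derivative_mult d)
    show "((\<lambda>x. x $ i) has_derivative (\<lambda>h. h $ i)) (at x)"
      by (rule bounded_linear_imp_has_derivative[OF bounded_linear_vec_nth])
    show "((\<lambda>x. \<Sum>l\<leftarrow>L. iter_partial l f x) has_derivative (\<lambda>h. \<Sum>l\<leftarrow>L. ?D l x h)) (at x)"
      by (induction L) (auto intro!: has_derivative_add d)
  qed
  from partial_deriv_eqI[OF this, of j]
  have "iter_partial (j # js) (\<lambda>x. x $ i * f x) x
      = x $ i * iter_partial (j # js) f x + (\<Sum>l\<leftarrow>(if i = j then [js] else []) @ map ((#) j) L. iter_partial l f x)" for x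
    by (simp add: L o_def partial_deriv_def axis_def)
  then show ?case by blast
qed

lemma schwartz_mult_coord:
  fixes f :: "real^'d::finite \<Rightarrow> real"
  assumes f: "schwartz_fun f"
  shows "schwartz_fun (\<lambda>x. x $ i * f x)"
proof
  have fd: "iter_partial l f differentiable (at x)" for l x using f by (simp add: smooth_def)
  show "smooth (\<lambda>x. x $ i * f x)"
    unfolding smooth_def
  proof (intro allI)
    fix "is" x
    obtain L where L: "iter_partial is (\<lambda>x. x $ i * f x)
      = (\<lambda>x. x $ i * iter_partial is f x + (\<Sum>l\<leftarrow>L. iter_partial l f x))"
      using iter_partial_mult_coord[of f "is" i] f by blast
    have "(\<lambda>x. \<Sum>l\<leftarrow>L. iter_partial l f x) differentiable (at x)"
      by (induction L) (auto intro!: differentiable_add fd)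
    moreover have "(\<lambda>x. x $ i) differentiable (at x)"
      using bounded_linear_imp_differentiable[OF bounded_linear_vec_nth] .
    ultimately show "iter_partial is (\<lambda>x. x $ i * f x) differentiable (at x)"
      unfolding L by (intro differentiable_add differentiable_mult fd)
  qed
  have bd: "bounded (range (\<lambda>x. norm x ^ k * iter_partial l f x))" for k l
    using f by (simp add: rapidly_decreasing_def)
  show "rapidly_decreasing (\<lambda>x. x $ i * f x)"
    unfolding rapidly_decreasing_def
  proof (intro allI)
    fix "is" k
    obtain L where L: "iter_partial is (\<lambda>x. x $ i * f x)
      = (\<lambda>x. x $ i * iter_partial is f x + (\<Sum>l\<leftarrow>L. iter_partial l f x))"
      using iter_partial_mult_coord[of f "is" i] f by blast
    have 1: "bounded (range (\<lambda>x. norm x ^ k * (\<Sum>l\<leftarrow>L. iter_partial l f x)))"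
      by (induction L) (auto simp: distrib_left intro!: bounded_plus_comp bd)
    obtain B where B: "\<And>x. \<bar>norm x ^ Suc k * iter_partial is f x\<bar> \<le> B"
      using bd[of "Suc k" "is"] unfolding bounded_iff real_norm_def by blast
    have "\<bar>norm x ^ k * (x $ i * iter_partial is f x)\<bar> \<le> B" for x
    proof -
      have "\<bar>norm x ^ k * (x $ i * iter_partial is f x)\<bar> = \<bar>x $ i\<bar> * (norm x ^ k * \<bar>iter_partial is f x\<bar>)"
        by (simp add: abs_mult)
      also have "\<dots> \<le> norm x * (norm x ^ k * \<bar>iter_partial is f x\<bar>)"
        by (intro mult_right_mono component_le_norm_cart) simp
      also have "\<dots> \<le> B" using B[of x] by (simp add: abs_mult)
      finally show ?thesis .
    qed
    then have 2: "bounded (range (\<lambda>x. norm x ^ k * (x $ i * iter_partial is f x)))"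
      unfolding bounded_iff by auto
    show "bounded (range (\<lambda>x. norm x ^ k * iter_partial is (\<lambda>x. x $ i * f x) x))"
      unfolding L distrib_left by (intro bounded_plus_comp 1 2)
  qed
qed

lemma integrable_inverse_one_plus_sq: "integrable lborel (\<lambda>x::real. inverse (1 + x\<^sup>2))"
  using integrable_inverse_1_plus_square by (simp add: set_integrable_def)

lemma rapidly_decreasing_bound:
  assumes "rapidly_decreasing f"
  shows "\<exists>C. \<forall>x. norm x ^ k * \<bar>f x\<bar> \<le> C"
proof -
  have "bounded (range (\<lambda>x. norm x ^ k * iter_partial [] f x))"
    using assms unfolding rapidly_decreasing_def by blast
  then show ?thesis by (auto simp: bounded_iff abs_mult)
qed

lemma schwartz_bounded: "schwartz_fun f \<Longrightarrow> \<exists>C. \<forall>x. \<bar>f x\<bar> \<le> C"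
  using rapidly_decreasing_bound[of f 0] by simp

text \<open>
  Decay of order \<open>2d\<close> gives a bound by a multiple of the product of the integrable functions
  \<open>1 / (1 + x\<^sub>i\<^sup>2)\<close>.
\<close>

lemma schwartz_integrable:
  fixes f :: "real^'d::finite \<Rightarrow> real"
  assumes f: "schwartz_fun f"
  shows "integrable lborel f"
proof -
  define d where "d = CARD('d)"
  obtain A where A: "\<And>x. norm x ^ 0 * \<bar>f x\<bar> \<le> A" using rapidly_decreasing_bound f by blast
  obtain B where B: "\<And>x. norm x ^ (2 * d) * \<bar>f x\<bar> \<le> B" using rapidly_decreasing_bound f by blast
  define w where "w x = (\<Prod>i\<in>UNIV. inverse (1 + (x $ i)\<^sup>2))" for x :: "real^'d"
  have "\<bar>f x\<bar> \<le> 2 ^ d * (A + B) * w x" for x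
  proof -
    have le: "1 + (x $ i)\<^sup>2 \<le> 1 + (norm x)\<^sup>2" for i
      using component_le_norm_cart[of x i] power_mono[of "\<bar>x $ i\<bar>" "norm x" 2] by simp
    have "(\<Prod>i\<in>UNIV. 1 + (x $ i)\<^sup>2) \<le> (1 + (norm x)\<^sup>2) ^ d"
      unfolding d_def prod_constant[symmetric] by (intro prod_mono conjI le) auto
    also have "\<dots> \<le> (2 * max 1 ((norm x)\<^sup>2)) ^ d" by (intro power_mono) auto
    also have "\<dots> \<le> 2 ^ d * (1 + norm x ^ (2 * d))"
      by (auto simp: power_mult_distrib max_def power_mult)
    finally have "\<bar>f x\<bar> * (\<Prod>i\<in>UNIV. 1 + (x $ i)\<^sup>2) \<le> \<bar>f x\<bar> * (2 ^ d * (1 + norm x ^ (2 * d)))"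
      by (intro mult_left_mono) auto
    also have "\<dots> = 2 ^ d * (norm x ^ 0 * \<bar>f x\<bar> + norm x ^ (2 * d) * \<bar>f x\<bar>)"
      by (simp add: algebra_simps)
    also have "\<dots> \<le> 2 ^ d * (A + B)" by (intro mult_left_mono add_mono A B) auto
    finally have "\<bar>f x\<bar> * (\<Prod>i\<in>UNIV. 1 + (x $ i)\<^sup>2) \<le> 2 ^ d * (A + B)" .
    moreover have "0 < (\<Prod>i\<in>UNIV. 1 + (x $ i)\<^sup>2)" by (intro prod_pos) (auto intro: add_pos_nonneg)
    moreover have "w x = inverse (\<Prod>i\<in>UNIV. 1 + (x $ i)\<^sup>2)"
      using prod_inversef[of "\<lambda>i. 1 + (x $ i)\<^sup>2" UNIV] by (simp add: w_def o_def)
    ultimately show ?thesis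
      by (simp only: divide_inverse[symmetric] pos_le_divide_eq)
  qed
  moreover have "0 \<le> w x" for x unfolding w_def by (intro prod_nonneg) auto
  moreover have "0 \<le> A" "0 \<le> B" using A[of 0] B[of 0] by (auto intro: order_trans[rotated])
  ultimately have "AE x in lborel. norm (f x) \<le> norm (2 ^ d * (A + B) * w x)"
    by (simp add: abs_mult)
  moreover have "integrable lborel (\<lambda>x. 2 ^ d * (A + B) * w x)"
    unfolding w_def by (intro integrable_mult_right integrable_prod_vec integrable_inverse_one_plus_sq)
  ultimately show ?thesis
    using f by (intro Bochner_Integration.integrable_bound[of lborel "\<lambda>x. 2 ^ d * (A + B) * w x" f])
      (auto simp: smooth_measurable)
qed

lemma integrable_mult_bounded:
  fixes f g :: "'a \<Rightarrow> real"
  assumes "integrable M f" "g \<in> borel_measurable M" "\<And>x. x \<in> space M \<Longrightarrow> \<bar>g x\<bar> \<le> C"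
  shows "integrable M (\<lambda>x. f x * g x)"
proof (rule Bochner_Integration.integrable_bound[of M "\<lambda>x. C * f x"])
  show "AE x in M. norm (f x * g x) \<le> norm (C * f x)"
  proof (rule AE_I2)
    fix x assume x: "x \<in> space M"
    have "\<bar>g x\<bar> * \<bar>f x\<bar> \<le> \<bar>C\<bar> * \<bar>f x\<bar>"
      using assms(3)[OF x] by (intro mult_right_mono) auto
    then show "norm (f x * g x) \<le> norm (C * f x)" by (simp add: abs_mult mult.commute)
  qed
qed (use assms in auto)

text \<open>
  \<^const>\<open>hermite_coeff\<close> for plain functions, so that differential operators can be iterated without
  packing each intermediate function into the type of rapidly decreasing functions.
\<close>

definition fun_coeff :: "(real^'d::finite \<Rightarrow> real) \<Rightarrow> ('d \<Rightarrow> nat) \<Rightarrow> real" where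
  "fun_coeff f n = (\<integral>x. f x * hermite_fun n x \<partial>lborel)"

lemma hermite_coeff_eq: "hermite_coeff \<phi> n = fun_coeff (sfun \<phi>) n"
  by (simp add: hermite_coeff_def fun_coeff_def)

lemma schwartz_mult_hermite_integrable:
  fixes f :: "real^'d::finite \<Rightarrow> real"
  assumes "schwartz_fun f"
  shows "integrable lborel (\<lambda>x. f x * hermite_fun n x)"
  by (rule integrable_mult_bounded[OF schwartz_integrable[OF assms]]) (auto intro: hermite_fun_le)

lemma fun_coeff_bound:
  fixes f :: "real^'d::finite \<Rightarrow> real"
  assumes "schwartz_fun f"
  shows "\<bar>fun_coeff f n\<bar> \<le> 2 ^ CARD('d) * odd_prod n * (\<integral>x. \<bar>f x\<bar> \<partial>lborel)"
proof -
  have "\<bar>fun_coeff f n\<bar> \<le> (\<integral>x. \<bar>f x * hermite_fun n x\<bar> \<partial>lborel)"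
    unfolding fun_coeff_def by (rule integral_abs_bound)
  also have "\<dots> \<le> (\<integral>x. 2 ^ CARD('d) * odd_prod n * \<bar>f x\<bar> \<partial>lborel)"
  proof (rule integral_mono)
    fix x show "\<bar>f x * hermite_fun n x\<bar> \<le> 2 ^ CARD('d) * odd_prod n * \<bar>f x\<bar>"
      unfolding abs_mult mult.commute[of "\<bar>f x\<bar>"] by (intro mult_right_mono hermite_fun_le) simp
  qed (intro integrable_abs integrable_mult_right schwartz_mult_hermite_integrable schwartz_integrable assms)+
  finally show ?thesis by simp
qed

text \<open>
  The function is \<open>g = x\<^sub>i\<^sup>2 f - \<partial>\<^sub>i\<^sup>2 f\<close>: the operator is symmetric and \<open>h\<^sub>n\<close> is its eigenfunction for
  the eigenvalue \<open>2 n\<^sub>i + 1\<close>.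
\<close>

lemma fun_coeff_hermite_operator:
  fixes f :: "real^'d::finite \<Rightarrow> real"
  assumes f: "schwartz_fun f"
  shows "\<exists>g. schwartz_fun g \<and> (\<forall>n. fun_coeff g n = (2 * real (n i) + 1) * fun_coeff f n)"
proof -
  define f1 where "f1 = partial_deriv i f"
  define f2 where "f2 = partial_deriv i f1"
  define q where "q = (\<lambda>x. x $ i * (x $ i * f x))"
  define g where "g = (\<lambda>x. 1 * q x + (-1) * f2 x)"
  have f1: "schwartz_fun f1" and f2: "schwartz_fun f2"
    unfolding f2_def f1_def using f by (auto intro!: schwartz_partial_deriv)
  have q: "schwartz_fun q" unfolding q_def by (intro schwartz_mult_coord f)
  have g: "schwartz_fun g" unfolding g_def by (rule schwartz_lin[OF q f2])
  have "fun_coeff g n = (2 * real (n i) + 1) * fun_coeff f n" for n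
  proof -
    note int = schwartz_mult_hermite_integrable
    \<comment> \<open>The derivative of \<open>f1 h - f h'\<close>, in which the two products of first derivatives cancel.\<close>
    define G where "G x = (2 * real (n i) + 1) * (f x * hermite_fun n x) - g x * hermite_fun n x" for x
    obtain C where C: "\<And>x::real^'d. \<bar>hermite_fun_d i n x\<bar> \<le> C" using hermite_fun_d_bounded by blast
    have "(\<integral>x. G x \<partial>lborel) = 0"
    proof (rule integral_directional_derivative_eq_0[where v = "axis i 1"])
      show "integrable lborel (\<lambda>x. f1 x * hermite_fun n x - f x * hermite_fun_d i n x)"
        by (intro Bochner_Integration.integrable_diff int f1 integrable_mult_bounded[OF schwartz_integrable[OF f], of _ C] C)
           (simp add: borel_measurable_continuous_onI hermite_fun_d_continuous)
      show "integrable lborel G" unfolding G_def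
        by (intro Bochner_Integration.integrable_diff integrable_mult_right int f g)
      show "continuous_on UNIV G" unfolding G_def
        using f g by (intro continuous_intros smooth_continuous) auto
      fix x :: "real^'d" and s :: real
      let ?y = "x + s *\<^sub>R axis i 1"
      have "((\<lambda>s. f1 (x + s *\<^sub>R axis i 1) * hermite_fun n (x + s *\<^sub>R axis i 1)
          - f (x + s *\<^sub>R axis i 1) * hermite_fun_d i n (x + s *\<^sub>R axis i 1)) has_real_derivative
          (f2 ?y * hermite_fun n ?y + hermite_fun_d i n ?y * f1 ?y)
          - (f1 ?y * hermite_fun_d i n ?y + (((?y $ i)\<^sup>2 - (2 * real (n i) + 1)) * hermite_fun n ?y) * f ?y)) (at s)"
        using smooth_deriv_along_axis[of f x i s] smooth_deriv_along_axis[of f1 x i s] f f1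
        unfolding f1_def[symmetric] f2_def[symmetric]
        by (intro DERIV_diff DERIV_mult hermite_fun_deriv hermite_fun_d_deriv) auto
      moreover have "(f2 ?y * hermite_fun n ?y + hermite_fun_d i n ?y * f1 ?y)
          - (f1 ?y * hermite_fun_d i n ?y + (((?y $ i)\<^sup>2 - (2 * real (n i) + 1)) * hermite_fun n ?y) * f ?y) = G ?y"
        unfolding G_def g_def q_def power2_eq_square by algebra
      ultimately show "((\<lambda>s. f1 (x + s *\<^sub>R axis i 1) * hermite_fun n (x + s *\<^sub>R axis i 1)
          - f (x + s *\<^sub>R axis i 1) * hermite_fun_d i n (x + s *\<^sub>R axis i 1)) has_real_derivative G ?y) (at s)"
        by simp
    qed
    then show ?thesis
      unfolding G_def fun_coeff_def by (simp add: int f g)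
  qed
  with g show ?thesis by blast
qed

lemma fun_coeff_odd_prod:
  fixes f :: "real^'d::finite \<Rightarrow> real"
  assumes f: "schwartz_fun f"
  shows "\<exists>g. schwartz_fun g \<and> (\<forall>n. fun_coeff g n = odd_prod n * fun_coeff f n)"
proof -
  have "\<exists>g. schwartz_fun g \<and> (\<forall>n. fun_coeff g n = (\<Prod>i\<in>A. 2 * real (n i) + 1) * fun_coeff f n)"
    if "finite A" for A :: "'d set"
    using that
  proof induction
    case empty
    then show ?case using f by auto
  next
    case (insert i A)
    then obtain g where g: "schwartz_fun g" "\<And>n. fun_coeff g n = (\<Prod>i\<in>A. 2 * real (n i) + 1) * fun_coeff f n"
      by blast
    from fun_coeff_hermite_operator[OF g(1), of i] g(2) insert.hyps show ?case
      by (auto simp: mult.assoc)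
  qed
  from this[OF finite[of UNIV]] show ?thesis unfolding odd_prod_def .
qed

text \<open>
  Each application of all coordinate operators gains a factor \<open>odd_prod n\<close>; one more application
  than \<open>M\<close> absorbs the growth of the trivial bound \<open>fun_coeff_bound\<close>.
\<close>

lemma fun_coeff_rapid_decay:
  fixes f :: "real^'d::finite \<Rightarrow> real"
  assumes f: "schwartz_fun f"
  shows "\<exists>C\<ge>0. \<forall>n. odd_prod n ^ M * \<bar>fun_coeff f n\<bar> \<le> C"
proof -
  have "\<exists>g. schwartz_fun g \<and> (\<forall>n. fun_coeff g n = odd_prod n ^ k * fun_coeff f n)" for k
  proof (induction k)
    case (Suc k)
    then obtain g where g: "schwartz_fun g" "\<And>n. fun_coeff g n = odd_prod n ^ k * fun_coeff f n" by blast
    from fun_coeff_odd_prod[OF g(1)] g(2) show ?case by (auto simp: mult.assoc)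
  qed (use f in auto)
  from this[of "Suc M"] obtain g where g: "schwartz_fun g"
    "\<And>n. fun_coeff g n = odd_prod n ^ Suc M * fun_coeff f n" by blast
  define C where "C = 2 ^ CARD('d) * (\<integral>x. \<bar>g x\<bar> \<partial>lborel)"
  have "odd_prod n ^ M * \<bar>fun_coeff f n\<bar> \<le> C" for n
  proof -
    have P: "0 < odd_prod n" using odd_prod_ge_1[of n] by linarith
    have "odd_prod n * (odd_prod n ^ M * \<bar>fun_coeff f n\<bar>) = \<bar>fun_coeff g n\<bar>"
      using P by (simp add: g(2) abs_mult)
    also have "\<dots> \<le> odd_prod n * C"
      using fun_coeff_bound[OF g(1), of n] by (simp add: C_def mult_ac)
    finally show ?thesis using P by simp
  qed
  moreover have "0 \<le> C" by (simp add: C_def)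
  ultimately show ?thesis by blast
qed

text \<open>
  Without this, the infinite sum defining \<^const>\<open>hs_norm\<close> could be the default value zero, and no
  bound by the norm would hold.
\<close>

lemma hs_norm_summable:
  "(\<lambda>n. hermite_eigenvalue n powr (2 * p) * hermite_coeff \<phi> n * hermite_coeff \<phi> n) summable_on UNIV"
  for \<phi> :: "'d::finite schwartz"
proof -
  obtain q :: nat where q: "p \<le> real q" using real_arch_simple by blast
  have f: "schwartz_fun (sfun \<phi>)" using sfun[of \<phi>] by simp
  obtain C where C: "0 \<le> C" "\<And>n. odd_prod n ^ (q + 1) * \<bar>fun_coeff (sfun \<phi>) n\<bar> \<le> C"
    using fun_coeff_rapid_decay[OF f] by blast
  define d where "d = real CARD('d)"
  have "(\<lambda>n::'d \<Rightarrow> nat. (d ^ (2 * q) * C\<^sup>2) * odd_prod n powr - 2) summable_on UNIV"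
    by (intro summable_on_cmult_right summable_on_odd_prod)
  then show ?thesis
  proof (rule summable_on_comparison_test)
    fix n :: "'d \<Rightarrow> nat"
    define P c where "P = odd_prod n" and "c = fun_coeff (sfun \<phi>) n"
    have P: "1 \<le> P" unfolding P_def by (rule odd_prod_ge_1)
    have l: "1 \<le> hermite_eigenvalue n" by (rule hermite_eigenvalue_ge_1)
    have "hermite_eigenvalue n powr (2 * p) \<le> hermite_eigenvalue n powr (real (2 * q))"
      using l q by (intro powr_mono) auto
    also have "\<dots> = hermite_eigenvalue n ^ (2 * q)" using l by (intro powr_realpow) linarith
    also have "\<dots> \<le> (d * P) ^ (2 * q)"
      using l hermite_eigenvalue_le_odd_prod[of n] unfolding d_def P_def by (intro power_mono) linarith+
    finally have le: "hermite_eigenvalue n powr (2 * p) \<le> d ^ (2 * q) * P ^ (2 * q)"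
      by (simp add: power_mult_distrib)
    have "hermite_eigenvalue n powr (2 * p) * c * c \<le> (d ^ (2 * q) * P ^ (2 * q)) * (c * c)"
      unfolding mult.assoc by (metis le mult.assoc mult_right_mono zero_le_square)
    also have "\<dots> = d ^ (2 * q) * (P ^ (q + 1) * \<bar>c\<bar>)\<^sup>2 * P powr - 2"
    proof -
      define X where "X = P ^ q"
      have X: "P ^ (2 * q) = X * X" "P ^ (q + 1) = X * P" by (simp_all add: X_def mult_2 power_add)
      have inv: "P powr - 2 = inverse (P * P)" using P by (simp add: powr_minus power2_eq_square)
      have sq: "(X * P * \<bar>c\<bar>)\<^sup>2 = X * X * (P * P) * (c * c)" by (simp add: power2_eq_square)
      show ?thesis unfolding X inv sq using P by (simp add: field_simps)
    qed
    also have "\<dots> \<le> d ^ (2 * q) * C\<^sup>2 * P powr - 2"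
      using C(2)[of n] P unfolding P_def[symmetric] c_def[symmetric]
      by (intro mult_right_mono mult_left_mono power_mono) (auto simp: d_def)
    finally show "hermite_eigenvalue n powr (2 * p) * hermite_coeff \<phi> n * hermite_coeff \<phi> n
        \<le> (d ^ (2 * q) * C\<^sup>2) * odd_prod n powr - 2"
      by (simp add: hermite_coeff_eq c_def P_def)
  qed (simp add: mult.assoc)
qed

lemma schwartz_coeff_bound_summable:
  fixes f :: "real^'d::finite \<Rightarrow> real"
  assumes f: "schwartz_fun f"
  obtains m where "m summable_on UNIV" "\<And>n x. \<bar>fun_coeff f n * hermite_fun n x\<bar> \<le> m n"
proof -
  obtain C where C: "0 \<le> C" "\<And>n. odd_prod n ^ 3 * \<bar>fun_coeff f n\<bar> \<le> C"
    using fun_coeff_rapid_decay[OF f] by blast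
  define m where "m n = (C * 2 ^ CARD('d)) * odd_prod n powr - 2" for n :: "'d \<Rightarrow> nat"
  show ?thesis
  proof
    show "m summable_on UNIV" unfolding m_def
      by (intro summable_on_cmult_right summable_on_odd_prod)
    fix n :: "'d \<Rightarrow> nat" and x :: "real^'d"
    have P: "1 \<le> odd_prod n" by (rule odd_prod_ge_1)
    have "\<bar>fun_coeff f n * hermite_fun n x\<bar> \<le> \<bar>fun_coeff f n\<bar> * (2 ^ CARD('d) * odd_prod n)"
      unfolding abs_mult by (intro mult_left_mono hermite_fun_le) simp
    also have "\<dots> = 2 ^ CARD('d) * (odd_prod n ^ 3 * \<bar>fun_coeff f n\<bar>) * odd_prod n powr - 2"
    proof -
      have "odd_prod n powr - 2 = inverse ((odd_prod n)\<^sup>2)" using P by (simp add: powr_minus)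
      then show ?thesis using P by (simp add: power3_eq_cube power2_eq_square field_simps)
    qed
    also have "\<dots> \<le> 2 ^ CARD('d) * C * odd_prod n powr - 2"
      using C P by (intro mult_right_mono mult_left_mono) auto
    finally show "\<bar>fun_coeff f n * hermite_fun n x\<bar> \<le> m n" by (simp add: m_def mult_ac)
  qed
qed

section \<open>Completeness of the Hermite functions\<close>

text \<open>
  Integrability is part of the notion, because the integral of a non-integrable function is zero by
  default and the closure properties below would fail.
\<close>

definition hermite_orthogonal :: "(real^'d::finite \<Rightarrow> real) \<Rightarrow> bool" where
  "hermite_orthogonal u \<longleftrightarrow>
     (\<forall>n. integrable lborel (\<lambda>x. u x * hermite_fun n x) \<and> (\<integral>x. u x * hermite_fun n x \<partial>lborel) = 0)"

text \<open>
  By the three-term recurrence, multiplying \<open>h\<^sub>n\<close> by a coordinate gives a combination of Hermite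
  functions.
\<close>

lemma hermite_orthogonal_mult_coord:
  assumes "hermite_orthogonal u"
  shows "hermite_orthogonal (\<lambda>x. x $ i * u x)"
proof -
  have eq: "x $ i * u x * hermite_fun n x = sqrt (real (Suc (n i)) / 2) * (u x * hermite_fun (n(i := Suc (n i))) x)
     + sqrt (real (n i) / 2) * (u x * hermite_fun (n(i := n i - 1)) x)" for x n
    using hermite_fun_mult_coord[of x i n] by (simp add: algebra_simps del: of_nat_Suc)
  show ?thesis using assms unfolding hermite_orthogonal_def eq by simp
qed

lemma hermite_orthogonal_lincomb:
  assumes "\<And>i. i \<in> I \<Longrightarrow> hermite_orthogonal (u i)"
  shows "hermite_orthogonal (\<lambda>x. \<Sum>i\<in>I. c i * u i x)"
proof -
  have eq: "(\<Sum>i\<in>I. c i * u i x) * hermite_fun n x = (\<Sum>i\<in>I. c i * (u i x * hermite_fun n x))" for x n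
    by (simp add: sum_distrib_right mult.assoc)
  show ?thesis using assms unfolding hermite_orthogonal_def eq by simp
qed

lemma hermite_orthogonal_mult_inner:
  assumes "hermite_orthogonal u"
  shows "hermite_orthogonal (\<lambda>x. (b \<bullet> x) * u x)"
  using hermite_orthogonal_lincomb[of UNIV "\<lambda>i x. x $ i * u x" "\<lambda>i. b $ i"] hermite_orthogonal_mult_coord[OF assms]
  by (simp add: inner_vec_def sum_distrib_right mult.assoc)

lemma hermite_orthogonal_mult_norm_sq:
  assumes "hermite_orthogonal u"
  shows "hermite_orthogonal (\<lambda>x. (s * (norm x)\<^sup>2) * u x)"
proof -
  have "(s * (norm x)\<^sup>2) * u x = (\<Sum>i\<in>UNIV. s * (x $ i * (x $ i * u x)))" for x
    by (simp add: norm_vec_sq sum_distrib_right sum_distrib_left mult.assoc)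
      (simp add: power2_eq_square mult.assoc)
  then show ?thesis
    using hermite_orthogonal_lincomb[of UNIV "\<lambda>i x. x $ i * (x $ i * u x)" "\<lambda>i. s"]
      hermite_orthogonal_mult_coord[OF hermite_orthogonal_mult_coord[OF assms]]
    by simp
qed

text \<open>
  Expand \<open>exp q\<close> in powers of \<open>q\<close>: every partial sum is orthogonal, and the Gaussian decay of the
  Hermite functions dominates them all.
\<close>

lemma hermite_orthogonal_mult_exp:
  fixes q u :: "real^'d::finite \<Rightarrow> real"
  assumes q: "\<And>v. hermite_orthogonal v \<Longrightarrow> hermite_orthogonal (\<lambda>x. q x * v x)"
    and u: "hermite_orthogonal u"
    and meas [measurable]: "q \<in> borel_measurable borel" "u \<in> borel_measurable borel"
    and bdd: "\<And>x. \<bar>u x\<bar> \<le> B"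
    and int: "integrable lborel (\<lambda>x. exp \<bar>q x\<bar> * exp (- (1/4) * (norm x)\<^sup>2))"
  shows "hermite_orthogonal (\<lambda>x. exp (q x) * u x)"
  unfolding hermite_orthogonal_def
proof
  fix n
  have pow: "hermite_orthogonal (\<lambda>x. q x ^ k * u x)" for k
    by (induction k) (use u q in \<open>auto simp: mult.assoc\<close>)
  obtain C where C: "0 < C" "\<And>x::real^'d. \<bar>hermite_fun n x\<bar> \<le> C * exp (- (1/4) * (norm x)\<^sup>2)"
    using hermite_fun_gaussian_bound by blast
  define S where "S N x = (\<Sum>k<N. (1 / fact k) * (q x ^ k * u x * hermite_fun n x))" for N x
  define w where "w x = B * C * (exp \<bar>q x\<bar> * exp (- (1/4) * (norm x)\<^sup>2))" for x
  have exp_sums: "(\<lambda>k. x ^ k / fact k) sums exp x" for x :: real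
    using exp_converges[of x] by (simp add: divide_inverse mult.commute)
  have w: "integrable lborel w" unfolding w_def using int by simp
  have lim: "AE x in lborel. (\<lambda>N. S N x) \<longlonglongrightarrow> exp (q x) * u x * hermite_fun n x"
  proof (rule AE_I2)
    fix x
    have "(\<lambda>k. q x ^ k / fact k * (u x * hermite_fun n x)) sums (exp (q x) * (u x * hermite_fun n x))"
      by (intro sums_mult2 exp_sums)
    then show "(\<lambda>N. S N x) \<longlonglongrightarrow> exp (q x) * u x * hermite_fun n x"
      by (simp add: sums_def S_def mult.assoc)
  qed
  have dom: "AE x in lborel. norm (S N x) \<le> w x" for N
  proof (rule AE_I2)
    fix x
    have "norm (S N x) \<le> (\<Sum>k<N. \<bar>q x\<bar> ^ k / fact k * (\<bar>u x\<bar> * \<bar>hermite_fun n x\<bar>))"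
      unfolding S_def by (rule order_trans[OF norm_sum]) (simp add: abs_mult power_abs mult.assoc)
    also have "\<dots> = (\<Sum>k<N. \<bar>q x\<bar> ^ k / fact k) * (\<bar>u x\<bar> * \<bar>hermite_fun n x\<bar>)"
      by (simp add: sum_distrib_right)
    also have "\<dots> \<le> exp \<bar>q x\<bar> * (B * (C * exp (- (1/4) * (norm x)\<^sup>2)))"
    proof (intro mult_mono bdd C)
      show "(\<Sum>k<N. \<bar>q x\<bar> ^ k / fact k) \<le> exp \<bar>q x\<bar>"
        unfolding sums_unique[OF exp_sums] by (intro sum_le_suminf sums_summable[OF exp_sums]) auto
    qed (use order_trans[OF abs_ge_zero bdd[of x]] in auto)
    also have "\<dots> = w x" by (simp add: w_def)
    finally show "norm (S N x) \<le> w x" .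
  qed
  have S_meas: "S N \<in> borel_measurable lborel" for N unfolding S_def by measurable
  have S0: "(\<integral>x. S N x \<partial>lborel) = 0" for N
    using pow unfolding S_def hermite_orthogonal_def by simp
  have "(\<lambda>x. exp (q x) * u x * hermite_fun n x) \<in> borel_measurable lborel" by measurable
  note dc = this S_meas w lim dom
  from integrable_dominated_convergence[OF dc] integral_dominated_convergence[OF dc]
  show "integrable lborel (\<lambda>x. exp (q x) * u x * hermite_fun n x) \<and>
    (\<integral>x. exp (q x) * u x * hermite_fun n x \<partial>lborel) = 0"
    by (simp add: S0 LIMSEQ_const_iff)
qed

abbreviation gaussian :: "'a::real_normed_vector \<Rightarrow> real" where
  "gaussian z \<equiv> exp (- 1 * (norm z)\<^sup>2)"

lemma lborel_integral_affine:
  fixes f :: "'a::euclidean_space \<Rightarrow> real"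
  assumes [measurable]: "f \<in> borel_measurable borel" and c: "0 < c"
  shows "(\<integral>x. f x \<partial>lborel) = c ^ DIM('a) * (\<integral>x. f (t + c *\<^sub>R x) \<partial>lborel)"
proof -
  have "(\<integral>x. f x \<partial>lborel) = (\<integral>x. f x \<partial>density (distr lborel borel (\<lambda>x. t + c *\<^sub>R x)) (\<lambda>_. ennreal (c ^ DIM('a))))"
    using lborel_affine[of c t] c by (simp add: power_abs)
  also have "\<dots> = c ^ DIM('a) * (\<integral>x. f (t + c *\<^sub>R x) \<partial>lborel)"
    using c by (subst integral_density) (auto simp: integral_distr)
  finally show ?thesis .
qed

lemma hermite_fun_zero: "hermite_fun (\<lambda>_. 0) x = (1 / sqrt (sqrt pi)) ^ CARD('d) * exp (- (1/2) * (norm x)\<^sup>2)"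
  for x :: "real^'d::finite"
proof -
  have "hermite_fun (\<lambda>_. 0) x = (\<Prod>i\<in>UNIV. 1 / sqrt (sqrt pi) * exp (- (1/2) * (x $ i)\<^sup>2))"
    unfolding hermite_fun_def by (intro prod.cong refl) (simp add: hermite1_def)
  then show ?thesis unfolding prod.distrib prod_constant exp_norm_sq_vec .
qed

text \<open>
  Orthogonality to all Hermite functions is orthogonality to all polynomials times a fixed
  Gaussian. Multiplying repeatedly by \<open>exp (- \<bar>x\<bar>\<^sup>2 / 8)\<close> makes the Gaussian as narrow as desired, and
  multiplying by an exponential \<open>exp (b \<bullet> x)\<close> moves its centre to \<open>a\<close>. So the integrals of \<open>g\<close>
  against an approximate identity at \<open>a\<close> all vanish, and by continuity \<open>g a = 0\<close>.
\<close>

lemma hermite_complete: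
  fixes g :: "real^'d::finite \<Rightarrow> real"
  assumes cont: "continuous_on UNIV g" and bdd: "\<And>x. \<bar>g x\<bar> \<le> B"
    and orth: "\<And>n. (\<integral>x. g x * hermite_fun n x \<partial>lborel) = 0"
  shows "g a = 0"
proof -
  have [measurable]: "g \<in> borel_measurable borel" by (rule borel_measurable_continuous_onI[OF cont])
  have B: "0 \<le> B" using order_trans[OF abs_ge_zero bdd] .
  have "integrable lborel (\<lambda>x. hermite_fun n x * g x)" for n
    by (rule integrable_mult_bounded[OF hermite_fun_integrable _ bdd]) simp
  then have g: "hermite_orthogonal g"
    unfolding hermite_orthogonal_def using orth by (simp add: mult.commute)
  \<comment> \<open>The rate 1/8 stays below the rate 1/4 at which the Hermite functions are known to decay.\<close>
  define u where "u m x = exp (- real m / 8 * (norm x)\<^sup>2) * g x" for m x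
  have u_meas [measurable]: "u m \<in> borel_measurable borel" for m unfolding u_def by measurable
  have u_bdd: "\<bar>u m x\<bar> \<le> B" for m x
  proof -
    have "\<bar>u m x\<bar> \<le> 1 * B" unfolding u_def abs_mult using bdd B by (intro mult_mono) auto
    then show ?thesis by simp
  qed
  have u: "hermite_orthogonal (u m)" for m
  proof (induction m)
    case 0
    then show ?case using g by (simp add: u_def[abs_def])
  next
    case (Suc m)
    have "hermite_orthogonal (\<lambda>x. exp (- (1/8) * (norm x)\<^sup>2) * u m x)"
    proof (rule hermite_orthogonal_mult_exp[OF hermite_orthogonal_mult_norm_sq Suc _ _ u_bdd])
      have "(\<lambda>x::real^'d. exp \<bar>- (1/8) * (norm x)\<^sup>2\<bar> * exp (- (1/4) * (norm x)\<^sup>2)) = (\<lambda>x. exp (- (1/8) * (norm x)\<^sup>2))"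
        by (auto simp flip: exp_add)
      then show "integrable lborel (\<lambda>x::real^'d. exp \<bar>- (1/8) * (norm x)\<^sup>2\<bar> * exp (- (1/4) * (norm x)\<^sup>2))"
        by (simp only:) (rule integrable_gaussian_vec, simp)
    qed measurable
    moreover have "exp (- (1/8) * (norm x)\<^sup>2) * u m x = u (Suc m) x" for x
    proof -
      have "exp (- (1/8) * (norm x)\<^sup>2) * exp (- real m / 8 * (norm x)\<^sup>2) = exp (- real (Suc m) / 8 * (norm x)\<^sup>2)"
        unfolding exp_add[symmetric] by (simp add: field_simps)
      then show ?thesis unfolding u_def by (simp only: mult.assoc[symmetric])
    qed
    ultimately show ?case by simp
  qed
  define \<beta> where "\<beta> m = real m / 8 + 1 / 2" for m
  have \<beta>_pos: "0 < \<beta> m" for m by (simp add: \<beta>_def add_nonneg_pos)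
  have gauss: "(\<integral>x. g x * exp (- \<beta> m * (norm (x - a))\<^sup>2) \<partial>lborel) = 0" for m
  proof -
    \<comment> \<open>This choice completes the square to \<open>- \<beta> m \<bar>x - a\<bar>\<^sup>2\<close>, up to a constant.\<close>
    define b where "b = (2 * \<beta> m) *\<^sub>R a"
    have "hermite_orthogonal (\<lambda>x. exp (b \<bullet> x) * u m x)"
    proof (rule hermite_orthogonal_mult_exp[OF hermite_orthogonal_mult_inner u _ _ u_bdd])
      show "integrable lborel (\<lambda>x. exp \<bar>b \<bullet> x\<bar> * exp (- (1/4) * (norm x)\<^sup>2))"
      proof (rule Bochner_Integration.integrable_bound)
        show "integrable lborel (\<lambda>x::real^'d. exp (2 * (norm b)\<^sup>2) * exp (- (1/8) * (norm x)\<^sup>2))"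
          by (intro integrable_mult_right integrable_gaussian_vec) simp
        show "AE x in lborel. norm (exp \<bar>b \<bullet> x\<bar> * exp (- (1/4) * (norm x)\<^sup>2))
            \<le> norm (exp (2 * (norm b)\<^sup>2) * exp (- (1/8) * (norm x)\<^sup>2))"
        proof (rule AE_I2)
          fix x :: "real^'d"
          have "\<bar>b \<bullet> x\<bar> \<le> norm b * norm x" by (rule Cauchy_Schwarz_ineq2)
          also have "\<dots> \<le> 2 * (norm b)\<^sup>2 + (1/8) * (norm x)\<^sup>2"
            using zero_le_power2[of "norm x - 4 * norm b"] by (simp add: power2_diff algebra_simps)
          finally show "norm (exp \<bar>b \<bullet> x\<bar> * exp (- (1/4) * (norm x)\<^sup>2))
            \<le> norm (exp (2 * (norm b)\<^sup>2) * exp (- (1/8) * (norm x)\<^sup>2))"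
            unfolding exp_add[symmetric] by simp
        qed
      qed measurable
    qed measurable
    then have "(\<integral>x. exp (b \<bullet> x) * u m x * hermite_fun (\<lambda>_. 0) x \<partial>lborel) = 0"
      by (simp add: hermite_orthogonal_def)
    moreover have "exp (b \<bullet> x) * u m x * hermite_fun (\<lambda>_. 0) x
        = ((1 / sqrt (sqrt pi)) ^ CARD('d) * exp (\<beta> m * (norm a)\<^sup>2)) * (g x * exp (- \<beta> m * (norm (x - a))\<^sup>2))" for x
    proof -
      have "exp (b \<bullet> x) * exp (- real m / 8 * (norm x)\<^sup>2) * exp (- (1/2) * (norm x)\<^sup>2)
          = exp (\<beta> m * (norm a)\<^sup>2) * exp (- \<beta> m * (norm (x - a))\<^sup>2)"
        unfolding exp_add[symmetric] b_def \<beta>_def power2_norm_eq_inner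
        by (intro arg_cong[where f = exp]) (simp add: algebra_simps inner_commute)
      then show ?thesis unfolding u_def hermite_fun_zero by (simp only: mult_ac)
    qed
    ultimately show ?thesis by simp
  qed
  define c where "c m = 1 / sqrt (\<beta> m)" for m
  have c_pos: "0 < c m" for m using \<beta>_pos[of m] by (simp add: c_def)
  have shifted: "(\<integral>y. g (a + c m *\<^sub>R y) * gaussian y \<partial>lborel) = 0" for m
  proof -
    have 1: "\<beta> m * (c m)\<^sup>2 = 1" using \<beta>_pos[of m] by (simp add: c_def power_divide)
    have "- 1 * (norm y)\<^sup>2 = - \<beta> m * (norm ((a + c m *\<^sub>R y) - a))\<^sup>2" for y :: "real^'d"
    proof -
      have "- \<beta> m * (norm ((a + c m *\<^sub>R y) - a))\<^sup>2 = - (\<beta> m * (c m)\<^sup>2) * (norm y)\<^sup>2"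
        by (simp add: power_mult_distrib)
      then show ?thesis unfolding 1 by simp
    qed
    note eq = this
    have "c m ^ DIM(real^'d) * (\<integral>y. g (a + c m *\<^sub>R y) * exp (- \<beta> m * (norm ((a + c m *\<^sub>R y) - a))\<^sup>2) \<partial>lborel) = 0"
      using gauss[of m] by (subst lborel_integral_affine[symmetric, OF _ c_pos]) measurable
    then show ?thesis using c_pos[of m] unfolding eq by (auto simp del: DIM_cart)
  qed
  have c_lim: "c \<longlonglongrightarrow> 0"
  proof -
    have "filterlim (\<lambda>m. 1 / 2 + (1/8) * real m) at_top sequentially"
      by (intro filterlim_tendsto_add_at_top[OF tendsto_const]
        filterlim_tendsto_pos_mult_at_top[OF tendsto_const _ filterlim_real_sequentially]) simp
    then have "filterlim (\<lambda>m. sqrt (\<beta> m)) at_top sequentially"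
      unfolding \<beta>_def by (intro filterlim_compose[OF sqrt_at_top]) (simp add: add.commute)
    from tendsto_inverse_0_at_top[OF this] show ?thesis unfolding c_def by (simp add: divide_inverse)
  qed
  have "(\<lambda>m. \<integral>y. g (a + c m *\<^sub>R y) * gaussian y \<partial>lborel) \<longlonglongrightarrow> (\<integral>y. g a * gaussian (y::real^'d) \<partial>lborel)"
  proof (rule integral_dominated_convergence)
    show "integrable lborel (\<lambda>y::real^'d. B * gaussian y)"
      by (intro integrable_mult_right integrable_gaussian_vec) simp
    show "AE y in lborel. (\<lambda>m. g (a + c m *\<^sub>R y) * gaussian y) \<longlonglongrightarrow> g a * gaussian y"
    proof (rule AE_I2)
      fix y :: "real^'d"
      have "(\<lambda>m. a + c m *\<^sub>R y) \<longlonglongrightarrow> a + 0 *\<^sub>R y" by (intro tendsto_intros c_lim)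
      then have "(\<lambda>m. g (a + c m *\<^sub>R y)) \<longlonglongrightarrow> g a"
        using cont by (intro isCont_tendsto_compose[of a g]) (auto simp: continuous_on_eq_continuous_at)
      then show "(\<lambda>m. g (a + c m *\<^sub>R y) * gaussian y) \<longlonglongrightarrow> g a * gaussian y"
        by (intro tendsto_intros)
    qed
    show "AE y in lborel. norm (g (a + c m *\<^sub>R y) * gaussian y) \<le> B * gaussian y" for m
      using bdd by (intro AE_I2) (simp add: abs_mult)
  qed measurable
  then have "(\<integral>y. g a * gaussian (y::real^'d) \<partial>lborel) = 0"
    unfolding shifted by (simp add: LIMSEQ_const_iff)
  then have "g a * sqrt pi ^ CARD('d) = 0"
    using integral_gaussian_vec[where \<beta> = 1 and 'd = 'd] by simp
  then show ?thesis by simp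
qed

section \<open>Hermite expansions and Dirac distributions\<close>

text \<open>
  The series converges uniformly, so its sum is continuous; the difference from \<open>f\<close> is orthogonal
  to all Hermite functions and vanishes by \<open>hermite_complete\<close>.
\<close>

lemma schwartz_hermite_expansion:
  fixes f :: "real^'d::finite \<Rightarrow> real"
  assumes f: "schwartz_fun f"
  shows "((\<lambda>n. fun_coeff f n * hermite_fun n x) has_sum f x) UNIV"
proof -
  obtain m where m: "m summable_on UNIV" "\<And>n x. \<bar>fun_coeff f n * hermite_fun n x\<bar> \<le> m n"
    using schwartz_coeff_bound_summable[OF f] by blast
  define S where "S A x = (\<Sum>n\<in>A. fun_coeff f n * hermite_fun n x)" for A x
  define T where "T x = (\<Sum>\<^sub>\<infinity>n. fun_coeff f n * hermite_fun n x)" for x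
  have summ: "(\<lambda>n. norm (fun_coeff f n * hermite_fun n x)) summable_on UNIV" for x
    by (rule summable_on_comparison_test[OF m(1)]) (use m(2) in auto)
  have unif: "uniform_limit UNIV S T (finite_subsets_at_top UNIV)"
    unfolding S_def T_def by (rule Weierstrass_m_test_general[OF _ m(1)]) (use m(2) in auto)
  have T_cont: "continuous_on UNIV T"
    by (rule uniform_limit_theorem[OF _ unif])
       (simp_all add: S_def always_eventually continuous_on_sum continuous_on_mult_left hermite_fun_continuous)
  define g where "g x = f x - T x" for x
  obtain A where A: "\<And>x. \<bar>f x\<bar> \<le> A" using schwartz_bounded[OF f] by blast
  have T_bdd: "\<bar>T x\<bar> \<le> infsum m UNIV" for x
  proof -
    have "\<bar>T x\<bar> \<le> (\<Sum>\<^sub>\<infinity>n. \<bar>fun_coeff f n * hermite_fun n x\<bar>)"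
      unfolding T_def using norm_infsum_bound[OF summ] by simp
    also have "\<dots> \<le> infsum m UNIV"
      using summ m by (intro infsum_mono) auto
    finally show ?thesis .
  qed
  have "g a = 0" for a
  proof (rule hermite_complete)
    show "continuous_on UNIV g"
      unfolding g_def using f by (intro continuous_intros T_cont smooth_continuous) auto
    show "\<bar>g x\<bar> \<le> A + infsum m UNIV" for x
      using T_bdd[of x] A[of x] abs_triangle_ineq4[of "f x" "T x"] unfolding g_def by linarith
    fix k
    have T_meas [measurable]: "T \<in> borel_measurable borel"
      by (rule borel_measurable_continuous_onI[OF T_cont])
    have f_meas [measurable]: "f \<in> borel_measurable borel" using f by (simp add: smooth_measurable)
    have intfh: "integrable lborel (\<lambda>x. f x * hermite_fun k x)"
      by (rule schwartz_mult_hermite_integrable[OF f])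
    have inthh: "integrable lborel (\<lambda>x. hermite_fun n x * hermite_fun k (x::real^'d))" for n
      by (rule integrable_mult_bounded[OF hermite_fun_integrable]) (auto intro: hermite_fun_le)
    have intS: "integrable lborel (\<lambda>x. S A x * hermite_fun k x)" for A
      unfolding S_def sum_distrib_right mult.assoc by (intro Bochner_Integration.integrable_sum integrable_mult_right inthh)
    have int_abs: "integrable lborel (\<lambda>x. \<bar>hermite_fun k (x::real^'d)\<bar>)"
      by (intro integrable_abs hermite_fun_integrable)
    have "\<bar>\<integral>x. g x * hermite_fun k x \<partial>lborel\<bar> \<le> e * (\<integral>x. \<bar>hermite_fun k (x::real^'d)\<bar> \<partial>lborel)" if e: "0 < e" for e
    proof -
      have "\<forall>\<^sub>F A in finite_subsets_at_top UNIV. \<forall>x\<in>UNIV. dist (S A x) (T x) < e"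
        using unif e by (rule uniform_limitD)
      then obtain A0 where A0: "finite A0" "\<And>A. finite A \<Longrightarrow> A0 \<subseteq> A \<Longrightarrow> \<forall>x\<in>UNIV. dist (S A x) (T x) < e"
        unfolding eventually_finite_subsets_at_top by auto
      define A where "A = insert k A0"
      have A: "finite A" "k \<in> A" "\<And>x. \<bar>S A x - T x\<bar> < e"
        using A0(1) A0(2)[of A] by (auto simp: A_def dist_real_def)
      have "(\<integral>x. S A x * hermite_fun k x \<partial>lborel) = (\<Sum>n\<in>A. fun_coeff f n * (if n = k then 1 else 0))"
        unfolding S_def sum_distrib_right mult.assoc
        by (simp add: inthh hermite_fun_orthonormal)
      also have "\<dots> = (\<Sum>n\<in>A. if n = k then fun_coeff f n else 0)"
        by (intro sum.cong refl) simp
      also have "\<dots> = fun_coeff f k" using A(1,2) by (simp add: sum.delta)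
      finally have eq: "(\<integral>x. S A x * hermite_fun k x \<partial>lborel) = (\<integral>x. f x * hermite_fun k x \<partial>lborel)"
        by (simp add: fun_coeff_def)
      have ST: "\<bar>(S A x - T x) * hermite_fun k x\<bar> \<le> e * \<bar>hermite_fun k x\<bar>" for x
        unfolding abs_mult by (intro mult_right_mono less_imp_le[OF A(3)]) simp
      have intST: "integrable lborel (\<lambda>x. (S A x - T x) * hermite_fun k x)"
      proof (rule Bochner_Integration.integrable_bound[OF integrable_mult_right[OF int_abs, of e]])
        show "AE x in lborel. norm ((S A x - T x) * hermite_fun k x) \<le> norm (e * \<bar>hermite_fun k x\<bar>)"
          using ST e by (intro AE_I2) (simp add: abs_mult)
      qed (simp add: S_def)
      have "(\<integral>x. g x * hermite_fun k x \<partial>lborel)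
          = (\<integral>x. (f x * hermite_fun k x - S A x * hermite_fun k x) + (S A x - T x) * hermite_fun k x \<partial>lborel)"
        by (simp add: g_def algebra_simps)
      also have "\<dots> = (\<integral>x. (S A x - T x) * hermite_fun k x \<partial>lborel)"
        using intfh intS intST eq by simp
      also have "\<bar>\<dots>\<bar> \<le> (\<integral>x. \<bar>(S A x - T x) * hermite_fun k x\<bar> \<partial>lborel)" by (rule integral_abs_bound)
      also have "\<dots> \<le> (\<integral>x. e * \<bar>hermite_fun k (x::real^'d)\<bar> \<partial>lborel)"
        by (intro integral_mono integrable_abs integrable_mult_right intST int_abs ST)
      finally show ?thesis by simp
    qed
    note le = this
    define J where "J = (\<integral>x. \<bar>hermite_fun k (x::real^'d)\<bar> \<partial>lborel)"
    have "((\<lambda>e. e * J) \<longlongrightarrow> 0 * J) (at_right 0)" by (intro tendsto_intros)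
    then have "\<bar>\<integral>x. g x * hermite_fun k x \<partial>lborel\<bar> \<le> 0 * J"
      by (rule tendsto_lowerbound) (auto simp: J_def eventually_at_right_less le eventually_at_filter)
    then show "(\<integral>x. g x * hermite_fun k x \<partial>lborel) = 0" by simp
  qed
  then have "f x = T x" by (simp add: g_def)
  then show ?thesis
    using has_sum_infsum[OF abs_summable_summable[OF summ[of x]]] by (simp add: T_def)
qed

text \<open>
  Cauchy-Schwarz with the weights \<open>(2\<bar>n\<bar> + d)\<^sup>p\<close> and \<open>(2\<bar>n\<bar> + d)\<^sup>-\<^sup>p\<close>. In the
  applications, \<open>D n\<close> is the value at the \<open>n\<close>-th Hermite function of a Dirac distribution or of a
  difference of two.
\<close>

lemma hs_norm_dominates:
  fixes \<phi> :: "'d::finite schwartz"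
  assumes sum: "((\<lambda>n. hermite_coeff \<phi> n * D n) has_sum s) UNIV"
    and D: "\<And>A. finite A \<Longrightarrow> (\<Sum>n\<in>A. hermite_eigenvalue n powr (- 2 * p) * (D n)\<^sup>2) \<le> K\<^sup>2"
    and K: "0 \<le> K"
  shows "\<bar>s\<bar> \<le> K * hs_norm p \<phi>"
proof -
  let ?c = "\<lambda>n. hermite_eigenvalue n powr (2 * p) * hermite_coeff \<phi> n * hermite_coeff \<phi> n"
  have c0: "0 \<le> ?c n" for n by (simp add: mult.assoc)
  have nn: "0 \<le> hs_inner p \<phi> \<phi>" unfolding hs_inner_def by (intro infsum_nonneg c0)
  have fin: "\<bar>\<Sum>n\<in>A. hermite_coeff \<phi> n * D n\<bar> \<le> K * hs_norm p \<phi>" if A: "finite A" for A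
  proof -
    have l: "0 < hermite_eigenvalue n" for n :: "'d \<Rightarrow> nat" using hermite_eigenvalue_ge_1[of n] by linarith
    have "(\<Sum>n\<in>A. hermite_coeff \<phi> n * D n)\<^sup>2
        = (\<Sum>n\<in>A. (hermite_eigenvalue n powr p * hermite_coeff \<phi> n) * (hermite_eigenvalue n powr (- p) * D n))\<^sup>2"
    proof (intro arg_cong[where f = "\<lambda>x. x\<^sup>2"] sum.cong refl)
      fix n :: "'d \<Rightarrow> nat"
      have "hermite_eigenvalue n powr p * hermite_eigenvalue n powr (- p) = 1"
        using l[of n] unfolding powr_add[symmetric] by simp
      then show "hermite_coeff \<phi> n * D n = (hermite_eigenvalue n powr p * hermite_coeff \<phi> n) * (hermite_eigenvalue n powr (- p) * D n)"
        by (simp only: mult_ac)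
    qed
    also have "\<dots> \<le> (\<Sum>n\<in>A. (hermite_eigenvalue n powr p * hermite_coeff \<phi> n)\<^sup>2) * (\<Sum>n\<in>A. (hermite_eigenvalue n powr (- p) * D n)\<^sup>2)"
      by (rule Cauchy_Schwarz_ineq_sum)
    also have "\<dots> = (\<Sum>n\<in>A. ?c n) * (\<Sum>n\<in>A. hermite_eigenvalue n powr (- 2 * p) * (D n)\<^sup>2)"
    proof -
      have "(hermite_eigenvalue n powr p)\<^sup>2 = hermite_eigenvalue n powr (2 * p)"
        "(hermite_eigenvalue n powr (- p))\<^sup>2 = hermite_eigenvalue n powr (- 2 * p)" for n :: "'d \<Rightarrow> nat"
        unfolding power2_eq_square powr_add[symmetric] by simp_all
      then show ?thesis by (simp only: power_mult_distrib power2_eq_square[of "hermite_coeff \<phi> _"] mult.assoc)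
    qed
    also have "\<dots> \<le> hs_inner p \<phi> \<phi> * K\<^sup>2"
    proof (intro mult_mono D A nn)
      show "sum ?c A \<le> hs_inner p \<phi> \<phi>"
        unfolding hs_inner_def using c0 by (intro finite_sum_le_infsum hs_norm_summable A) auto
    qed (auto intro!: sum_nonneg)
    also have "\<dots> = (K * hs_norm p \<phi>)\<^sup>2" using nn by (simp add: hs_norm_def power_mult_distrib)
    finally have "\<bar>\<Sum>n\<in>A. hermite_coeff \<phi> n * D n\<bar> \<le> \<bar>K * hs_norm p \<phi>\<bar>"
      unfolding abs_le_square_iff .
    also have "\<dots> = K * hs_norm p \<phi>" using K nn by (simp add: hs_norm_def)
    finally show ?thesis .
  qed
  from sum have "((\<lambda>A. \<bar>\<Sum>n\<in>A. hermite_coeff \<phi> n * D n\<bar>) \<longlongrightarrow> \<bar>s\<bar>) (finite_subsets_at_top UNIV)"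
    unfolding has_sum_def by (rule tendsto_rabs)
  then show ?thesis
    by (rule tendsto_upperbound) (auto intro!: eventually_finite_subsets_at_top_weakI fin)
qed

lemma sfun_expansion: "((\<lambda>n. hermite_coeff \<phi> n * hermite_fun n z) has_sum sfun \<phi> z) UNIV"
  unfolding hermite_coeff_eq using sfun[of \<phi>] by (intro schwartz_hermite_expansion) simp

lemma dirac_bound:
  assumes "real CARD('d::finite) / 4 < p"
  shows "\<exists>K>0. \<forall>z (\<phi> :: 'd schwartz). \<bar>sfun \<phi> z\<bar> \<le> K * hs_norm p \<phi>"
proof -
  obtain K where K: "0 < K" "\<And>A (z::real^'d). finite A \<Longrightarrow>
    (\<Sum>n\<in>A. hermite_eigenvalue n powr (- 2 * p) * (hermite_fun n z)\<^sup>2) \<le> K"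
    using sum_weighted_hermite_fun_sq_bounded[OF assms] by blast
  have "\<bar>sfun \<phi> z\<bar> \<le> sqrt K * hs_norm p \<phi>" for z and \<phi> :: "'d schwartz"
    by (rule hs_norm_dominates[OF sfun_expansion]) (use K in auto)
  then show ?thesis using K(1) by (intro exI[of _ "sqrt K"]) auto
qed

text \<open>
  Finitely many low modes are continuous in \<open>z\<close>. The remaining ones are uniformly small: with an
  exponent \<open>r\<close> strictly between \<open>d/4\<close> and \<open>p\<close>, their weights gain the factor \<open>L\<^sup>-\<^sup>2\<^sup>(\<^sup>p\<^sup>-\<^sup>r\<^sup>)\<close> while the sums
  with exponent \<open>r\<close> stay bounded.
\<close>

lemma dirac_continuous:
  fixes w :: "real^'d::finite"
  assumes p: "real CARD('d) / 4 < p" and e: "0 < e"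
  shows "\<exists>\<delta>>0. \<forall>z. dist z w < \<delta> \<longrightarrow> (\<forall>\<phi>. \<bar>sfun \<phi> z - sfun \<phi> w\<bar> \<le> e * hs_norm p \<phi>)"
proof -
  define r where "r = (p + real CARD('d) / 4) / 2"
  have r: "real CARD('d) / 4 < r" "r < p" using p by (simp_all add: r_def)
  obtain K where K: "0 < K" "\<And>A (z::real^'d). finite A \<Longrightarrow>
    (\<Sum>n\<in>A. hermite_eigenvalue n powr (- 2 * r) * (hermite_fun n z)\<^sup>2) \<le> K"
    using sum_weighted_hermite_fun_sq_bounded[OF r(1)] by blast
  define s where "s = 2 * (p - r)"
  have s: "0 < s" using r by (simp add: s_def)
  \<comment> \<open>The tail is at most \<open>4 K \<eta>\<close>, which is half of \<open>e\<^sup>2\<close>; the threshold \<open>L\<close> makes its weight gain equal to \<open>\<eta>\<close>.\<close>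
  define \<eta> where "\<eta> = e\<^sup>2 / (8 * K)"
  have \<eta>: "0 < \<eta>" using e K(1) by (simp add: \<eta>_def)
  define L where "L = \<eta> powr (- 1 / s)"
  have L: "0 < L" "L powr (- s) = \<eta>" using \<eta> s by (simp_all add: L_def powr_powr)
  define F where "F = {n :: 'd \<Rightarrow> nat. hermite_eigenvalue n \<le> L}"
  have F: "finite F" unfolding F_def by (rule finite_multiindex_sublevel)
  define W where "W z = (\<Sum>n\<in>F. hermite_eigenvalue n powr (- 2 * p) * (hermite_fun n z - hermite_fun n w)\<^sup>2)" for z
  have "continuous_on UNIV W" unfolding W_def by (intro continuous_intros)
  moreover have "W w = 0" by (simp add: W_def)
  ultimately have "\<exists>\<delta>>0. \<forall>z. dist z w < \<delta> \<longrightarrow> dist (W z) 0 < e\<^sup>2 / 2"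
    using e unfolding continuous_on_iff by (metis UNIV_I half_gt_zero zero_less_power)
  then obtain \<delta> where \<delta>: "0 < \<delta>" "\<And>z. dist z w < \<delta> \<Longrightarrow> W z < e\<^sup>2 / 2"
    by (auto simp: dist_real_def) (smt (verit))
  have "\<bar>sfun \<phi> z - sfun \<phi> w\<bar> \<le> e * hs_norm p \<phi>" if z: "dist z w < \<delta>" for z \<phi>
  proof (rule hs_norm_dominates)
    show "((\<lambda>n. hermite_coeff \<phi> n * (hermite_fun n z - hermite_fun n w)) has_sum (sfun \<phi> z - sfun \<phi> w)) UNIV"
      using has_sum_add[OF sfun_expansion[of \<phi> z] has_sum_cmult_right[OF sfun_expansion[of \<phi> w], of "- 1"]]
      by (simp add: right_diff_distrib)
    fix A :: "('d \<Rightarrow> nat) set" assume A: "finite A"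
    let ?t = "\<lambda>n. hermite_eigenvalue n powr (- 2 * p) * (hermite_fun n z - hermite_fun n w)\<^sup>2"
    have "sum ?t A = sum ?t (A \<inter> F) + sum ?t (A - F)"
      using A by (subst sum.union_disjoint[symmetric]) (auto intro!: sum.cong)
    also have "sum ?t (A \<inter> F) \<le> W z"
      unfolding W_def by (rule sum_mono2[OF F]) auto
    also have "W z \<le> e\<^sup>2 / 2" using \<delta>(2)[OF z] by simp
    also have "sum ?t (A - F) \<le> (\<Sum>n\<in>A - F. \<eta> * (2 * (hermite_eigenvalue n powr (- 2 * r) * (hermite_fun n z)\<^sup>2
        + hermite_eigenvalue n powr (- 2 * r) * (hermite_fun n w)\<^sup>2)))"
    proof (rule sum_mono)
      fix n assume n: "n \<in> A - F"
      have "hermite_eigenvalue n powr (- 2 * p) = hermite_eigenvalue n powr (- s) * hermite_eigenvalue n powr (- 2 * r)"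
        unfolding powr_add[symmetric] s_def by (simp add: algebra_simps)
      also have "\<dots> \<le> \<eta> * hermite_eigenvalue n powr (- 2 * r)"
        unfolding L(2)[symmetric] using n s L(1) by (intro mult_right_mono powr_mono2') (auto simp: F_def)
      finally have 1: "hermite_eigenvalue n powr (- 2 * p) \<le> \<eta> * hermite_eigenvalue n powr (- 2 * r)" .
      have 2: "(hermite_fun n z - hermite_fun n w)\<^sup>2 \<le> 2 * ((hermite_fun n z)\<^sup>2 + (hermite_fun n w)\<^sup>2)"
        using zero_le_power2[of "hermite_fun n z + hermite_fun n w"] by (simp add: power2_diff power2_sum)
      have "?t n \<le> (\<eta> * hermite_eigenvalue n powr (- 2 * r)) * (2 * ((hermite_fun n z)\<^sup>2 + (hermite_fun n w)\<^sup>2))"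
        by (intro mult_mono 1 2) (use \<eta> in auto)
      then show "?t n \<le> \<eta> * (2 * (hermite_eigenvalue n powr (- 2 * r) * (hermite_fun n z)\<^sup>2
        + hermite_eigenvalue n powr (- 2 * r) * (hermite_fun n w)\<^sup>2))"
        by (simp only: distrib_left mult_ac)
    qed
    also have "\<dots> = \<eta> * (2 * ((\<Sum>n\<in>A - F. hermite_eigenvalue n powr (- 2 * r) * (hermite_fun n z)\<^sup>2)
        + (\<Sum>n\<in>A - F. hermite_eigenvalue n powr (- 2 * r) * (hermite_fun n w)\<^sup>2)))"
      by (simp only: sum_distrib_left[symmetric] sum.distrib)
    also have "\<dots> \<le> \<eta> * (2 * (K + K))"
      using \<eta> A by (intro mult_left_mono add_mono K(2)) auto
    also have "\<dots> = e\<^sup>2 / 2" using K(1) by (simp add: \<eta>_def)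
    finally show "sum ?t A \<le> e\<^sup>2" by simp
  qed (use e in simp)
  with \<delta>(1) show ?thesis by blast
qed

section \<open>The dual norm and the Bochner integral of Dirac distributions\<close>

lemma sfun_add: "sfun (\<phi> + \<theta>) x = sfun \<phi> x + sfun \<theta> x"
  by (simp add: plus_schwartz.rep_eq)

lemma sfun_scaleR: "sfun (c *\<^sub>R \<phi>) x = c * sfun \<phi> x"
  by (simp add: scaleR_schwartz.rep_eq)

lemma hs_norm_nonneg: "0 \<le> hs_norm p \<phi>"
  unfolding hs_norm_def hs_inner_def by (auto intro!: infsum_nonneg simp: mult.assoc)

lemma hs_norm_scaleR: "hs_norm p (c *\<^sub>R \<phi>) = \<bar>c\<bar> * hs_norm p \<phi>"
proof -
  have c: "hermite_coeff (c *\<^sub>R \<phi>) n = c * hermite_coeff \<phi> n" for n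
    by (simp add: hermite_coeff_def sfun_scaleR mult.assoc)
  have "hs_inner p (c *\<^sub>R \<phi>) (c *\<^sub>R \<phi>) = (\<Sum>\<^sub>\<infinity>n. (c * c) * (hermite_eigenvalue n powr (2 * p)
        * hermite_coeff \<phi> n * hermite_coeff \<phi> n))"
    unfolding hs_inner_def c by (simp only: mult_ac)
  also have "\<dots> = (c * c) * hs_inner p \<phi> \<phi>"
    unfolding hs_inner_def by (rule infsum_cmult_right')
  finally show ?thesis by (simp add: hs_norm_def real_sqrt_mult)
qed

lemma hs_dual_linear: "T \<in> hs_dual p \<Longrightarrow> linear T"
  by (simp add: hs_dual_def)

lemma hs_dual_bound:
  fixes T :: "'d::finite dist"
  assumes "T \<in> hs_dual p"
  shows "\<bar>T \<phi>\<bar> \<le> dual_norm p T * hs_norm p \<phi>"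
proof -
  obtain K where K: "\<And>\<phi>. \<bar>T \<phi>\<bar> \<le> K * hs_norm p \<phi>" using assms by (auto simp: hs_dual_def)
  have bdd: "bdd_above ((\<lambda>\<phi>. \<bar>T \<phi>\<bar>) ` {\<phi>. hs_norm p \<phi> \<le> 1})"
  proof (rule bdd_aboveI2)
    fix \<phi> :: "'d schwartz" assume \<phi>: "\<phi> \<in> {\<phi>. hs_norm p \<phi> \<le> 1}"
    have "\<bar>T \<phi>\<bar> \<le> \<bar>K\<bar> * hs_norm p \<phi>"
      by (rule order_trans[OF K]) (intro mult_right_mono hs_norm_nonneg, simp)
    also have "\<dots> \<le> \<bar>K\<bar> * 1" using \<phi> by (intro mult_left_mono) auto
    finally show "\<bar>T \<phi>\<bar> \<le> \<bar>K\<bar>" by simp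
  qed
  show ?thesis
  proof (cases "hs_norm p \<phi> = 0")
    case True
    then show ?thesis using K[of \<phi>] by simp
  next
    case False
    define r where "r = hs_norm p \<phi>"
    have r: "0 < r" using False hs_norm_nonneg[of p \<phi>] by (simp add: r_def)
    have "\<bar>T ((1 / r) *\<^sub>R \<phi>)\<bar> \<le> dual_norm p T"
      unfolding dual_norm_def
      by (rule cSUP_upper[OF _ bdd]) (use r in \<open>simp add: hs_norm_scaleR flip: r_def\<close>)
    then show ?thesis
      using r by (simp add: linear_cmul[OF hs_dual_linear[OF assms]] abs_mult field_simps flip: r_def)
  qed
qed

lemma dual_norm_le:
  fixes T :: "'d::finite dist"
  assumes "\<And>\<phi>. \<bar>T \<phi>\<bar> \<le> K * hs_norm p \<phi>" "0 \<le> K"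
  shows "dual_norm p T \<le> K"
  unfolding dual_norm_def
proof (rule cSUP_least)
  have "hs_norm p (0 *\<^sub>R (0 :: 'd schwartz)) \<le> 1" unfolding hs_norm_scaleR by simp
  then show "{\<phi> :: 'd schwartz. hs_norm p \<phi> \<le> 1} \<noteq> {}" by auto
  fix \<phi> :: "'d schwartz"
  assume "\<phi> \<in> {\<phi>. hs_norm p \<phi> \<le> 1}"
  then have "K * hs_norm p \<phi> \<le> K * 1" using assms(2) by (intro mult_left_mono) auto
  then show "\<bar>T \<phi>\<bar> \<le> K" using assms(1)[of \<phi>] by simp
qed

lemma dual_norm_nonneg:
  fixes T :: "'d::finite dist"
  assumes "T \<in> hs_dual p"
  shows "0 \<le> dual_norm p T"
proof (rule ccontr)
  assume neg: "\<not> 0 \<le> dual_norm p T"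
  have "hs_norm p \<phi> = 0" for \<phi> :: "'d schwartz"
    using order_trans[OF abs_ge_zero hs_dual_bound[OF assms, of \<phi>]] neg hs_norm_nonneg[of p \<phi>]
    by (auto simp: zero_le_mult_iff)
  then have "\<bar>T \<phi>\<bar> = 0" for \<phi> using hs_dual_bound[OF assms, of \<phi>] by simp
  moreover have "hs_norm p (0 *\<^sub>R (0 :: 'd schwartz)) \<le> 1" unfolding hs_norm_scaleR by simp
  ultimately have "dual_norm p T = 0"
    unfolding dual_norm_def by (auto simp: image_constant_conv)
  with neg show False by simp
qed

lemma hs_dual_lincomb:
  assumes T: "T \<in> hs_dual p" and S: "S \<in> hs_dual p"
  shows "(\<lambda>\<phi>. a * T \<phi> + b * S \<phi>) \<in> hs_dual p"
  unfolding hs_dual_def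
proof (intro CollectI conjI exI allI)
  show "linear (\<lambda>\<phi>. a * T \<phi> + b * S \<phi>)"
    using hs_dual_linear[OF T] hs_dual_linear[OF S]
    by (intro linearI) (auto simp: linear_add linear_cmul algebra_simps)
  fix \<phi>
  have "\<bar>a * T \<phi> + b * S \<phi>\<bar> \<le> \<bar>a\<bar> * \<bar>T \<phi>\<bar> + \<bar>b\<bar> * \<bar>S \<phi>\<bar>"
    using abs_triangle_ineq[of "a * T \<phi>" "b * S \<phi>"] by (simp add: abs_mult)
  also have "\<dots> \<le> \<bar>a\<bar> * (dual_norm p T * hs_norm p \<phi>) + \<bar>b\<bar> * (dual_norm p S * hs_norm p \<phi>)"
    by (intro add_mono mult_left_mono hs_dual_bound T S) auto
  finally show "\<bar>a * T \<phi> + b * S \<phi>\<bar> \<le> (\<bar>a\<bar> * dual_norm p T + \<bar>b\<bar> * dual_norm p S) * hs_norm p \<phi>"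
    by (simp add: algebra_simps)
qed

lemma hs_dual_diff: "T \<in> hs_dual p \<Longrightarrow> S \<in> hs_dual p \<Longrightarrow> (\<lambda>\<phi>. T \<phi> - S \<phi>) \<in> hs_dual p"
  using hs_dual_lincomb[of T p S 1 "-1"] by simp

lemma hs_dual_cmult: "T \<in> hs_dual p \<Longrightarrow> (\<lambda>\<phi>. a * T \<phi>) \<in> hs_dual p"
  using hs_dual_lincomb[of T p T a 0] by simp

lemma hs_dual_zero: "(\<lambda>_. 0) \<in> hs_dual p"
  unfolding hs_dual_def by (auto intro!: linearI exI[of _ 0])

lemma hs_dual_sum: "finite A \<Longrightarrow> (\<And>T. T \<in> A \<Longrightarrow> T \<in> hs_dual p) \<Longrightarrow> (\<lambda>\<phi>. \<Sum>T\<in>A. c T * T \<phi>) \<in> hs_dual p"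
proof (induction A rule: finite_induct)
  case empty
  then show ?case by (simp add: hs_dual_zero)
next
  case (insert S A)
  then show ?case using hs_dual_lincomb[of S p "\<lambda>\<phi>. \<Sum>T\<in>A. c T * T \<phi>" "c S" 1] by simp
qed

lemma dual_norm_triangle:
  assumes "\<And>\<phi>. R \<phi> = a * T \<phi> + b * S \<phi>" "T \<in> hs_dual p" "S \<in> hs_dual p"
  shows "dual_norm p R \<le> \<bar>a\<bar> * dual_norm p T + \<bar>b\<bar> * dual_norm p S"
proof (rule dual_norm_le)
  fix \<phi>
  have "\<bar>R \<phi>\<bar> \<le> \<bar>a\<bar> * \<bar>T \<phi>\<bar> + \<bar>b\<bar> * \<bar>S \<phi>\<bar>"
    unfolding assms(1) using abs_triangle_ineq[of "a * T \<phi>" "b * S \<phi>"] by (simp add: abs_mult)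
  also have "\<dots> \<le> \<bar>a\<bar> * (dual_norm p T * hs_norm p \<phi>) + \<bar>b\<bar> * (dual_norm p S * hs_norm p \<phi>)"
    by (intro add_mono mult_left_mono hs_dual_bound assms) auto
  finally show "\<bar>R \<phi>\<bar> \<le> (\<bar>a\<bar> * dual_norm p T + \<bar>b\<bar> * dual_norm p S) * hs_norm p \<phi>"
    by (simp add: algebra_simps)
qed (intro add_nonneg_nonneg mult_nonneg_nonneg dual_norm_nonneg assms abs_ge_zero)

lemma dirac_in_hs_dual:
  assumes "real CARD('d::finite) / 4 < p"
  shows "dirac (z :: real^'d) \<in> hs_dual p"
  using dirac_bound[OF assms] unfolding hs_dual_def dirac_def
  by (auto intro!: linearI simp: sfun_add sfun_scaleR)

lemma dirac_dual_norm_bounded: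
  assumes "real CARD('d::finite) / 4 < p"
  shows "\<exists>K>0. \<forall>z :: real^'d. dual_norm p (dirac z) \<le> K"
proof -
  obtain K where "0 < K" "\<And>z (\<phi> :: 'd schwartz). \<bar>sfun \<phi> z\<bar> \<le> K * hs_norm p \<phi>"
    using dirac_bound[OF assms] by blast
  then show ?thesis by (intro exI[of _ K]) (auto simp: dirac_def intro!: dual_norm_le)
qed

lemma dirac_tendsto:
  fixes w :: "real^'d::finite"
  assumes p: "real CARD('d) / 4 < p" and u: "(u \<longlongrightarrow> w) F"
  shows "((\<lambda>i. dual_norm p (\<lambda>\<phi>. dirac w \<phi> - dirac (u i) \<phi>)) \<longlongrightarrow> 0) F"
proof (rule tendstoI)
  fix e :: real assume e: "0 < e"
  obtain \<delta> where \<delta>: "0 < \<delta>" "\<And>z \<phi>. dist z w < \<delta> \<Longrightarrow> \<bar>sfun \<phi> z - sfun \<phi> w\<bar> \<le> (e / 2) * hs_norm p \<phi>"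
    using dirac_continuous[OF p, of "e / 2" w] e by auto
  have "dist (dual_norm p (\<lambda>\<phi>. dirac w \<phi> - dirac z \<phi>)) 0 < e" if "dist z w < \<delta>" for z
  proof -
    have "dual_norm p (\<lambda>\<phi>. dirac w \<phi> - dirac z \<phi>) \<le> e / 2"
      by (rule dual_norm_le) (use \<delta>(2)[OF that] e in \<open>auto simp: dirac_def abs_minus_commute\<close>)
    moreover have "0 \<le> dual_norm p (\<lambda>\<phi>. dirac w \<phi> - dirac z \<phi>)"
      by (intro dual_norm_nonneg hs_dual_diff dirac_in_hs_dual p)
    ultimately show ?thesis using e by simp
  qed
  then show "\<forall>\<^sub>F i in F. dist (dual_norm p (\<lambda>\<phi>. dirac w \<phi> - dirac (u i) \<phi>)) 0 < e"
    using tendstoD[OF u \<delta>(1)] by (auto elim: eventually_mono)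
qed

text \<open>
  The norm is a supremum over uncountably many test functions, so measurability of norms is
  obtained from continuity in the parameters; see \<open>measurable_dual_norm_dirac_diff\<close>.
\<close>

lemma continuous_dual_norm_scaled_dirac_diff:
  fixes T :: "'d::finite dist"
  assumes p: "real CARD('d) / 4 < p" and T: "T \<in> hs_dual p"
  shows "continuous_on UNIV (\<lambda>x. dual_norm p (\<lambda>\<phi>. fst x * dirac (snd x) \<phi> - T \<phi>))"
  unfolding continuous_on_def
proof
  fix x0 :: "real \<times> (real^'d)"
  obtain K where K: "0 < K" "\<And>z :: real^'d. dual_norm p (dirac z) \<le> K"
    using dirac_dual_norm_bounded[OF p] by blast
  let ?N = "\<lambda>x. dual_norm p (\<lambda>\<phi>. fst x * dirac (snd x) \<phi> - T \<phi>)"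
  let ?E = "\<lambda>x. dual_norm p (\<lambda>\<phi>. dirac (snd x0) \<phi> - dirac (snd x) \<phi>)"
  let ?F = "\<lambda>x. dual_norm p (\<lambda>\<phi>. fst x * dirac (snd x) \<phi> - fst x0 * dirac (snd x0) \<phi>)"
  note dual = hs_dual_diff hs_dual_cmult dirac_in_hs_dual p T
  have F: "?F x \<le> \<bar>fst x - fst x0\<bar> * K + \<bar>fst x0\<bar> * ?E x" for x
  proof -
    have "?F x \<le> \<bar>fst x - fst x0\<bar> * dual_norm p (dirac (snd x)) + \<bar>- fst x0\<bar> * ?E x"
      by (rule dual_norm_triangle) (auto intro!: dual simp: algebra_simps)
    also have "\<dots> \<le> \<bar>fst x - fst x0\<bar> * K + \<bar>fst x0\<bar> * ?E x"
      by (intro add_mono mult_left_mono K) auto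
    finally show ?thesis .
  qed
  have "norm (?N x - ?N x0) \<le> ?F x" for x
  proof -
    have "?N x \<le> \<bar>1\<bar> * ?F x + \<bar>1\<bar> * ?N x0"
      by (rule dual_norm_triangle) (auto intro!: dual)
    moreover have "?N x0 \<le> \<bar>- 1\<bar> * ?F x + \<bar>1\<bar> * ?N x"
      by (rule dual_norm_triangle) (auto intro!: dual)
    ultimately show ?thesis by simp
  qed
  then have le: "norm (?N x - ?N x0) \<le> \<bar>fst x - fst x0\<bar> * K + \<bar>fst x0\<bar> * ?E x" for x
    using F order_trans by blast
  have "((\<lambda>x. \<bar>fst x - fst x0\<bar> * K + \<bar>fst x0\<bar> * ?E x) \<longlongrightarrow> \<bar>fst x0 - fst x0\<bar> * K + \<bar>fst x0\<bar> * 0) (at x0)"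
    by (intro tendsto_intros dirac_tendsto[OF p])
  then have lim: "((\<lambda>x. \<bar>fst x - fst x0\<bar> * K + \<bar>fst x0\<bar> * ?E x) \<longlongrightarrow> 0) (at x0)" by simp
  have "((\<lambda>x. ?N x - ?N x0) \<longlongrightarrow> 0) (at x0)"
    by (rule Lim_null_comparison[OF _ lim]) (intro always_eventually allI le)
  then show "(?N \<longlongrightarrow> ?N x0) (at x0 within UNIV)"
    by (simp add: LIM_zero_iff)
qed

text \<open>
  On each of the finitely many level sets of \<open>s\<close> this is a continuous function of \<open>(c z, w z)\<close>.
\<close>

lemma measurable_dual_norm_dirac_diff:
  fixes s :: "'a \<Rightarrow> 'd::finite dist"
  assumes p: "real CARD('d) / 4 < p"
    and [measurable]: "c \<in> borel_measurable M" "w \<in> borel_measurable M"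
    and s: "simple_function M s" "\<And>z. z \<in> space M \<Longrightarrow> s z \<in> hs_dual p"
  shows "(\<lambda>z. dual_norm p (\<lambda>\<phi>. c z * dirac (w z) \<phi> - s z \<phi>)) \<in> borel_measurable M"
proof -
  let ?N = "\<lambda>T x. dual_norm p (\<lambda>\<phi>. fst x * dirac (snd x) \<phi> - T \<phi>)"
  have "(\<lambda>z. ?N T (c z, w z)) \<in> borel_measurable M" if "T \<in> s ` space M" for T
  proof (rule measurable_compose[where g = "?N T" and N = borel])
    show "?N T \<in> borel_measurable borel"
      using that s by (intro borel_measurable_continuous_onI continuous_dual_norm_scaled_dirac_diff p) auto
  qed measurable
  then have N: "(\<lambda>z. dual_norm p (\<lambda>\<phi>. c z * dirac (w z) \<phi> - T \<phi>)) \<in> borel_measurable M"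
    if "T \<in> s ` space M" for T using that by simp
  have fin: "finite (s ` space M)" using s by (simp add: simple_function_def)
  have sets: "s -` {T} \<inter> space M \<in> sets M" for T using s by (auto simp: simple_function_def intro: simple_functionD(2)[OF s(1)])
  have "(\<lambda>z. \<Sum>T\<in>s ` space M. indicator (s -` {T} \<inter> space M) z * dual_norm p (\<lambda>\<phi>. c z * dirac (w z) \<phi> - T \<phi>))
      \<in> borel_measurable M"
    using sets by (intro borel_measurable_sum borel_measurable_times N borel_measurable_indicator) auto
  moreover have "(\<Sum>T\<in>s ` space M. indicator (s -` {T} \<inter> space M) z * dual_norm p (\<lambda>\<phi>. c z * dirac (w z) \<phi> - T \<phi>))
      = dual_norm p (\<lambda>\<phi>. c z * dirac (w z) \<phi> - s z \<phi>)" if z: "z \<in> space M" for z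
  proof -
    have "(\<Sum>T\<in>s ` space M. indicator (s -` {T} \<inter> space M) z * dual_norm p (\<lambda>\<phi>. c z * dirac (w z) \<phi> - T \<phi>))
       = (\<Sum>T\<in>s ` space M. if T = s z then dual_norm p (\<lambda>\<phi>. c z * dirac (w z) \<phi> - s z \<phi>) else 0)"
      using z by (intro sum.cong refl) auto
    also have "\<dots> = dual_norm p (\<lambda>\<phi>. c z * dirac (w z) \<phi> - s z \<phi>)"
      using z fin by simp
    finally show ?thesis .
  qed
  ultimately show ?thesis by (simp cong: measurable_cong)
qed

lemma hs_simple_integral_eq:
  assumes s: "hs_simple p M s"
  shows "integrable M (\<lambda>z. s z \<phi>)" and "hs_simple_integral M s \<phi> = (\<integral>z. s z \<phi> \<partial>M)"
proof -
  have sf: "simple_function M s" and fin: "emeasure M {z \<in> space M. s z \<noteq> (\<lambda>_. 0)} \<noteq> \<infinity>"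
    using s by (auto simp: hs_simple_def)
  have fr: "finite (s ` space M)" using sf by (simp add: simple_function_def)
  let ?E = "\<lambda>T. {z \<in> space M. s z = T}"
  have "?E T = s -` {T} \<inter> space M" for T by auto
  then have sets: "?E T \<in> sets M" for T using simple_functionD(2)[OF sf, of "{T}"] by simp
  have "{z \<in> space M. s z \<noteq> (\<lambda>_. 0)} = space M - ?E (\<lambda>_. 0)" by auto
  then have sets0: "{z \<in> space M. s z \<noteq> (\<lambda>_. 0)} \<in> sets M" using sets by auto
  have int: "integrable M (\<lambda>z. T \<phi> * indicator (?E T) z)" for T
  proof (cases "T = (\<lambda>_. 0)")
    case False
    then have "emeasure M (?E T) \<le> emeasure M {z \<in> space M. s z \<noteq> (\<lambda>_. 0)}"
      by (intro emeasure_mono sets0) auto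
    then have "emeasure M (?E T) < \<infinity>" using fin by (auto simp: less_top[symmetric] top_unique)
    then show ?thesis using sets by (intro integrable_mult_right integrable_real_indicator)
  qed simp
  have eq: "s z \<phi> = (\<Sum>T\<in>s ` space M. T \<phi> * indicator (?E T) z)" if z: "z \<in> space M" for z
  proof -
    have "(\<Sum>T\<in>s ` space M. T \<phi> * indicator (?E T) z) = (\<Sum>T\<in>s ` space M. if T = s z then s z \<phi> else 0)"
      using z by (intro sum.cong refl) auto
    also have "\<dots> = s z \<phi>" using z fr by simp
    finally show ?thesis ..
  qed
  show "integrable M (\<lambda>z. s z \<phi>)"
    by (subst Bochner_Integration.integrable_cong[OF refl eq]) (auto intro!: Bochner_Integration.integrable_sum int)
  have "(\<integral>z. s z \<phi> \<partial>M) = (\<integral>z. (\<Sum>T\<in>s ` space M. T \<phi> * indicator (?E T) z) \<partial>M)"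
    by (rule Bochner_Integration.integral_cong[OF refl eq])
  also have "\<dots> = (\<Sum>T\<in>s ` space M. T \<phi> * measure M (?E T))"
    by (subst Bochner_Integration.integral_sum[OF int]) (simp add: sets Int_absorb2)
  finally show "hs_simple_integral M s \<phi> = (\<integral>z. s z \<phi> \<partial>M)"
    by (simp add: hs_simple_integral_def mult.commute)
qed

lemma hs_simple_integral_approx:
  assumes s: "hs_simple p M s" and f: "\<And>z. z \<in> space M \<Longrightarrow> f z \<in> hs_dual p"
    and meas: "(\<lambda>z. dual_norm p (\<lambda>\<phi>. f z \<phi> - s z \<phi>)) \<in> borel_measurable M"
    and int: "integrable M (\<lambda>z. f z \<phi>)"
  shows "ennreal \<bar>(\<integral>z. f z \<phi> \<partial>M) - hs_simple_integral M s \<phi>\<bar>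
    \<le> (\<integral>\<^sup>+z. ennreal (dual_norm p (\<lambda>\<phi>. f z \<phi> - s z \<phi>)) \<partial>M) * ennreal (hs_norm p \<phi>)"
proof -
  note si = hs_simple_integral_eq[OF s]
  have sd: "z \<in> space M \<Longrightarrow> s z \<in> hs_dual p" for z using s by (simp add: hs_simple_def)
  have "ennreal \<bar>(\<integral>z. f z \<phi> \<partial>M) - hs_simple_integral M s \<phi>\<bar> = ennreal \<bar>\<integral>z. f z \<phi> - s z \<phi> \<partial>M\<bar>"
    using int si by simp
  also have "\<dots> \<le> ennreal (\<integral>z. \<bar>f z \<phi> - s z \<phi>\<bar> \<partial>M)" by (intro ennreal_leI integral_abs_bound)
  also have "\<dots> = (\<integral>\<^sup>+z. ennreal \<bar>f z \<phi> - s z \<phi>\<bar> \<partial>M)"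
    using int si by (intro nn_integral_eq_integral[symmetric]) auto
  also have "\<dots> \<le> (\<integral>\<^sup>+z. ennreal (dual_norm p (\<lambda>\<phi>. f z \<phi> - s z \<phi>)) * ennreal (hs_norm p \<phi>) \<partial>M)"
  proof (rule nn_integral_mono)
    fix z assume z: "z \<in> space M"
    have "(\<lambda>\<phi>. f z \<phi> - s z \<phi>) \<in> hs_dual p" by (intro hs_dual_diff f sd z)
    from hs_dual_bound[OF this, of \<phi>] dual_norm_nonneg[OF this]
    show "ennreal \<bar>f z \<phi> - s z \<phi>\<bar> \<le> ennreal (dual_norm p (\<lambda>\<phi>. f z \<phi> - s z \<phi>)) * ennreal (hs_norm p \<phi>)"
      by (subst ennreal_mult[symmetric]) (auto intro: ennreal_leI hs_norm_nonneg)
  qed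
  also have "\<dots> = (\<integral>\<^sup>+z. ennreal (dual_norm p (\<lambda>\<phi>. f z \<phi> - s z \<phi>)) \<partial>M) * ennreal (hs_norm p \<phi>)"
    using meas by (intro nn_integral_multc) auto
  finally show ?thesis .
qed

text \<open>
  Testing commutes with the Bochner integral; in particular the integral is unique as soon as all
  tested integrands are integrable.
\<close>

lemma has_hs_integral_eval:
  assumes I: "has_hs_integral p M f I" and int: "integrable M (\<lambda>z. f z \<phi>)"
  shows "I \<phi> = (\<integral>z. f z \<phi> \<partial>M)"
proof -
  obtain s where I_dual: "I \<in> hs_dual p" and f: "\<And>z. z \<in> space M \<Longrightarrow> f z \<in> hs_dual p"
    and s: "\<And>i::nat. hs_simple p M (s i)"
    and meas: "\<And>i. (\<lambda>z. dual_norm p (\<lambda>\<phi>. f z \<phi> - s i z \<phi>)) \<in> borel_measurable M"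
    and lim: "(\<lambda>i. \<integral>\<^sup>+z. ennreal (dual_norm p (\<lambda>\<phi>. f z \<phi> - s i z \<phi>)) \<partial>M) \<longlonglongrightarrow> 0"
    and limI: "(\<lambda>i. dual_norm p (\<lambda>\<phi>. I \<phi> - hs_simple_integral M (s i) \<phi>)) \<longlonglongrightarrow> 0"
    using I unfolding has_hs_integral_def by blast
  let ?S = "\<lambda>i. hs_simple_integral M (s i) \<phi>"
  have "(\<lambda>i. ennreal \<bar>(\<integral>z. f z \<phi> \<partial>M) - ?S i\<bar>) \<longlonglongrightarrow> 0"
  proof (rule tendsto_sandwich[OF _ _ tendsto_const])
    show "\<forall>\<^sub>F i in sequentially. ennreal \<bar>(\<integral>z. f z \<phi> \<partial>M) - ?S i\<bar>
        \<le> (\<integral>\<^sup>+z. ennreal (dual_norm p (\<lambda>\<phi>. f z \<phi> - s i z \<phi>)) \<partial>M) * ennreal (hs_norm p \<phi>)"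
      by (intro always_eventually allI hs_simple_integral_approx s f meas int)
    show "(\<lambda>i. (\<integral>\<^sup>+z. ennreal (dual_norm p (\<lambda>\<phi>. f z \<phi> - s i z \<phi>)) \<partial>M) * ennreal (hs_norm p \<phi>)) \<longlonglongrightarrow> 0"
      using ennreal_tendsto_cmult[OF _ lim, of "ennreal (hs_norm p \<phi>)"] by (simp add: mult.commute)
  qed simp
  then have "(\<lambda>i. \<bar>(\<integral>z. f z \<phi> \<partial>M) - ?S i\<bar>) \<longlonglongrightarrow> 0"
    using tendsto_ennreal_iff[of "\<lambda>i. \<bar>(\<integral>z. f z \<phi> \<partial>M) - ?S i\<bar>" sequentially 0] by simp
  then have 1: "(\<lambda>i. (\<integral>z. f z \<phi> \<partial>M) - ?S i) \<longlonglongrightarrow> 0" by (simp add: tendsto_rabs_zero_iff)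
  have "\<bar>I \<phi> - ?S i\<bar> \<le> dual_norm p (\<lambda>\<phi>. I \<phi> - hs_simple_integral M (s i) \<phi>) * hs_norm p \<phi>" for i
  proof (rule hs_dual_bound[where T = "\<lambda>\<phi>. I \<phi> - hs_simple_integral M (s i) \<phi>"])
    have "hs_simple_integral M (s i) \<in> hs_dual p"
      unfolding hs_simple_integral_def using s[of i]
      by (intro hs_dual_sum) (auto simp: hs_simple_def simple_function_def)
    then show "(\<lambda>\<phi>. I \<phi> - hs_simple_integral M (s i) \<phi>) \<in> hs_dual p" by (intro hs_dual_diff I_dual)
  qed
  then have 2: "(\<lambda>i. I \<phi> - ?S i) \<longlonglongrightarrow> 0"
    by (intro Lim_null_comparison[OF _ tendsto_mult_left_zero[OF limI, of "hs_norm p \<phi>"]]) auto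
  from tendsto_diff[OF 2 1] show ?thesis by (simp add: LIMSEQ_const_iff)
qed

text \<open>
  The approximants are \<open>c\<^sub>i(z) \<delta>\<close> at \<open>v\<^sub>i(z)\<close>, for simple functions \<open>c\<^sub>i \<rightarrow> \<psi>\<close> in \<open>L\<^sup>1\<close> and \<open>v\<^sub>i \<rightarrow> w\<close> pointwise. The
  error is at most \<open>\<bar>\<psi> - c\<^sub>i\<bar> K\<close> plus \<open>\<bar>\<psi>\<bar>\<close> times the distance of two Dirac distributions, which tends
  to zero by continuity and is bounded by \<open>2 K\<close>, so dominated convergence applies.
\<close>

lemma has_hs_integral_dirac:
  fixes w :: "'a \<Rightarrow> real^'d::finite"
  assumes p: "real CARD('d) / 4 < p"
    and \<psi>: "integrable M \<psi>" and w [measurable]: "w \<in> borel_measurable M"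
  shows "has_hs_integral p M (\<lambda>z \<phi>. \<psi> z * dirac (w z) \<phi>) (\<lambda>\<phi>. \<integral>z. \<psi> z * sfun \<phi> (w z) \<partial>M)"
    (is "has_hs_integral p M ?f ?I")
proof -
  have [measurable]: "\<psi> \<in> borel_measurable M" using \<psi> by auto
  obtain K where K: "0 < K" "\<And>z :: real^'d. dual_norm p (dirac z) \<le> K"
    using dirac_dual_norm_bounded[OF p] by blast
  note dirac = dirac_in_hs_dual[OF p]
  have f_dual: "?f z \<in> hs_dual p" for z by (intro hs_dual_cmult dirac)
  have int: "integrable M (\<lambda>z. \<psi> z * sfun \<phi> (w z))" for \<phi>
  proof -
    have \<phi>: "schwartz_fun (sfun \<phi>)" using sfun[of \<phi>] by simp
    obtain A where A: "\<And>x. \<bar>sfun \<phi> x\<bar> \<le> A" using schwartz_bounded[OF \<phi>] by blast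
    have [measurable]: "sfun \<phi> \<in> borel_measurable borel" using \<phi> by (simp add: smooth_measurable)
    show ?thesis by (rule integrable_mult_bounded[OF \<psi> _ A]) measurable
  qed
  obtain c where c: "\<And>i::nat. Bochner_Integration.simple_bochner_integrable M (c i)"
    and c_lim: "(\<lambda>i. \<integral>\<^sup>+z. norm (\<psi> z - c i z) \<partial>M) \<longlonglongrightarrow> 0"
    using \<psi> unfolding integrable.simps has_bochner_integral.simps by blast
  obtain v where v: "\<And>i::nat. simple_function M (v i)" "\<And>z. z \<in> space M \<Longrightarrow> (\<lambda>i. v i z) \<longlonglongrightarrow> w z"
    using borel_measurable_implies_sequence_metric[OF w] by metis
  have c_simple: "simple_function M (c i)" "emeasure M {z \<in> space M. c i z \<noteq> 0} \<noteq> \<infinity>" for i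
    using c[of i] by (auto simp: Bochner_Integration.simple_bochner_integrable.simps)
  have [measurable]: "c i \<in> borel_measurable M" "v i \<in> borel_measurable M" for i
    using c_simple(1) v(1) by (auto intro: borel_measurable_simple_function)
  define s where "s i z = (\<lambda>\<phi>. c i z * dirac (v i z) \<phi>)" for i z
  define E where "E i z = dual_norm p (\<lambda>\<phi>. dirac (w z) \<phi> - dirac (v i z) \<phi>)" for i z
  have s_dual: "s i z \<in> hs_dual p" for i z unfolding s_def by (intro hs_dual_cmult dirac)
  have s_simple: "hs_simple p M (s i)" for i
    unfolding hs_simple_def
  proof (intro conjI ballI s_dual)
    show "simple_function M (s i)"
      unfolding s_def using simple_function_compose2[OF c_simple(1) v(1), where h = "\<lambda>a b \<phi>. a * dirac b \<phi>"] .
    have "emeasure M {z \<in> space M. s i z \<noteq> (\<lambda>_. 0)} \<le> emeasure M {z \<in> space M. c i z \<noteq> 0}"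
      by (intro emeasure_mono) (auto simp: s_def)
    then show "emeasure M {z \<in> space M. s i z \<noteq> (\<lambda>_. 0)} \<noteq> \<infinity>"
      using c_simple(2)[of i] by (auto simp: top_unique)
  qed
  let ?N = "\<lambda>i z. dual_norm p (\<lambda>\<phi>. ?f z \<phi> - s i z \<phi>)"
  have N_meas [measurable]: "?N i \<in> borel_measurable M" for i
    using s_simple[of i] by (intro measurable_dual_norm_dirac_diff p) (auto simp: hs_simple_def)
  have E_meas [measurable]: "E i \<in> borel_measurable M" for i
  proof -
    have "(\<lambda>z. dual_norm p (\<lambda>\<phi>. 1 * dirac (w z) \<phi> - dirac (v i z) \<phi>)) \<in> borel_measurable M"
      by (intro measurable_dual_norm_dirac_diff p simple_function_compose1[OF v(1)] dirac) measurable
    then show ?thesis by (simp add: E_def[abs_def])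
  qed
  have E_nonneg: "0 \<le> E i z" for i z
    unfolding E_def by (intro dual_norm_nonneg hs_dual_diff dirac)
  have E_le: "E i z \<le> 2 * K" for i z
  proof -
    have "E i z \<le> \<bar>1\<bar> * dual_norm p (dirac (w z)) + \<bar>- 1\<bar> * dual_norm p (dirac (v i z))"
      unfolding E_def by (rule dual_norm_triangle) (auto intro: dirac)
    with K(2)[of "w z"] K(2)[of "v i z"] show ?thesis by simp
  qed
  have N_le: "?N i z \<le> \<bar>\<psi> z - c i z\<bar> * K + \<bar>\<psi> z\<bar> * E i z" for i z
  proof -
    have "?N i z \<le> \<bar>\<psi> z - c i z\<bar> * dual_norm p (dirac (v i z)) + \<bar>\<psi> z\<bar> * E i z"
      unfolding E_def by (rule dual_norm_triangle) (auto intro!: hs_dual_diff dirac simp: s_def algebra_simps)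
    also have "\<dots> \<le> \<bar>\<psi> z - c i z\<bar> * K + \<bar>\<psi> z\<bar> * E i z"
      by (intro add_mono mult_left_mono K) auto
    finally show ?thesis .
  qed
  have lim2: "(\<lambda>i. \<integral>\<^sup>+z. ennreal (\<bar>\<psi> z\<bar> * E i z) \<partial>M) \<longlonglongrightarrow> (\<integral>\<^sup>+z. 0 \<partial>M)"
  proof (rule nn_integral_dominated_convergence[where w = "\<lambda>z. ennreal (\<bar>\<psi> z\<bar> * (2 * K))"])
    show "AE z in M. ennreal (\<bar>\<psi> z\<bar> * E i z) \<le> ennreal (\<bar>\<psi> z\<bar> * (2 * K))" for i
      by (intro AE_I2 ennreal_leI mult_left_mono E_le) simp
    have "integrable M (\<lambda>z. \<bar>\<psi> z\<bar> * (2 * K))" using \<psi> by simp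
    then show "(\<integral>\<^sup>+z. ennreal (\<bar>\<psi> z\<bar> * (2 * K)) \<partial>M) < \<infinity>"
      using K(1) by (subst nn_integral_eq_integral) auto
    show "AE z in M. (\<lambda>i. ennreal (\<bar>\<psi> z\<bar> * E i z)) \<longlonglongrightarrow> 0"
    proof (rule AE_I2)
      fix z assume z: "z \<in> space M"
      have "(\<lambda>i. \<bar>\<psi> z\<bar> * E i z) \<longlonglongrightarrow> \<bar>\<psi> z\<bar> * 0"
        unfolding E_def by (intro tendsto_intros dirac_tendsto[OF p] v z)
      then show "(\<lambda>i. ennreal (\<bar>\<psi> z\<bar> * E i z)) \<longlonglongrightarrow> 0"
        using tendsto_ennrealI by fastforce
    qed
  qed measurable
  have lim: "(\<lambda>i. \<integral>\<^sup>+z. ennreal (?N i z) \<partial>M) \<longlonglongrightarrow> 0"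
  proof (rule tendsto_sandwich[OF _ _ tendsto_const])
    show "\<forall>\<^sub>F i in sequentially. (\<integral>\<^sup>+z. ennreal (?N i z) \<partial>M)
        \<le> (\<integral>\<^sup>+z. norm (\<psi> z - c i z) \<partial>M) * ennreal K + (\<integral>\<^sup>+z. ennreal (\<bar>\<psi> z\<bar> * E i z) \<partial>M)"
    proof (intro always_eventually allI)
      fix i
      have "(\<integral>\<^sup>+z. ennreal (?N i z) \<partial>M)
          \<le> (\<integral>\<^sup>+z. ennreal (norm (\<psi> z - c i z)) * ennreal K + ennreal (\<bar>\<psi> z\<bar> * E i z) \<partial>M)"
      proof (rule nn_integral_mono)
        fix z :: 'a
        have "ennreal (?N i z) \<le> ennreal (\<bar>\<psi> z - c i z\<bar> * K + \<bar>\<psi> z\<bar> * E i z)"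
          by (intro ennreal_leI N_le)
        also have "\<dots> = ennreal (norm (\<psi> z - c i z)) * ennreal K + ennreal (\<bar>\<psi> z\<bar> * E i z)"
          using E_nonneg[of i z] K(1) by (simp add: ennreal_plus ennreal_mult)
        finally show "ennreal (?N i z) \<le> ennreal (norm (\<psi> z - c i z)) * ennreal K + ennreal (\<bar>\<psi> z\<bar> * E i z)" .
      qed
      also have "\<dots> = (\<integral>\<^sup>+z. norm (\<psi> z - c i z) \<partial>M) * ennreal K + (\<integral>\<^sup>+z. ennreal (\<bar>\<psi> z\<bar> * E i z) \<partial>M)"
        by (subst nn_integral_add) (auto simp: nn_integral_multc)
      finally show "(\<integral>\<^sup>+z. ennreal (?N i z) \<partial>M)
        \<le> (\<integral>\<^sup>+z. norm (\<psi> z - c i z) \<partial>M) * ennreal K + (\<integral>\<^sup>+z. ennreal (\<bar>\<psi> z\<bar> * E i z) \<partial>M)" .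
    qed
    have "(\<lambda>i. ennreal K * (\<integral>\<^sup>+z. norm (\<psi> z - c i z) \<partial>M) + (\<integral>\<^sup>+z. ennreal (\<bar>\<psi> z\<bar> * E i z) \<partial>M))
        \<longlonglongrightarrow> ennreal K * 0 + (\<integral>\<^sup>+z. 0 \<partial>M)"
      by (intro tendsto_add ennreal_tendsto_cmult c_lim lim2) simp
    then show "(\<lambda>i. (\<integral>\<^sup>+z. norm (\<psi> z - c i z) \<partial>M) * ennreal K + (\<integral>\<^sup>+z. ennreal (\<bar>\<psi> z\<bar> * E i z) \<partial>M)) \<longlonglongrightarrow> 0"
      by (simp add: mult.commute)
  qed simp
  have int_f: "integrable M (\<lambda>z. ?f z \<phi>)" for \<phi> using int[of \<phi>] by (simp add: dirac_def)
  have I_eq: "?I \<phi> = (\<integral>z. ?f z \<phi> \<partial>M)" for \<phi> by (simp add: dirac_def)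
  have I_dual: "?I \<in> hs_dual p"
    unfolding hs_dual_def
  proof (intro CollectI conjI exI allI)
    show "linear ?I"
      by (intro linearI) (auto simp: sfun_add sfun_scaleR distrib_left int mult.left_commute)
    fix \<phi>
    have "\<bar>?I \<phi>\<bar> \<le> (\<integral>z. \<bar>\<psi> z * sfun \<phi> (w z)\<bar> \<partial>M)" by (rule integral_abs_bound)
    also have "\<dots> \<le> (\<integral>z. \<bar>\<psi> z\<bar> * (K * hs_norm p \<phi>) \<partial>M)"
    proof (rule integral_mono)
      fix z
      have "\<bar>sfun \<phi> (w z)\<bar> \<le> dual_norm p (dirac (w z)) * hs_norm p \<phi>"
        using hs_dual_bound[OF dirac, of "w z" \<phi>] by (simp add: dirac_def)
      also have "\<dots> \<le> K * hs_norm p \<phi>" by (intro mult_right_mono K hs_norm_nonneg)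
      finally show "\<bar>\<psi> z * sfun \<phi> (w z)\<bar> \<le> \<bar>\<psi> z\<bar> * (K * hs_norm p \<phi>)"
        unfolding abs_mult by (intro mult_left_mono) auto
    qed (use int \<psi> in auto)
    finally show "\<bar>?I \<phi>\<bar> \<le> ((\<integral>z. \<bar>\<psi> z\<bar> \<partial>M) * K) * hs_norm p \<phi>" by (simp add: mult.assoc)
  qed
  let ?r = "\<lambda>i. \<integral>\<^sup>+z. ennreal (?N i z) \<partial>M"
  \<comment> \<open>Eventually the error integral is finite, so it may be read as a real number.\<close>
  have fin: "\<forall>\<^sub>F i in sequentially. ?r i < 1"
    using order_tendstoD(2)[OF lim, of 1] by simp
  have limI: "(\<lambda>i. dual_norm p (\<lambda>\<phi>. ?I \<phi> - hs_simple_integral M (s i) \<phi>)) \<longlonglongrightarrow> 0"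
  proof (rule Lim_null_comparison)
    show "(\<lambda>i. enn2real (?r i)) \<longlonglongrightarrow> 0" using tendsto_enn2real[of _ 0] lim by simp
    show "\<forall>\<^sub>F i in sequentially. norm (dual_norm p (\<lambda>\<phi>. ?I \<phi> - hs_simple_integral M (s i) \<phi>)) \<le> enn2real (?r i)"
      using fin
    proof eventually_elim
      case (elim i)
      then have r: "ennreal (enn2real (?r i)) = ?r i" by (intro ennreal_enn2real) (rule order.strict_trans[OF _ ennreal_one_less_top])
      have "dual_norm p (\<lambda>\<phi>. ?I \<phi> - hs_simple_integral M (s i) \<phi>) \<le> enn2real (?r i)"
      proof (rule dual_norm_le)
        fix \<phi>
        have "ennreal \<bar>?I \<phi> - hs_simple_integral M (s i) \<phi>\<bar> \<le> ?r i * ennreal (hs_norm p \<phi>)"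
          unfolding I_eq by (rule hs_simple_integral_approx[OF s_simple f_dual N_meas int_f])
        also have "\<dots> = ennreal (enn2real (?r i) * hs_norm p \<phi>)"
          by (subst r[symmetric]) (simp add: ennreal_mult hs_norm_nonneg)
        finally show "\<bar>?I \<phi> - hs_simple_integral M (s i) \<phi>\<bar> \<le> enn2real (?r i) * hs_norm p \<phi>"
          by (subst (asm) ennreal_le_iff) (auto intro!: mult_nonneg_nonneg hs_norm_nonneg)
      qed simp
      moreover have "hs_simple_integral M (s i) \<in> hs_dual p"
        unfolding hs_simple_integral_def using s_simple[of i]
        by (intro hs_dual_sum) (auto simp: hs_simple_def simple_function_def)
      then have "0 \<le> dual_norm p (\<lambda>\<phi>. ?I \<phi> - hs_simple_integral M (s i) \<phi>)"
        by (intro dual_norm_nonneg hs_dual_diff I_dual)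
      ultimately show ?case by simp
    qed
  qed
  show ?thesis
    unfolding has_hs_integral_def
    by (intro conjI ballI exI[of _ s] allI I_dual f_dual s_simple N_meas lim limI)
qed

lemma hs_integral_dirac_eq:
  fixes w :: "'a \<Rightarrow> real^'d::finite"
  assumes p: "real CARD('d) / 4 < p"
    and \<psi>: "integrable M \<psi>" and w: "w \<in> borel_measurable M"
  shows "hs_integral p M (\<lambda>z \<phi>. \<psi> z * dirac (w z) \<phi>) = (\<lambda>\<phi>. \<integral>z. \<psi> z * sfun \<phi> (w z) \<partial>M)"
  unfolding hs_integral_def
proof (rule the_equality)
  show "has_hs_integral p M (\<lambda>z \<phi>. \<psi> z * dirac (w z) \<phi>) (\<lambda>\<phi>. \<integral>z. \<psi> z * sfun \<phi> (w z) \<partial>M)"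
    by (rule has_hs_integral_dirac[OF assms])
  fix I assume I: "has_hs_integral p M (\<lambda>z \<phi>. \<psi> z * dirac (w z) \<phi>) I"
  have "integrable M (\<lambda>z. \<psi> z * dirac (w z) \<phi>)" for \<phi>
  proof -
    have \<phi>: "schwartz_fun (sfun \<phi>)" using sfun[of \<phi>] by simp
    obtain A where A: "\<And>x. \<bar>sfun \<phi> x\<bar> \<le> A" using schwartz_bounded[OF \<phi>] by blast
    have "sfun \<phi> \<in> borel_measurable borel" using \<phi> by (simp add: smooth_measurable)
    then show ?thesis unfolding dirac_def
      by (intro integrable_mult_bounded[OF \<psi> _ A] measurable_compose[OF w])
  qed
  from has_hs_integral_eval[OF I this] show "I = (\<lambda>\<phi>. \<integral>z. \<psi> z * sfun \<phi> (w z) \<partial>M)"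
    by (simp add: fun_eq_iff dirac_def)
qed

section \<open>The matrix exponential and linear substitutions\<close>

definition matrix_pow :: "real^'d::finite^'d \<Rightarrow> nat \<Rightarrow> real^'d^'d" where
  "matrix_pow C n = (((**) C) ^^ n) (mat 1)"

lemma matrix_pow_simps: "matrix_pow C 0 = mat 1" "matrix_pow C (Suc n) = C ** matrix_pow C n"
  by (simp_all add: matrix_pow_def)

lemma matrix_pow_Suc_right: "matrix_pow C (Suc n) = matrix_pow C n ** C"
proof (induction n)
  case (Suc n)
  have "matrix_pow C (Suc (Suc n)) = C ** (matrix_pow C n ** C)"
    using Suc matrix_pow_simps(2) by metis
  also have "\<dots> = matrix_pow C (Suc n) ** C" by (simp only: matrix_mul_assoc matrix_pow_simps(2))
  finally show ?case .
qed (simp add: matrix_pow_simps)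

lemma matrix_mul_scaleR: "(t *\<^sub>R A) ** (s *\<^sub>R B) = (t * s) *\<^sub>R (A ** (B :: real^'d::finite^'d))"
  by (simp add: matrix_matrix_mult_def vec_eq_iff sum_distrib_left mult_ac)

lemma matrix_pow_scaleR: "matrix_pow (t *\<^sub>R C) n = t ^ n *\<^sub>R matrix_pow C n"
  by (induction n) (simp_all add: matrix_pow_simps matrix_mul_scaleR)

lemma matrix_pow_entry_bound:
  fixes C :: "real^'d::finite^'d"
  shows "\<exists>K>0. \<forall>n i j. \<bar>matrix_pow C n $ i $ j\<bar> \<le> K ^ n"
proof -
  define K where "K = 1 + (\<Sum>i\<in>UNIV. \<Sum>k\<in>UNIV. \<bar>C $ i $ k\<bar>)"
  have row: "(\<Sum>k\<in>UNIV. \<bar>C $ i $ k\<bar>) \<le> K" for i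
    unfolding K_def by (rule order_trans[OF member_le_sum[of i UNIV "\<lambda>i. \<Sum>k\<in>UNIV. \<bar>C $ i $ k\<bar>"]]) (auto intro: sum_nonneg)
  have K: "0 < K" unfolding K_def by (intro add_pos_nonneg sum_nonneg) auto
  have "\<forall>i j. \<bar>matrix_pow C n $ i $ j\<bar> \<le> K ^ n" for n
  proof (induction n)
    case 0
    show ?case by (auto simp: matrix_pow_simps mat_def)
  next
    case (Suc n)
    show ?case
    proof (intro allI)
      fix i j
      have "\<bar>matrix_pow C (Suc n) $ i $ j\<bar> \<le> (\<Sum>k\<in>UNIV. \<bar>C $ i $ k\<bar> * \<bar>matrix_pow C n $ k $ j\<bar>)"
        unfolding matrix_pow_simps matrix_matrix_mult_def by (simp add: sum_abs flip: abs_mult)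
      also have "\<dots> \<le> (\<Sum>k\<in>UNIV. \<bar>C $ i $ k\<bar> * K ^ n)"
        by (intro sum_mono mult_left_mono) (use Suc in auto)
      also have "\<dots> \<le> K * K ^ n"
        unfolding sum_distrib_right[symmetric] using K by (intro mult_right_mono row) simp
      finally show "\<bar>matrix_pow C (Suc n) $ i $ j\<bar> \<le> K ^ Suc n" by simp
    qed
  qed
  then show ?thesis using K by blast
qed

lemma summable_matrix_pow_entry:
  fixes C :: "real^'d::finite^'d"
  shows "summable (\<lambda>n. matrix_pow C n $ i $ j / fact n * t ^ n)"
proof -
  obtain K where K: "0 < K" "\<And>n i j. \<bar>matrix_pow C n $ i $ j\<bar> \<le> K ^ n"
    using matrix_pow_entry_bound by blast
  show ?thesis
  proof (rule summable_comparison_test[OF _ summable_exp[of "K * \<bar>t\<bar>"]], intro exI allI impI)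
    fix n :: nat
    have "norm (matrix_pow C n $ i $ j / fact n * t ^ n) = inverse (fact n) * (\<bar>matrix_pow C n $ i $ j\<bar> * \<bar>t\<bar> ^ n)"
      by (simp add: abs_mult power_abs divide_inverse mult_ac)
    also have "\<dots> \<le> inverse (fact n) * (K ^ n * \<bar>t\<bar> ^ n)"
      by (intro mult_left_mono mult_right_mono K) auto
    finally show "norm (matrix_pow C n $ i $ j / fact n * t ^ n) \<le> inverse (fact n) * (K * \<bar>t\<bar>) ^ n"
      by (simp add: power_mult_distrib)
  qed
qed

text \<open>
  Entries are scalar power series in \<open>t\<close>, which can be differentiated term by term.
\<close>

lemma mat_exp_entry:
  fixes C :: "real^'d::finite^'d"
  shows "mat_exp (t *\<^sub>R C) $ i $ j = (\<Sum>n. matrix_pow C n $ i $ j / fact n * t ^ n)"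
proof -
  have "(\<lambda>n. (1 / fact n) *\<^sub>R matrix_pow (t *\<^sub>R C) n) sums (\<chi> i j. \<Sum>n. matrix_pow C n $ i $ j / fact n * t ^ n)"
    unfolding sums_def
  proof (intro vec_tendstoI)
    fix i j
    have "(\<lambda>n. matrix_pow C n $ i $ j / fact n * t ^ n) sums (\<Sum>n. matrix_pow C n $ i $ j / fact n * t ^ n)"
      by (rule summable_sums[OF summable_matrix_pow_entry])
    then show "(\<lambda>n. (\<Sum>k<n. (1 / fact k) *\<^sub>R matrix_pow (t *\<^sub>R C) k) $ i $ j)
      \<longlonglongrightarrow> (\<chi> i j. \<Sum>n. matrix_pow C n $ i $ j / fact n * t ^ n) $ i $ j"
      by (simp add: sums_def matrix_pow_scaleR mult.commute)
  qed
  then have "mat_exp (t *\<^sub>R C) = (\<chi> i j. \<Sum>n. matrix_pow C n $ i $ j / fact n * t ^ n)"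
    unfolding mat_exp_def matrix_pow_def[symmetric] by (rule sums_unique[symmetric])
  then show ?thesis by simp
qed

lemma mat_exp_0: "mat_exp (0 *\<^sub>R C) = (mat 1 :: real^'d::finite^'d)"
  unfolding vec_eq_iff mat_exp_entry
  by (simp add: matrix_pow_simps powser_zero[where f = "\<lambda>n. matrix_pow C n $ _ $ _ / fact n", simplified])

lemma
  fixes C :: "real^'d::finite^'d"
  shows mat_exp_deriv: "((\<lambda>t. mat_exp (t *\<^sub>R C) $ i $ j) has_real_derivative (C ** mat_exp (t *\<^sub>R C)) $ i $ j) (at t)"
    and mat_exp_commute: "C ** mat_exp (t *\<^sub>R C) = mat_exp (t *\<^sub>R C) ** C"
proof -
  note sm = summable_matrix_pow_entry[of C]
  have left: "(C ** mat_exp (t *\<^sub>R C)) $ i $ j = (\<Sum>n. matrix_pow C (Suc n) $ i $ j / fact n * t ^ n)" for i j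
  proof -
    have "(C ** mat_exp (t *\<^sub>R C)) $ i $ j = (\<Sum>k\<in>UNIV. \<Sum>n. C $ i $ k * (matrix_pow C n $ k $ j / fact n * t ^ n))"
      by (simp only: matrix_matrix_mult_def vec_lambda_beta mat_exp_entry suminf_mult[OF sm])
    also have "\<dots> = (\<Sum>n. \<Sum>k\<in>UNIV. C $ i $ k * (matrix_pow C n $ k $ j / fact n * t ^ n))"
      by (rule suminf_sum[symmetric]) (intro summable_mult sm)
    finally show ?thesis
      by (simp only: matrix_pow_simps matrix_matrix_mult_def vec_lambda_beta sum_divide_distrib sum_distrib_right
        times_divide_eq_right mult.assoc times_divide_eq_left)
  qed
  have right: "(mat_exp (t *\<^sub>R C) ** C) $ i $ j = (\<Sum>n. matrix_pow C (Suc n) $ i $ j / fact n * t ^ n)" for i j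
  proof -
    have "(mat_exp (t *\<^sub>R C) ** C) $ i $ j = (\<Sum>k\<in>UNIV. \<Sum>n. (matrix_pow C n $ i $ k / fact n * t ^ n) * C $ k $ j)"
      by (simp only: matrix_matrix_mult_def vec_lambda_beta mat_exp_entry suminf_mult2[OF sm])
    also have "\<dots> = (\<Sum>n. \<Sum>k\<in>UNIV. (matrix_pow C n $ i $ k / fact n * t ^ n) * C $ k $ j)"
      by (rule suminf_sum[symmetric]) (intro summable_mult2 sm)
    finally show ?thesis
      by (simp only: matrix_pow_Suc_right matrix_matrix_mult_def vec_lambda_beta sum_divide_distrib sum_distrib_left
        times_divide_eq_right mult_ac times_divide_eq_left)
  qed
  show "C ** mat_exp (t *\<^sub>R C) = mat_exp (t *\<^sub>R C) ** C"
    by (simp add: vec_eq_iff left right)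
  have "diffs (\<lambda>n. matrix_pow C n $ i $ j / fact n) n = matrix_pow C (Suc n) $ i $ j / fact n" for n
    by (simp add: diffs_def field_simps del: of_nat_Suc)
  then show "((\<lambda>t. mat_exp (t *\<^sub>R C) $ i $ j) has_real_derivative (C ** mat_exp (t *\<^sub>R C)) $ i $ j) (at t)"
    unfolding left mat_exp_entry using termdiffs_strong_converges_everywhere[OF sm, of i j t] by simp
qed

text \<open>
  The product of \<open>exp ((s + t - u) C)\<close> and \<open>exp (u C)\<close> does not depend on \<open>u\<close>, because its derivative
  vanishes.
\<close>

lemma mat_exp_add:
  fixes C :: "real^'d::finite^'d"
  shows "mat_exp (s *\<^sub>R C) ** mat_exp (t *\<^sub>R C) = mat_exp ((s + t) *\<^sub>R C)"
proof -
  define e where "e u = mat_exp (u *\<^sub>R C)" for u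
  have "(e (s + t - t) ** e t) $ i $ j = (e (s + t - 0) ** e 0) $ i $ j" for i j
  proof -
    have ed: "((\<lambda>u. e u $ k $ j) has_real_derivative (C ** e u) $ k $ j) (at u)" for k j u
      unfolding e_def by (rule mat_exp_deriv)
    have "((\<lambda>u. (e (s + t - u) ** e u) $ i $ j) has_real_derivative 0) (at u)" for u
    proof -
      have "((\<lambda>u. \<Sum>k\<in>UNIV. e (s + t - u) $ i $ k * e u $ k $ j) has_real_derivative
          (\<Sum>k\<in>UNIV. (C ** e (s + t - u)) $ i $ k * (0 - 1) * e u $ k $ j + (C ** e u) $ k $ j * e (s + t - u) $ i $ k)) (at u)"
        by (intro DERIV_sum DERIV_mult DERIV_chain2[OF ed] DERIV_diff DERIV_const DERIV_ident ed)
      also have "(\<Sum>k\<in>UNIV. (C ** e (s + t - u)) $ i $ k * (0 - 1) * e u $ k $ j + (C ** e u) $ k $ j * e (s + t - u) $ i $ k)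
          = (e (s + t - u) ** (C ** e u)) $ i $ j - ((C ** e (s + t - u)) ** e u) $ i $ j"
        unfolding matrix_matrix_mult_def[of _ "C ** e u"] matrix_matrix_mult_def[of "C ** _" "e u"]
        by (simp add: sum.distrib sum_subtractf mult.commute sum_negf)
      also have "\<dots> = 0"
        unfolding e_def mat_exp_commute[of C "s + t - u"] by (simp add: matrix_mul_assoc)
      finally show ?thesis unfolding matrix_matrix_mult_def by simp
    qed
    then show ?thesis by (intro DERIV_isconst_all[rule_format]) auto
  qed
  then have "e s ** e t = e (s + t) ** e 0" by (simp add: vec_eq_iff)
  then show ?thesis by (simp only: e_def mat_exp_0 matrix_mul_rid)
qed

lemma mat_exp_inverse:
  fixes C :: "real^'d::finite^'d"
  shows "mat_exp ((- t) *\<^sub>R C) ** mat_exp (t *\<^sub>R C) = mat 1" "mat_exp (t *\<^sub>R C) ** mat_exp ((- t) *\<^sub>R C) = mat 1"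
  using mat_exp_add[of "- t" C t] mat_exp_add[of t C "- t"] mat_exp_0[of C] by simp_all

lemma matrix_vector_mult_measurable [measurable]: "(\<lambda>z. A *v z) \<in> borel_measurable borel"
  for A :: "real^'d::finite^'d"
  by (intro borel_measurable_continuous_onI matrix_vector_mult_linear_continuous_on)

lemma matrix_vector_mult_bound:
  fixes A :: "real^'d::finite^'d"
  shows "\<exists>K>0. \<forall>x. norm (A *v x) \<le> K * norm x"
  using linear_bounded_pos[OF matrix_vector_mul_linear, of A] by blast

text \<open>
  The image of Lebesgue measure under \<open>A\<close> is translation invariant, hence proportional to Lebesgue
  measure. The classical argument integrates \<open>f (A x + y)\<close> against a Gaussian weight in \<open>y\<close> in both
  orders; the Gaussian also identifies the constant of proportionality.
\<close>

lemma nn_integral_linear_substitution: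
  fixes A A' :: "real^'d::finite^'d"
  assumes inv: "A ** A' = mat 1" "A' ** A = mat 1"
    and [measurable]: "f \<in> borel_measurable borel"
  shows "(\<integral>\<^sup>+x. f (A *v x) \<partial>lborel) * (\<integral>\<^sup>+y. ennreal (gaussian (y :: real^'d)) \<partial>lborel)
    = (\<integral>\<^sup>+x. f x \<partial>lborel) * (\<integral>\<^sup>+x. ennreal (gaussian (A *v x)) \<partial>lborel)"
proof -
  define \<gamma> where "\<gamma> y = ennreal (gaussian (y :: real^'d))" for y
  have [measurable]: "\<gamma> \<in> borel_measurable borel" unfolding \<gamma>_def by measurable
  have AA: "A *v (A' *v y) = y" for y by (simp add: matrix_vector_mul_assoc inv)
  have "(\<integral>\<^sup>+x. f (A *v x) \<partial>lborel) * (\<integral>\<^sup>+y. \<gamma> y \<partial>lborel) = (\<integral>\<^sup>+y. (\<integral>\<^sup>+x. f (A *v x) * \<gamma> y \<partial>lborel) \<partial>lborel)"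
    by (simp add: nn_integral_multc nn_integral_cmult)
  also have "\<dots> = (\<integral>\<^sup>+y. (\<integral>\<^sup>+x. f (A *v x + y) * \<gamma> y \<partial>lborel) \<partial>lborel)"
  proof (rule nn_integral_cong)
    fix y :: "real^'d"
    show "(\<integral>\<^sup>+x. f (A *v x) * \<gamma> y \<partial>lborel) = (\<integral>\<^sup>+x. f (A *v x + y) * \<gamma> y \<partial>lborel)"
      by (subst lborel_nn_integral_shift[of _ "A' *v y", symmetric])
         (simp_all add: matrix_vector_right_distrib AA)
  qed
  also have "\<dots> = (\<integral>\<^sup>+x. (\<integral>\<^sup>+y. f (A *v x + y) * \<gamma> y \<partial>lborel) \<partial>lborel)"
    by (rule lborel_pair.Fubini') measurable
  also have "\<dots> = (\<integral>\<^sup>+x. (\<integral>\<^sup>+y. f y * \<gamma> (y - A *v x) \<partial>lborel) \<partial>lborel)"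
  proof (rule nn_integral_cong)
    fix x :: "real^'d"
    show "(\<integral>\<^sup>+y. f (A *v x + y) * \<gamma> y \<partial>lborel) = (\<integral>\<^sup>+y. f y * \<gamma> (y - A *v x) \<partial>lborel)"
      using lborel_nn_integral_shift[of "\<lambda>y. f y * \<gamma> (y - A *v x)" "A *v x"] by (simp add: add.commute)
  qed
  also have "\<dots> = (\<integral>\<^sup>+y. (\<integral>\<^sup>+x. f y * \<gamma> (y - A *v x) \<partial>lborel) \<partial>lborel)"
    by (rule lborel_pair.Fubini'[symmetric]) measurable
  also have "\<dots> = (\<integral>\<^sup>+y. f y * (\<integral>\<^sup>+x. \<gamma> (A *v x) \<partial>lborel) \<partial>lborel)"
  proof (rule nn_integral_cong)
    fix y :: "real^'d"
    have "(\<integral>\<^sup>+x. \<gamma> (y - A *v x) \<partial>lborel) = (\<integral>\<^sup>+x. \<gamma> (y - A *v (x + A' *v y)) \<partial>lborel)"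
      by (rule lborel_nn_integral_shift[symmetric]) measurable
    also have "\<dots> = (\<integral>\<^sup>+x. \<gamma> (A *v x) \<partial>lborel)"
      by (simp add: matrix_vector_right_distrib AA \<gamma>_def)
    finally show "(\<integral>\<^sup>+x. f y * \<gamma> (y - A *v x) \<partial>lborel) = f y * (\<integral>\<^sup>+x. \<gamma> (A *v x) \<partial>lborel)"
      by (simp add: nn_integral_cmult)
  qed
  also have "\<dots> = (\<integral>\<^sup>+x. f x \<partial>lborel) * (\<integral>\<^sup>+x. \<gamma> (A *v x) \<partial>lborel)"
    by (simp add: nn_integral_multc)
  finally show ?thesis unfolding \<gamma>_def .
qed

section \<open>The Jacobian of the flow\<close>

lemma integrable_quadratic_gaussian:
  fixes q :: "real^'d::finite \<Rightarrow> real"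
  assumes [measurable]: "q \<in> borel_measurable borel" and q: "\<And>z. \<bar>q z\<bar> \<le> a + b * (norm z)\<^sup>2"
    and ab: "0 \<le> a" "0 \<le> b"
  shows "integrable lborel (\<lambda>z. q z * gaussian z)"
proof (rule Bochner_Integration.integrable_bound)
  show "integrable lborel (\<lambda>z::real^'d. (a + 2 * b) * exp (- (1/2) * (norm z)\<^sup>2))"
    by (intro integrable_mult_right integrable_gaussian_vec) simp
  show "AE z in lborel. norm (q z * gaussian z) \<le> norm ((a + 2 * b) * exp (- (1/2) * (norm z)\<^sup>2))"
  proof (rule AE_I2)
    fix z :: "real^'d"
    define y where "y = (norm z)\<^sup>2"
    have y: "0 \<le> y" by (simp add: y_def)
    have "1 \<le> exp (y / 2)" "y \<le> 2 * exp (y / 2)"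
      using exp_ge_add_one_self[of "y / 2"] y by (linarith, linarith)
    then have "a * 1 + b * y \<le> a * exp (y / 2) + b * (2 * exp (y / 2))"
      using ab by (intro add_mono mult_left_mono)
    then have "\<bar>q z\<bar> \<le> (a + 2 * b) * exp (y / 2)"
      using q[of z] unfolding y_def by (simp add: algebra_simps)
    then have "\<bar>q z\<bar> * exp (- 1 * y) \<le> ((a + 2 * b) * exp (y / 2)) * exp (- 1 * y)"
      by (intro mult_right_mono) auto
    also have "\<dots> = (a + 2 * b) * exp (- (1/2) * y)"
      unfolding mult.assoc exp_add[symmetric] by simp
    finally show "norm (q z * gaussian z) \<le> norm ((a + 2 * b) * exp (- (1/2) * (norm z)\<^sup>2))"
      using ab by (simp add: abs_mult y_def)
  qed
qed simp

lemma coord_mult_le: "\<bar>z $ i * z $ j\<bar> \<le> (norm (z :: real^'d::finite))\<^sup>2"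
  unfolding power2_eq_square abs_mult by (intro mult_mono component_le_norm_cart) auto

lemma integrable_coord_mult_gaussian:
  "integrable lborel (\<lambda>z. (z $ i * z $ j) * gaussian (z :: real^'d::finite))"
  by (rule integrable_quadratic_gaussian[where a = 0 and b = 1]) (auto simp: coord_mult_le)

text \<open>
  The second moments of a Gaussian, from integrating the \<open>i\<close>-th partial derivative of \<open>z\<^sub>j\<close> times the
  Gaussian.
\<close>

lemma integral_coord_mult_gaussian:
  "(\<integral>z. (z $ i * z $ j) * gaussian (z :: real^'d::finite) \<partial>lborel)
    = (if i = j then 1 else 0) / 2 * (\<integral>z. gaussian (z :: real^'d) \<partial>lborel)"
proof -
  define g where "g z = gaussian (z :: real^'d)" for z
  define \<delta> where "\<delta> = (if i = j then 1 else 0 :: real)"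
  define G where "G z = \<delta> * g z - 2 * (z $ i * z $ j * g z)" for z
  have g: "integrable lborel g" unfolding g_def by (rule integrable_gaussian_vec) simp
  have gij: "integrable lborel (\<lambda>z. z $ i * z $ j * g z)"
    unfolding g_def by (rule integrable_coord_mult_gaussian)
  have "(\<integral>z. G z \<partial>lborel) = 0"
  proof (rule integral_directional_derivative_eq_0[where v = "axis i 1"])
    show "integrable lborel (\<lambda>z. z $ j * g z)"
      unfolding g_def
    proof (rule integrable_quadratic_gaussian[where a = 1 and b = 1])
      fix z :: "real^'d"
      have "\<bar>z $ j\<bar> \<le> norm z" by (rule component_le_norm_cart)
      also have "\<dots> \<le> 1 + 1 * (norm z)\<^sup>2"
      proof -
        have "2 * norm z \<le> (norm z)\<^sup>2 + 1" using zero_le_power2[of "norm z - 1"] by (simp add: power2_diff)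
        then show ?thesis using norm_ge_zero[of z] by linarith
      qed
      finally show "\<bar>z $ j\<bar> \<le> 1 + 1 * (norm z)\<^sup>2" .
    qed auto
    show "integrable lborel G" unfolding G_def
      by (intro Bochner_Integration.integrable_diff integrable_mult_right g gij)
    show "continuous_on UNIV G" unfolding G_def g_def by (intro continuous_intros)
    fix x :: "real^'d" and s :: real
    let ?y = "\<lambda>s. x + s *\<^sub>R axis i 1"
    have n: "(norm (?y s))\<^sup>2 = (norm x)\<^sup>2 + 2 * s * x $ i + s\<^sup>2" for s
      unfolding power2_norm_eq_inner
      by (simp add: inner_add_left inner_add_right inner_axis inner_axis' power2_eq_square algebra_simps)
    have yj: "?y s $ j = x $ j + s * \<delta>" for s by (simp add: \<delta>_def axis_def)
    have yi: "?y s $ i = x $ i + s" for s by simp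
    have "((\<lambda>s. (x $ j + s * \<delta>) * exp (- 1 * ((norm x)\<^sup>2 + 2 * s * x $ i + s\<^sup>2))) has_real_derivative
      \<delta> * exp (- 1 * ((norm x)\<^sup>2 + 2 * s * x $ i + s\<^sup>2)) +
      (exp (- 1 * ((norm x)\<^sup>2 + 2 * s * x $ i + s\<^sup>2)) * (- 1 * (2 * x $ i + 2 * s))) * (x $ j + s * \<delta>)) (at s)"
      by (auto intro!: derivative_eq_intros)
    then show "((\<lambda>s. ?y s $ j * g (?y s)) has_real_derivative G (?y s)) (at s)"
      unfolding G_def g_def n yj yi by (simp add: algebra_simps)
  qed
  then show ?thesis
    unfolding G_def g_def[symmetric] \<delta>_def[symmetric] using g gij by simp
qed

lemma mat_exp_lower_bound:
  fixes C :: "real^'d::finite^'d"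
  shows "\<exists>m>0. \<forall>z. m * norm z \<le> norm (mat_exp (t *\<^sub>R C) *v z)"
proof -
  obtain K where K: "0 < K" "\<And>x. norm (mat_exp ((- t) *\<^sub>R C) *v x) \<le> K * norm x"
    using matrix_vector_mult_bound[of "mat_exp ((- t) *\<^sub>R C)"] by blast
  have "(1 / K) * norm z \<le> norm (mat_exp (t *\<^sub>R C) *v z)" for z
  proof -
    have "norm z = norm (mat_exp ((- t) *\<^sub>R C) *v (mat_exp (t *\<^sub>R C) *v z))"
      unfolding matrix_vector_mul_assoc mat_exp_inverse by simp
    also have "\<dots> \<le> K * norm (mat_exp (t *\<^sub>R C) *v z)" by (rule K)
    finally show ?thesis using K(1) by (simp add: field_simps)
  qed
  then show ?thesis using K(1) by (intro exI[of _ "1 / K"]) auto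
qed

lemma integrable_gaussian_mat_exp:
  fixes C :: "real^'d::finite^'d"
  shows "integrable lborel (\<lambda>z. gaussian (mat_exp (t *\<^sub>R C) *v z))"
proof -
  obtain m where m: "0 < m" "\<And>z. m * norm z \<le> norm (mat_exp (t *\<^sub>R C) *v z)"
    using mat_exp_lower_bound by blast
  show ?thesis
  proof (rule Bochner_Integration.integrable_bound)
    show "integrable lborel (\<lambda>z::real^'d. exp (- m\<^sup>2 * (norm z)\<^sup>2))"
      using m(1) by (intro integrable_gaussian_vec) simp
    have "(m * norm z)\<^sup>2 \<le> (norm (mat_exp (t *\<^sub>R C) *v z))\<^sup>2" for z
      using m by (intro power_mono) auto
    then show "AE z in lborel. norm (gaussian (mat_exp (t *\<^sub>R C) *v z)) \<le> norm (exp (- m\<^sup>2 * (norm z)\<^sup>2))"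
      by (simp add: power_mult_distrib)
  qed measurable
qed

lemma mat_exp_near_0:
  fixes C :: "real^'d::finite^'d"
  shows "\<exists>\<delta>>0. \<forall>t z. \<bar>t\<bar> < \<delta> \<longrightarrow> norm z / 2 \<le> norm (mat_exp (t *\<^sub>R C) *v z)"
proof -
  define e where "e t = mat_exp (t *\<^sub>R C)" for t
  define h where "h t = (\<Sum>i\<in>UNIV. \<Sum>j\<in>UNIV. \<bar>(e t - mat 1) $ i $ j\<bar>)" for t
  have "isCont (\<lambda>t. e t $ i $ j) 0" for i j
    unfolding e_def by (rule DERIV_isCont[OF mat_exp_deriv])
  then have "isCont h 0" unfolding h_def by (simp add: isCont_def tendsto_intros)
  moreover have "h 0 = 0" using mat_exp_0[of C] by (simp add: h_def e_def)
  ultimately have "(h \<longlongrightarrow> 0) (at 0)" by (simp add: isCont_def)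
  then obtain \<delta> where \<delta>: "0 < \<delta>" "\<And>t. t \<noteq> 0 \<Longrightarrow> \<bar>t\<bar> < \<delta> \<Longrightarrow> \<bar>h t\<bar> < 1 / 2"
    unfolding LIM_def by (metis diff_zero dist_real_def half_gt_zero_iff zero_less_one)
  have "norm z / 2 \<le> norm (e t *v z)" if t: "\<bar>t\<bar> < \<delta>" for t z
  proof -
    have h: "h t \<le> 1 / 2" using \<delta>(2)[of t] t \<open>h 0 = 0\<close> by (cases "t = 0") auto
    have "norm ((e t - mat 1) *v z) \<le> (\<Sum>i\<in>UNIV. \<bar>((e t - mat 1) *v z) $ i\<bar>)"
      by (rule norm_le_l1_cart)
    also have "\<dots> \<le> (\<Sum>i\<in>UNIV. \<Sum>j\<in>UNIV. \<bar>(e t - mat 1) $ i $ j\<bar> * norm z)"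
    proof (rule sum_mono)
      fix i
      have "\<bar>((e t - mat 1) *v z) $ i\<bar> \<le> (\<Sum>j\<in>UNIV. \<bar>(e t - mat 1) $ i $ j * z $ j\<bar>)"
        unfolding matrix_vector_mult_def vec_lambda_beta by (rule sum_abs)
      also have "\<dots> \<le> (\<Sum>j\<in>UNIV. \<bar>(e t - mat 1) $ i $ j\<bar> * norm z)"
        unfolding abs_mult by (intro sum_mono mult_left_mono component_le_norm_cart) simp
      finally show "\<bar>((e t - mat 1) *v z) $ i\<bar> \<le> (\<Sum>j\<in>UNIV. \<bar>(e t - mat 1) $ i $ j\<bar> * norm z)" .
    qed
    also have "\<dots> = h t * norm z" by (simp only: h_def sum_distrib_right)
    also have "\<dots> \<le> 1 / 2 * norm z" by (intro mult_right_mono h) simp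
    finally have "norm ((e t - mat 1) *v z) \<le> norm z / 2" by simp
    moreover have "z = e t *v z - (e t - mat 1) *v z"
      by (simp add: matrix_vector_mult_diff_rdistrib)
    then have "norm z \<le> norm (e t *v z) + norm ((e t - mat 1) *v z)"
      by (metis norm_triangle_ineq4)
    ultimately show ?thesis by linarith
  qed
  then show ?thesis using \<delta>(1) unfolding e_def by blast
qed

lemma gaussian_mat_exp_deriv:
  fixes C :: "real^'d::finite^'d"
  shows "((\<lambda>t. gaussian (mat_exp (t *\<^sub>R C) *v z)) has_real_derivative
    (let y = mat_exp (t *\<^sub>R C) *v z in gaussian y * (- 2 * (y \<bullet> (C *v y))))) (at t)"
proof -
  define y where "y t = mat_exp (t *\<^sub>R C) *v z" for t
  have y: "((\<lambda>t. y t $ i) has_real_derivative (C *v y t) $ i) (at t)" for i t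
  proof -
    have "((\<lambda>t. \<Sum>j\<in>UNIV. mat_exp (t *\<^sub>R C) $ i $ j * z $ j) has_real_derivative
       (\<Sum>j\<in>UNIV. (C ** mat_exp (t *\<^sub>R C)) $ i $ j * z $ j)) (at t)"
      by (intro DERIV_sum DERIV_cmult_right mat_exp_deriv)
    moreover have "(\<Sum>j\<in>UNIV. (C ** mat_exp (t *\<^sub>R C)) $ i $ j * z $ j) = (C *v y t) $ i"
      unfolding y_def matrix_vector_mul_assoc by (simp add: matrix_vector_mult_def)
    ultimately show ?thesis by (simp add: y_def matrix_vector_mult_def)
  qed
  have "((\<lambda>t. (\<Sum>i\<in>UNIV. y t $ i * y t $ i)) has_real_derivative
      (\<Sum>i\<in>UNIV. (C *v y t) $ i * y t $ i + (C *v y t) $ i * y t $ i)) (at t)"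
    by (intro DERIV_sum DERIV_mult y)
  then have "((\<lambda>t. (norm (y t))\<^sup>2) has_real_derivative 2 * (y t \<bullet> (C *v y t))) (at t)"
    unfolding power2_norm_eq_inner inner_vec_def by (simp add: sum_distrib_left sum.distrib mult.commute)
  from DERIV_fun_exp[OF DERIV_cmult[OF this, of "- 1"]] show ?thesis
    by (simp add: y_def Let_def)
qed

text \<open>
  Up to the value at zero, this is the factor by which \<open>exp (t C)\<close> scales integrals; see
  \<open>nn_integral_mat_exp_gaussian_mass\<close>.
\<close>

definition gaussian_mass :: "real^'d::finite^'d \<Rightarrow> real \<Rightarrow> real" where
  "gaussian_mass C t = (\<integral>z. gaussian (mat_exp (t *\<^sub>R C) *v z) \<partial>lborel)"

lemma gaussian_mass_0:
  fixes C :: "real^'d::finite^'d"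
  shows "gaussian_mass C 0 = (\<integral>z. gaussian (z :: real^'d) \<partial>lborel)" "0 < gaussian_mass C 0"
proof -
  show 1: "gaussian_mass C 0 = (\<integral>z. gaussian (z :: real^'d) \<partial>lborel)"
    unfolding gaussian_mass_def mat_exp_0 by simp
  show "0 < gaussian_mass C 0"
    unfolding 1 by (subst integral_gaussian_vec) auto
qed

text \<open>
  Differentiate under the integral sign. At \<open>t = 0\<close> the integrand has derivative \<open>- 2 (z \<bullet> C z)\<close> times
  the Gaussian, and the second moments \<open>integral_coord_mult_gaussian\<close> pick out the trace.
\<close>

lemma gaussian_mass_deriv_0:
  fixes C :: "real^'d::finite^'d"
  shows "(gaussian_mass C has_real_derivative - trace C * gaussian_mass C 0) (at 0)"
proof -
  define f where "f t z = gaussian (mat_exp (t *\<^sub>R C) *v z)" for t z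
  define f' where "f' t z = (let y = mat_exp (t *\<^sub>R C) *v z in gaussian y * (- 2 * (y \<bullet> (C *v y))))" for t z
  have deriv: "((\<lambda>t. f t z) has_real_derivative f' t z) (at t)" for t z
    unfolding f_def f'_def by (rule gaussian_mat_exp_deriv)
  have f_meas [measurable]: "f t \<in> borel_measurable borel" for t unfolding f_def by measurable
  have f_int: "integrable lborel (f t)" for t unfolding f_def by (rule integrable_gaussian_mat_exp)
  obtain \<delta> where \<delta>: "0 < \<delta>" "\<And>t z. \<bar>t\<bar> < \<delta> \<Longrightarrow> norm z / 2 \<le> norm (mat_exp (t *\<^sub>R C) *v z)"
    using mat_exp_near_0 by blast
  obtain K where K: "0 < K" "\<And>x. norm (C *v x) \<le> K * norm x" using matrix_vector_mult_bound by blast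
  \<comment> \<open>For small \<open>t\<close> the flow at most halves norms, and \<open>q e\<^sup>-\<^sup>q \<le> 2 e\<^sup>-\<^sup>q\<^sup>/\<^sup>2\<close>.\<close>
  define w where "w z = 4 * K * exp (- (1/8) * (norm (z :: real^'d))\<^sup>2)" for z
  have f'_le: "\<bar>f' t z\<bar> \<le> w z" if t: "\<bar>t\<bar> < \<delta>" for t z
  proof -
    define y where "y = mat_exp (t *\<^sub>R C) *v z"
    define q where "q = (norm y)\<^sup>2"
    have "(norm z / 2)\<^sup>2 \<le> q" unfolding q_def y_def using \<delta>(2)[OF t] by (intro power_mono) auto
    then have q: "(norm z)\<^sup>2 / 4 \<le> q" by (simp add: power_divide)
    have "\<bar>y \<bullet> (C *v y)\<bar> \<le> norm y * norm (C *v y)" by (rule Cauchy_Schwarz_ineq2)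
    also have "\<dots> \<le> norm y * (K * norm y)" by (intro mult_left_mono K) simp
    finally have ip: "\<bar>y \<bullet> (C *v y)\<bar> \<le> K * q" by (simp add: q_def power2_eq_square mult_ac)
    have "\<bar>f' t z\<bar> = exp (- 1 * q) * (2 * \<bar>y \<bullet> (C *v y)\<bar>)"
      by (simp add: f'_def Let_def y_def q_def abs_mult)
    also have "\<dots> \<le> exp (- 1 * q) * (2 * (K * (2 * exp (q / 2))))"
    proof (intro mult_left_mono)
      have "q \<le> 2 * exp (q / 2)" using exp_ge_add_one_self[of "q / 2"] by linarith
      then have "K * q \<le> K * (2 * exp (q / 2))" using K(1) by (intro mult_left_mono) auto
      with ip show "\<bar>y \<bullet> (C *v y)\<bar> \<le> K * (2 * exp (q / 2))" by linarith
    qed auto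
    also have "\<dots> = 4 * K * (exp (- 1 * q) * exp (q / 2))" by simp
    also have "exp (- 1 * q) * exp (q / 2) = exp (- (q / 2))" unfolding exp_add[symmetric] by simp
    also have "4 * K * exp (- (q / 2)) \<le> w z"
      unfolding w_def using K(1) q by (intro mult_left_mono) auto
    finally show ?thesis .
  qed
  have D0: "(\<integral>z. f' 0 z \<partial>lborel) = - trace C * gaussian_mass C 0"
  proof -
    have ip: "z \<bullet> (C *v z) = (\<Sum>i\<in>UNIV. \<Sum>j\<in>UNIV. C $ i $ j * (z $ i * z $ j))" for z
      by (simp add: inner_vec_def matrix_vector_mult_def sum_distrib_left mult_ac)
    define g where "g i j z = (z $ i * z $ j) * gaussian (z :: real^'d)" for i j z
    have g: "integrable lborel (g i j)" "(\<integral>z. g i j z \<partial>lborel) = (if i = j then 1 else 0) / 2 * gaussian_mass C 0" for i j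
      unfolding g_def gaussian_mass_0 by (rule integrable_coord_mult_gaussian integral_coord_mult_gaussian)+
    have "f' 0 z = - 2 * (\<Sum>i\<in>UNIV. \<Sum>j\<in>UNIV. C $ i $ j * g i j z)" for z
      unfolding f'_def mat_exp_0 Let_def ip matrix_vector_mul_lid g_def
      by (simp add: sum_distrib_left sum_distrib_right mult_ac)
    then have "(\<integral>z. f' 0 z \<partial>lborel) = - 2 * (\<Sum>i\<in>UNIV. \<Sum>j\<in>UNIV. C $ i $ j * (\<integral>z. g i j z \<partial>lborel))"
      by (simp add: g(1))
    also have "\<dots> = - 2 * (\<Sum>i\<in>UNIV. \<Sum>j\<in>UNIV. if i = j then C $ i $ j / 2 * gaussian_mass C 0 else 0)"
      unfolding g(2) by (intro arg_cong2[of _ _ _ _ times] refl sum.cong) auto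
    also have "\<dots> = - trace C * gaussian_mass C 0"
      by (simp add: trace_def sum_distrib_right sum_divide_distrib[symmetric])
    finally show ?thesis .
  qed
  have quot_le: "\<bar>(f h z - f 0 z) / h\<bar> \<le> w z" if h: "\<bar>h\<bar> < \<delta>" "h \<noteq> 0" for h z
  proof -
    have "norm (f h z - f 0 z) \<le> w z * norm (h - 0)"
    proof (rule field_differentiable_bound[where S = "{- \<delta> <..< \<delta>}"])
      show "((\<lambda>t. f t z) has_field_derivative f' t z) (at t within {- \<delta> <..< \<delta>})" for t
        by (rule DERIV_subset[OF deriv]) simp
      show "norm (f' t z) \<le> w z" if "t \<in> {- \<delta> <..< \<delta>}" for t
        using f'_le[of t z] that by (simp add: abs_less_iff)
    qed (use \<delta>(1) h in auto)
    then show ?thesis using h(2) by (simp add: abs_divide pos_divide_le_eq)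
  qed
  show ?thesis
    unfolding DERIV_def tendsto_at_iff_sequentially
  proof (intro allI impI)
    fix X :: "nat \<Rightarrow> real"
    assume X0: "\<forall>i. X i \<in> UNIV - {0}" and X: "X \<longlonglongrightarrow> 0"
    \<comment> \<open>The bound holds only for small arguments, so the first terms of the sequence are dropped.\<close>
    obtain N where N: "\<And>i. N \<le> i \<Longrightarrow> \<bar>X i\<bar> < \<delta>"
      using LIMSEQ_D[OF X \<delta>(1)] by auto
    have "(\<lambda>i. \<integral>z. (f (X (i + N)) z - f 0 z) / X (i + N) \<partial>lborel) \<longlonglongrightarrow> (\<integral>z. f' 0 z \<partial>lborel)"
    proof (rule integral_dominated_convergence[where w = w])
      have "f' 0 = (\<lambda>z. gaussian z * (- 2 * (z \<bullet> (C *v z))))"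
        unfolding f'_def mat_exp_0 Let_def by simp
      then show "f' 0 \<in> borel_measurable lborel" by simp
      show "integrable lborel w" unfolding w_def by (intro integrable_mult_right integrable_gaussian_vec) simp
      show "AE z in lborel. (\<lambda>i. (f (X (i + N)) z - f 0 z) / X (i + N)) \<longlonglongrightarrow> f' 0 z"
      proof (rule AE_I2)
        fix z
        have "(\<lambda>i. (f (0 + X i) z - f 0 z) / X i) \<longlonglongrightarrow> f' 0 z"
          using deriv[of z 0] X0 X unfolding DERIV_def tendsto_at_iff_sequentially by (auto simp: o_def)
        then show "(\<lambda>i. (f (X (i + N)) z - f 0 z) / X (i + N)) \<longlonglongrightarrow> f' 0 z"
          by (auto dest: LIMSEQ_ignore_initial_segment[where k = N])
      qed
      show "AE z in lborel. norm ((f (X (i + N)) z - f 0 z) / X (i + N)) \<le> w z" for i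
        using N[of "i + N"] X0 quot_le by auto
    qed measurable
    note lim = this
    have quot: "(\<integral>z. (f h z - f 0 z) / h \<partial>lborel) = (gaussian_mass C h - gaussian_mass C 0) / h" for h
    proof -
      have J: "gaussian_mass C t = (\<integral>z. f t z \<partial>lborel)" for t by (simp add: gaussian_mass_def f_def)
      show ?thesis unfolding J using f_int[of h] f_int[of 0] by simp
    qed
    from lim have "(\<lambda>i. (gaussian_mass C (X (i + N)) - gaussian_mass C 0) / X (i + N)) \<longlonglongrightarrow> - trace C * gaussian_mass C 0"
      unfolding quot D0 .
    then show "((\<lambda>h. (gaussian_mass C (0 + h) - gaussian_mass C 0) / h) \<circ> X) \<longlonglongrightarrow> - trace C * gaussian_mass C 0"
      unfolding o_def add_0 by (rule LIMSEQ_offset)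
  qed
qed

lemma gaussian_mass_nn_integral:
  "(\<integral>\<^sup>+z. ennreal (gaussian (mat_exp (t *\<^sub>R C) *v z)) \<partial>lborel) = ennreal (gaussian_mass C t)"
  for C :: "real^'d::finite^'d"
  unfolding gaussian_mass_def by (intro nn_integral_eq_integral integrable_gaussian_mat_exp) simp

lemma gaussian_mass_nonneg: "0 \<le> gaussian_mass C t"
  unfolding gaussian_mass_def by simp

lemma nn_integral_mat_exp_gaussian_mass:
  fixes C :: "real^'d::finite^'d"
  assumes "f \<in> borel_measurable borel"
  shows "(\<integral>\<^sup>+x. f (mat_exp (t *\<^sub>R C) *v x) \<partial>lborel) * ennreal (gaussian_mass C 0)
    = (\<integral>\<^sup>+x. f x \<partial>lborel) * ennreal (gaussian_mass C t)"
proof -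
  have "(\<integral>\<^sup>+y. ennreal (gaussian (y :: real^'d)) \<partial>lborel) = ennreal (gaussian_mass C 0)"
    using gaussian_mass_nn_integral[of 0 C] unfolding mat_exp_0 by simp
  with nn_integral_linear_substitution[OF mat_exp_inverse(2,1) assms, of t C] show ?thesis
    unfolding gaussian_mass_nn_integral by simp
qed

lemma gaussian_mass_add:
  fixes C :: "real^'d::finite^'d"
  shows "gaussian_mass C (s + t) * gaussian_mass C 0 = gaussian_mass C s * gaussian_mass C t"
proof -
  have "ennreal (gaussian_mass C (s + t)) * ennreal (gaussian_mass C 0)
      = ennreal (gaussian_mass C s) * ennreal (gaussian_mass C t)"
    using nn_integral_mat_exp_gaussian_mass[of "\<lambda>z. ennreal (gaussian (mat_exp (s *\<^sub>R C) *v z))" t C]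
    unfolding gaussian_mass_nn_integral matrix_vector_mul_assoc mat_exp_add
    by simp
  then show ?thesis
    by (simp add: gaussian_mass_nonneg flip: ennreal_mult)
qed

text \<open>
  By \<open>gaussian_mass_add\<close> the derivative at zero determines the derivative everywhere, and
  \<open>J' = - tr C J\<close> has only exponential solutions.
\<close>

lemma gaussian_mass_eq:
  fixes C :: "real^'d::finite^'d"
  shows "gaussian_mass C t = exp (- t * trace C) * gaussian_mass C 0"
proof -
  define J where "J = gaussian_mass C"
  have J0: "0 < J 0" unfolding J_def by (rule gaussian_mass_0)
  have J_add: "J (t + h) = J t / J 0 * J h" for t h
    using gaussian_mass_add[of C t h] J0 unfolding J_def by (simp add: field_simps)
  have J_deriv: "(J has_real_derivative - trace C * J t) (at t)" for t
  proof -
    have "((\<lambda>h. J t / J 0 * J h) has_real_derivative J t / J 0 * (- trace C * J 0)) (at 0)"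
      unfolding J_def by (intro DERIV_cmult gaussian_mass_deriv_0)
    then have "((\<lambda>h. J (t + h)) has_real_derivative - trace C * J t) (at 0)"
      using J0 by (simp add: J_add mult.commute)
    then show ?thesis using DERIV_shift[of J "- trace C * J t" 0 t] by (simp add: add.commute)
  qed
  have "((\<lambda>t. J t * exp (t * trace C)) has_real_derivative 0) (at t)" for t
  proof -
    have "((\<lambda>t. J t * exp (t * trace C)) has_real_derivative
        (- trace C * J t) * exp (t * trace C) + (exp (t * trace C) * (1 * trace C)) * J t) (at t)"
      by (intro DERIV_mult J_deriv DERIV_fun_exp DERIV_cmult_right DERIV_ident)
    then show ?thesis by (simp add: algebra_simps)
  qed
  then have "J t * exp (t * trace C) = J 0 * exp (0 * trace C)"
    by (intro DERIV_isconst_all[rule_format]) auto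
  then have "exp (- t * trace C) * J 0 = J t * (exp (t * trace C) * exp (- t * trace C))" by simp
  also have "\<dots> = J t" unfolding exp_add[symmetric] by simp
  finally show ?thesis unfolding J_def ..
qed

lemma nn_integral_affine_flow:
  fixes C :: "real^'d::finite^'d"
  assumes [measurable]: "f \<in> borel_measurable borel"
  shows "(\<integral>\<^sup>+x. f (v + mat_exp (t *\<^sub>R C) *v x) \<partial>lborel) = ennreal (exp (- t * trace C)) * (\<integral>\<^sup>+x. f x \<partial>lborel)"
proof -
  let ?L = "\<integral>\<^sup>+x. f (v + mat_exp (t *\<^sub>R C) *v x) \<partial>lborel"
  have "ennreal (gaussian_mass C 0) * ?L = ?L * ennreal (gaussian_mass C 0)" by (rule mult.commute)
  also have "\<dots> = (\<integral>\<^sup>+x. f (v + x) \<partial>lborel) * ennreal (gaussian_mass C t)"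
    using nn_integral_mat_exp_gaussian_mass[of "\<lambda>x. f (v + x)" t C] by simp
  also have "(\<integral>\<^sup>+x. f (v + x) \<partial>lborel) = (\<integral>\<^sup>+x. f x \<partial>lborel)"
    using lborel_nn_integral_shift[of f v] by (simp add: add.commute)
  also have "(\<integral>\<^sup>+x. f x \<partial>lborel) * ennreal (gaussian_mass C t)
      = ennreal (gaussian_mass C 0) * (ennreal (exp (- t * trace C)) * (\<integral>\<^sup>+x. f x \<partial>lborel))"
    unfolding gaussian_mass_eq[of C t] by (simp add: ennreal_mult gaussian_mass_nonneg mult_ac)
  finally show ?thesis
    using gaussian_mass_0(2)[of C] by (simp add: ennreal_mult_cancel_left)
qed

section \<open>Change of variables for integrable functions\<close>

lemma
  fixes C :: "real^'d::finite^'d" and f :: "real^'d \<Rightarrow> real"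
  assumes [measurable]: "f \<in> borel_measurable borel"
  shows integral_affine_flow:
      "(\<integral>x. f (v + mat_exp (t *\<^sub>R C) *v x) \<partial>lborel) = exp (- t * trace C) * (\<integral>x. f x \<partial>lborel)"
    and integrable_affine_flow:
      "integrable lborel (\<lambda>x. f (v + mat_exp (t *\<^sub>R C) *v x)) \<longleftrightarrow> integrable lborel f"
proof -
  define a where "a = exp (- t * trace C)"
  have distr: "distr lborel borel (\<lambda>x. v + mat_exp (t *\<^sub>R C) *v x) = density lborel (\<lambda>_. ennreal a)"
  proof (rule measure_eqI)
    fix X assume "X \<in> sets (distr lborel borel (\<lambda>x. v + mat_exp (t *\<^sub>R C) *v x))"
    then have X [measurable]: "X \<in> sets borel" by simp
    have "emeasure (distr lborel borel (\<lambda>x. v + mat_exp (t *\<^sub>R C) *v x)) X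
        = (\<integral>\<^sup>+x. indicator X (v + mat_exp (t *\<^sub>R C) *v x) \<partial>lborel)"
      by (subst nn_integral_indicator[symmetric], simp, subst nn_integral_distr) simp_all
    also have "\<dots> = ennreal a * (\<integral>\<^sup>+x. indicator X x \<partial>lborel)"
      unfolding a_def by (rule nn_integral_affine_flow) measurable
    also have "\<dots> = emeasure (density lborel (\<lambda>_. ennreal a)) X"
      by (simp add: emeasure_density nn_integral_cmult)
    finally show "emeasure (distr lborel borel (\<lambda>x. v + mat_exp (t *\<^sub>R C) *v x)) X
        = emeasure (density lborel (\<lambda>_. ennreal a)) X" .
  qed simp
  have a: "0 < a" by (simp add: a_def)
  have "(\<integral>x. f (v + mat_exp (t *\<^sub>R C) *v x) \<partial>lborel) = (\<integral>x. f x \<partial>distr lborel borel (\<lambda>x. v + mat_exp (t *\<^sub>R C) *v x))"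
    by (subst integral_distr) simp_all
  also have "\<dots> = a * (\<integral>x. f x \<partial>lborel)"
    unfolding distr using a by (subst integral_density) simp_all
  finally show "(\<integral>x. f (v + mat_exp (t *\<^sub>R C) *v x) \<partial>lborel) = exp (- t * trace C) * (\<integral>x. f x \<partial>lborel)"
    unfolding a_def .
  have "integrable lborel (\<lambda>x. f (v + mat_exp (t *\<^sub>R C) *v x))
      \<longleftrightarrow> integrable (distr lborel borel (\<lambda>x. v + mat_exp (t *\<^sub>R C) *v x)) f"
    by (subst integrable_distr_eq) simp_all
  also have "\<dots> \<longleftrightarrow> integrable lborel f"
    unfolding distr using a by (subst integrable_density) simp_all
  finally show "integrable lborel (\<lambda>x. f (v + mat_exp (t *\<^sub>R C) *v x)) \<longleftrightarrow> integrable lborel f" .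
qed

text \<open>
  The flow scales Lebesgue measure by a positive constant, so it preserves null sets.
\<close>

lemma AE_affine_flow_inverse:
  fixes C :: "real^'d::finite^'d"
  assumes "AE x in lborel. P x"
  shows "AE y in lborel. P (mat_exp ((- t) *\<^sub>R C) *v (y - v))"
proof -
  obtain N where N: "N \<in> null_sets lborel" "{x. \<not> P x} \<subseteq> N"
    using assms unfolding eventually_ae_filter by auto
  have [measurable]: "N \<in> sets borel" using N(1) by auto
  define f where "f y = (indicator N (mat_exp ((- t) *\<^sub>R C) *v (y - v)) :: ennreal)" for y
  have f: "f \<in> borel_measurable borel" unfolding f_def by measurable
  have "ennreal (exp (- t * trace C)) * (\<integral>\<^sup>+y. f y \<partial>lborel) = (\<integral>\<^sup>+x. f (v + mat_exp (t *\<^sub>R C) *v x) \<partial>lborel)"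
    by (rule nn_integral_affine_flow[OF f, symmetric])
  also have "\<dots> = (\<integral>\<^sup>+x. indicator N x \<partial>lborel)"
    by (simp add: f_def matrix_vector_mul_assoc mat_exp_inverse[simplified])
  also have "\<dots> = 0" using N(1) by (simp add: null_setsD1)
  finally have "(\<integral>\<^sup>+y. f y \<partial>lborel) = 0" by simp
  then have "AE y in lborel. f y = 0" using f by (simp add: nn_integral_0_iff_AE)
  then show ?thesis
    by eventually_elim (use N(2) in \<open>auto simp: f_def indicator_def split: if_splits\<close>)
qed

lemma borel_measurable_lebesgue_AE:
  fixes f g :: "'a::euclidean_space \<Rightarrow> real"
  assumes ae: "AE x in lborel. f x = g x" and g: "g \<in> borel_measurable borel"
  shows "f \<in> borel_measurable lebesgue"
proof (rule measurableI)
  fix U :: "real set" assume U: "U \<in> sets borel"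
  have "AE x in lebesgue. x \<in> g -` U \<longleftrightarrow> x \<in> f -` U"
    using AE_completion[OF ae] by eventually_elim auto
  moreover have "g -` U \<in> sets lebesgue" using measurable_sets[OF g U] by (simp add: sets_completionI_sets)
  ultimately show "f -` U \<inter> space lebesgue \<in> sets lebesgue"
    using completion.in_sets_AE[of "g -` U" "f -` U" lborel] by simp
qed simp

text \<open>
  For a Borel representative of \<open>\<psi>\<close> this is \<open>integral_affine_flow\<close>; passing to \<open>\<psi>\<close> itself uses that
  the flow preserves null sets, so that \<open>\<psi>\<close> composed with the inverse flow changes only on a null set.
\<close>

lemma affine_flow_change_of_variables:
  fixes C :: "real^'d::finite^'d" and v :: "real^'d" and t :: real
  assumes \<psi>: "integrable lebesgue \<psi>"
  defines "g \<equiv> \<lambda>y. exp (- t * trace C) * \<psi> (mat_exp ((- t) *\<^sub>R C) *v (y - v))"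
  shows "integrable lebesgue g"
    and "\<phi> \<in> borel_measurable borel \<Longrightarrow>
      (\<integral>z. \<psi> z * \<phi> (v + mat_exp (t *\<^sub>R C) *v z) \<partial>lebesgue) = (\<integral>y. g y * \<phi> y \<partial>lebesgue)"
proof -
  define T where "T y = mat_exp ((- t) *\<^sub>R C) *v (y - v)" for y
  define a where "a = exp (- t * trace C)"
  have T [measurable]: "T \<in> borel_measurable borel" unfolding T_def by measurable
  have TE: "T (v + mat_exp (t *\<^sub>R C) *v z) = z" for z
    unfolding T_def by (simp add: matrix_vector_mul_assoc mat_exp_inverse[simplified])
  obtain \<psi>' where \<psi>' [measurable]: "\<psi>' \<in> borel_measurable borel" and ae: "AE x in lborel. \<psi> x = \<psi>' x"
    using completion_ex_borel_measurable_real[OF borel_measurable_integrable[OF \<psi>]] by auto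
  have aeT: "AE y in lborel. \<psi> (T y) = \<psi>' (T y)"
    unfolding T_def by (rule AE_affine_flow_inverse[OF ae])
  have g: "g = (\<lambda>y. a * \<psi> (T y))" by (simp add: g_def a_def T_def)
  have aeg: "AE y in lborel. g y = a * \<psi>' (T y)"
    using aeT unfolding g by eventually_elim simp
  have \<psi>_meas: "\<psi> \<in> borel_measurable lebesgue" using \<psi> by auto
  have g_meas: "g \<in> borel_measurable lebesgue"
    by (rule borel_measurable_lebesgue_AE[OF aeg]) measurable
  have "integrable lebesgue \<psi>'"
    using \<psi> by (subst integrable_cong_AE[OF _ \<psi>_meas, of \<psi>'])
      (auto intro: AE_completion[OF AE_mp[OF ae]] measurable_completion)
  then have "integrable lborel \<psi>'" by (simp add: integrable_completion)
  then have "integrable lborel (\<lambda>y. \<psi>' (T y))"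
    using integrable_affine_flow[of "\<lambda>y. \<psi>' (T y)" v t C] by (simp add: TE)
  then have "integrable lebesgue (\<lambda>y. a * \<psi>' (T y))"
    by (simp add: integrable_completion)
  then show "integrable lebesgue g"
    by (subst integrable_cong_AE[OF g_meas _ AE_completion[OF aeg]]) (auto intro: measurable_completion)
  assume \<phi> [measurable]: "\<phi> \<in> borel_measurable borel"
  have "(\<integral>z. \<psi> z * \<phi> (v + mat_exp (t *\<^sub>R C) *v z) \<partial>lebesgue) = (\<integral>z. \<psi>' z * \<phi> (v + mat_exp (t *\<^sub>R C) *v z) \<partial>lebesgue)"
  proof (rule integral_cong_AE)
    show "AE z in lebesgue. \<psi> z * \<phi> (v + mat_exp (t *\<^sub>R C) *v z) = \<psi>' z * \<phi> (v + mat_exp (t *\<^sub>R C) *v z)"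
      using AE_completion[OF ae] by eventually_elim simp
    have "(\<lambda>z. \<phi> (v + mat_exp (t *\<^sub>R C) *v z)) \<in> borel_measurable lebesgue"
      by (intro measurable_completion) measurable
    then show "(\<lambda>z. \<psi> z * \<phi> (v + mat_exp (t *\<^sub>R C) *v z)) \<in> borel_measurable lebesgue"
      by (intro borel_measurable_times \<psi>_meas)
    show "(\<lambda>z. \<psi>' z * \<phi> (v + mat_exp (t *\<^sub>R C) *v z)) \<in> borel_measurable lebesgue"
      by (intro measurable_completion) measurable
  qed
  also have "\<dots> = (\<integral>z. \<psi>' (T (v + mat_exp (t *\<^sub>R C) *v z)) * \<phi> (v + mat_exp (t *\<^sub>R C) *v z) \<partial>lborel)"
    unfolding TE by (rule integral_completion) measurable
  also have "\<dots> = a * (\<integral>y. \<psi>' (T y) * \<phi> y \<partial>lborel)"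
    unfolding a_def by (rule integral_affine_flow[of "\<lambda>y. \<psi>' (T y) * \<phi> y"]) measurable
  also have "\<dots> = (\<integral>y. a * \<psi>' (T y) * \<phi> y \<partial>lborel)" by (simp add: mult.assoc)
  also have "\<dots> = (\<integral>y. a * \<psi>' (T y) * \<phi> y \<partial>lebesgue)"
    by (rule integral_completion[symmetric]) measurable
  also have "\<dots> = (\<integral>y. g y * \<phi> y \<partial>lebesgue)"
  proof (rule integral_cong_AE)
    show "AE y in lebesgue. a * \<psi>' (T y) * \<phi> y = g y * \<phi> y"
      using AE_completion[OF aeg] by eventually_elim simp
    show "(\<lambda>y. a * \<psi>' (T y) * \<phi> y) \<in> borel_measurable lebesgue"
      by (intro measurable_completion) measurable
    show "(\<lambda>y. g y * \<phi> y) \<in> borel_measurable lebesgue"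
      by (intro borel_measurable_times g_meas measurable_completion) measurable
  qed
  finally show "(\<integral>z. \<psi> z * \<phi> (v + mat_exp (t *\<^sub>R C) *v z) \<partial>lebesgue) = (\<integral>y. g y * \<phi> y \<partial>lebesgue)" .
qed

theorem proposition3p1:
  fixes M :: "'w measure"
    and F :: "real \<Rightarrow> 'w measure"
    and B :: "real \<Rightarrow> 'w \<Rightarrow> real^'d::finite"
    and \<nu> :: "(real^'d) measure"
    and N :: "'w \<Rightarrow> (real \<times> (real^'d)) measure"
    and \<sigma> C :: "real^'d^'d"
    and K :: "real^'d"
    and b :: "real^'d \<Rightarrow> real^'d"
    and G :: "real^'d \<Rightarrow> real^'d \<Rightarrow> real^'d"
    and E :: "(real^'d) set"
    and Z0 IB IN :: "real \<Rightarrow> 'w \<Rightarrow> real^'d"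
    and \<N> :: "'w set"
    and p :: real
    and \<psi> :: "real^'d \<Rightarrow> real"
  assumes basis: "usual_filtered_prob_space M F"
    and BM: "brownian_motion M F B"
    and levy: "levy_measure \<nu>"
    and PRM: "poisson_random_measure M F \<nu> N"
    and indep: "independent_BN M B N"
    and sigma: "invertible \<sigma>"
    and b: "\<And>z. b z = C *v z + K"
    and E: "E = {x. 0 < norm x \<and> norm x < 1}"
    and G_indep: "\<And>z x. x \<in> E \<Longrightarrow> G z x = G 0 x"
    and G_meas: "G 0 \<in> borel_measurable (restrict_space borel E)"
    and G_L2: "(\<integral>\<^sup>+x\<in>E. ennreal ((norm (G 0 x))\<^sup>2) \<partial>\<nu>) < \<infinity>"
    and G_bdd: "bounded (G 0 ` E)"
    and IB: "is_ito_integral M F B (\<lambda>s \<omega>. \<sigma>) IB"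
    and IN: "is_compensated_poisson_integral M F \<nu> N E (\<lambda>s x \<omega>. G 0 x) IN"
    and Z0_adapted: "adapted F Z0"
    and null: "\<N> \<in> null_sets M"
    and Z0_cadlag: "\<And>\<omega>. \<omega> \<in> space M - \<N> \<Longrightarrow> cadlag (\<lambda>t. Z0 t \<omega>)"
    and Z0_eq: "\<And>\<omega> t. \<omega> \<in> space M - \<N> \<Longrightarrow> 0 \<le> t \<Longrightarrow>
        Z0 t \<omega> = IB t \<omega> + (LINT s:{0..t}|lborel. b (left_lim (\<lambda>u. Z0 u \<omega>) s)) + IN t \<omega>"
    and p: "p > real CARD('d) / 4"
    and psi: "integrable lebesgue \<psi>"
  shows "\<forall>\<omega>\<in>space M - \<N>. \<forall>t\<ge>0.
    given_by_L1 (Y_dist p C Z0 \<psi> t \<omega>)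
      (\<lambda>z. exp (- t * trace C) * translate (Z0 t \<omega>) (psi_t C \<psi> t) z)"
proof (intro ballI allI impI)
  fix \<omega> t
  let ?w = "\<lambda>z. affine_flow C Z0 z t \<omega>"
  have "(\<lambda>z. Z0 t \<omega> + mat_exp (t *\<^sub>R C) *v z) \<in> borel_measurable lebesgue"
    by (intro measurable_completion) measurable
  then have w: "?w \<in> borel_measurable lebesgue" by (simp add: affine_flow_def)
  have Y: "Y_dist p C Z0 \<psi> t \<omega> \<phi> = (\<integral>z. \<psi> z * sfun \<phi> (Z0 t \<omega> + mat_exp (t *\<^sub>R C) *v z) \<partial>lebesgue)" for \<phi>
    unfolding Y_dist_def hs_integral_dirac_eq[OF p psi w] by (simp add: affine_flow_def)
  have sfun: "sfun \<phi> \<in> borel_measurable borel" for \<phi> :: "'d schwartz"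
    using sfun[of \<phi>] by (intro smooth_measurable) simp
  show "given_by_L1 (Y_dist p C Z0 \<psi> t \<omega>)
      (\<lambda>z. exp (- t * trace C) * translate (Z0 t \<omega>) (psi_t C \<psi> t) z)"
    unfolding given_by_L1_def translate_def psi_t_def
  proof (intro conjI allI)
    show "integrable lebesgue (\<lambda>z. exp (- t * trace C) * \<psi> (mat_exp ((- t) *\<^sub>R C) *v (z - Z0 t \<omega>)))"
      by (rule affine_flow_change_of_variables(1)[OF psi])
    show "Y_dist p C Z0 \<psi> t \<omega> \<phi>
        = (\<integral>z. exp (- t * trace C) * \<psi> (mat_exp ((- t) *\<^sub>R C) *v (z - Z0 t \<omega>)) * sfun \<phi> z \<partial>lebesgue)" for \<phi>
      unfolding Y by (rule affine_flow_change_of_variables(2)[OF psi sfun])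
  qed
qed

end
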